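(* Let $\xi,\eta\in L_G^1(\Omega)$ and $F(\lambda):=\hat{\mathbb{E}}[\xi+\lambda\eta]$, $\lambda\in\mathbb{R}$. Then the right-derivative of $F$ at $0$, $F'_+(0)=\lim_{0<\varepsilon\downarrow0}\frac{F(\varepsilon)-F(0)}{\varepsilon}$, is given by $$F'_+(0)=\max_{P\in\mathcal{P}_{\{\xi\}}}E_P[\eta]=\hat{\mathbb{E}}_{\{\xi\}}[\eta],$$ where $\hat{\mathbb{E}}_{\{\xi\}}[\eta]:=\sup_{P\in\mathcal{P}_{\{\xi\}}}E_P[\eta]$, $\eta\in L_G^1(\Omega)$, is a sublinear expectation, dominated by $\hat{\mathbb{E}}$, i.e. $\hat{\mathbb{E}}_{\{\xi\}}[\,\cdot\,]\le\hat{\mathbb{E}}[\,\cdot\,]$.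
   Context: Fix $T>0$ and $0<\underline\sigma^2\le\overline\sigma^2<\infty$; $G(a)=\frac12(\overline\sigma^2a^+-\underline\sigma^2a^-)$. $\Omega=C([0,T];\mathbb{R})$ with the uniform distance and Borel $\sigma$-field $\mathcal{B}(\Omega)$; $B$ is the coordinate process; $L_{ip}(\Omega)$ is the set of random variables $\varphi(B_{t_1},B_{t_2}-B_{t_1},\dots,B_{t_n}-B_{t_{n-1}})$ with $n\ge1$, $0\le t_1<\dots<t_n\le T$, $\varphi$ bounded Lipschitz. $\hat{\mathbb{E}}$ is the $G$-expectation, i.e. the sublinear expectation on $L_{ip}(\Omega)$ under which $B$ is a one-dimensional $G$-Brownian motion: $\hat{\mathbb{E}}[\varphi(B_{t_1},\dots,B_{t_n}-B_{t_{n-1}})]=\widetilde{\mathbb{E}}[\varphi(\sqrt{t_1}\xi_1,\dots,\sqrt{t_n-t_{n-1}}\xi_n)]$, where on some sublinear expectation space the $\xi_i$ are identically distributed and $G$-normal (with $\widetilde{\mathbb{E}}[\xi_i^2]=\overline\sigma^2$, $-\widetilde{\mathbb{E}}[-\xi_i^2]=\underline\sigma^2$), each $\xi_i$ independent of $(\xi_1,\dots,\xi_{i-1})$ in Peng's sense. $L_G^1(\Omega)$ is the completion of $L_{ip}(\Omega)$ under $\hat{\mathbb{E}}[|\cdot|]$. $\mathcal{P}=\{P\text{ probability on }(\Omega,\mathcal{B}(\Omega)):E_P[X]\le\hat{\mathbb{E}}[X]\ \forall X\in L_G^1(\Omega)\}$; it is known to be nonempty, convex, weakly compact, with $\hat{\mathbb{E}}[\xi]=\max_{P\in\mathcal{P}}E_P[\xi]$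 for all $\xi\in L_G^1(\Omega)$. For $\xi\in L_G^1(\Omega)$, $\mathcal{P}_{\{\xi\}}:=\{P\in\mathcal{P}:E_P[\xi]=\hat{\mathbb{E}}[\xi]\}$ (nonempty). A sublinear expectation is a functional that is monotone, constant preserving, sub-additive and positively homogeneous. *)

theory Defs
  imports "HOL-Probability.Probability"
begin

section \<open>Sublinear expectations\<close>

text \<open>
  The notion is used twice, for functionals on a space of real functions and for functionals
  on a completion of such a space. It is therefore stated for a carrier \<open>V\<close> with a
  preorder \<open>le\<close>, constants \<open>cst\<close>, addition \<open>add\<close> and scalar multiplication \<open>scl\<close>.
\<close>

definition sublinear_expectation ::
    "'v set \<Rightarrow> ('v \<Rightarrow> 'v \<Rightarrow> bool) \<Rightarrow> (real \<Rightarrow> 'v) \<Rightarrow> ('v \<Rightarrow> 'v \<Rightarrow> 'v) \<Rightarrow> (real \<Rightarrow> 'v \<Rightarrow> 'v)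
      \<Rightarrow> ('v \<Rightarrow> real) \<Rightarrow> bool" where
  "sublinear_expectation V le cst add scl E \<longleftrightarrow>
     (\<forall>X\<in>V. \<forall>Y\<in>V. le X Y \<longrightarrow> E X \<le> E Y) \<and>
     (\<forall>c. E (cst c) = c) \<and>
     (\<forall>X\<in>V. \<forall>Y\<in>V. E (add X Y) \<le> E X + E Y) \<and>
     (\<forall>X\<in>V. \<forall>a\<ge>0. E (scl a X) = a * E X)"

text \<open>
  Vectors of \<open>\<real>\<^sup>n\<close> are the coordinates \<open>i < n\<close> of a function on \<open>nat\<close>. The Lipschitz
  estimates below force \<open>\<phi>\<close> to ignore all other coordinates.
\<close>

definition vnorm :: "nat \<Rightarrow> (nat \<Rightarrow> real) \<Rightarrow> real" where
  "vnorm n x = L2_set x {..<n}"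

definition bdd_lipschitz :: "nat \<Rightarrow> ((nat \<Rightarrow> real) \<Rightarrow> real) set" where
  "bdd_lipschitz n = {\<phi>. (\<exists>M. \<forall>x. \<bar>\<phi> x\<bar> \<le> M) \<and>
     (\<exists>C\<ge>0. \<forall>x y. \<bar>\<phi> x - \<phi> y\<bar> \<le> C * vnorm n (\<lambda>i. x i - y i))}"

text \<open>Peng's test functions: locally Lipschitz with polynomial growth.\<close>

definition loc_lipschitz :: "nat \<Rightarrow> ((nat \<Rightarrow> real) \<Rightarrow> real) set" where
  "loc_lipschitz n = {\<phi>. \<exists>C\<ge>0. \<exists>m::nat. \<forall>x y.
     \<bar>\<phi> x - \<phi> y\<bar> \<le> C * (1 + vnorm n x ^ m + vnorm n y ^ m) * vnorm n (\<lambda>i. x i - y i)}"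

definition sublinear_expectation_space ::
    "('w \<Rightarrow> real) set \<Rightarrow> (('w \<Rightarrow> real) \<Rightarrow> real) \<Rightarrow> bool" where
  "sublinear_expectation_space H E \<longleftrightarrow>
     (\<forall>c. (\<lambda>_. c) \<in> H) \<and>
     (\<forall>X\<in>H. \<forall>Y\<in>H. (\<lambda>w. X w + Y w) \<in> H) \<and>
     (\<forall>X\<in>H. \<forall>a. (\<lambda>w. a * X w) \<in> H) \<and>
     (\<forall>X\<in>H. (\<lambda>w. \<bar>X w\<bar>) \<in> H) \<and>
     (\<forall>n X \<phi>. (\<forall>i<n. X i \<in> H) \<longrightarrow> \<phi> \<in> loc_lipschitz n \<longrightarrow> (\<lambda>w. \<phi> (\<lambda>i. X i w)) \<in> H) \<and>
     sublinear_expectation H (\<lambda>X Y. \<forall>w. X w \<le> Y w) (\<lambda>c _. c)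
       (\<lambda>X Y w. X w + Y w) (\<lambda>a X w. a * X w) E"

definition ident_distr :: "(('w \<Rightarrow> real) \<Rightarrow> real) \<Rightarrow> ('w \<Rightarrow> real) \<Rightarrow> ('w \<Rightarrow> real) \<Rightarrow> bool" where
  "ident_distr E X Y \<longleftrightarrow>
     (\<forall>\<phi>\<in>loc_lipschitz 1. E (\<lambda>w. \<phi> (\<lambda>_. X w)) = E (\<lambda>w. \<phi> (\<lambda>_. Y w)))"

text \<open>\<open>Y\<close> is independent of \<open>(X 0, \<dots>, X (n - 1))\<close> in Peng's sense (not a symmetric relation).\<close>

definition peng_indep ::
    "(('w \<Rightarrow> real) \<Rightarrow> real) \<Rightarrow> nat \<Rightarrow> (nat \<Rightarrow> 'w \<Rightarrow> real) \<Rightarrow> ('w \<Rightarrow> real) \<Rightarrow> bool" where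
  "peng_indep E n X Y \<longleftrightarrow> (\<forall>\<phi>\<in>loc_lipschitz (Suc n).
     E (\<lambda>w. \<phi> (\<lambda>i. if i < n then X i w else Y w)) =
     E (\<lambda>w. E (\<lambda>v. \<phi> (\<lambda>i. if i < n then X i w else Y v))))"

definition G_fun :: "real \<Rightarrow> real \<Rightarrow> real \<Rightarrow> real" where
  "G_fun \<sigma>l \<sigma>u a = (\<sigma>u\<^sup>2 * max a 0 - \<sigma>l\<^sup>2 * max (- a) 0) / 2"

text \<open>
  Peng's definition of a (centred) \<open>G\<close>-normal variable. Taking \<open>a = 1\<close> and \<open>a = - 1\<close> in the
  last conjunct gives \<open>E[X\<^sup>2] = \<sigma>u\<^sup>2\<close> and \<open>- E[- X\<^sup>2] = \<sigma>l\<^sup>2\<close>.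
\<close>

definition G_normal ::
    "('w \<Rightarrow> real) set \<Rightarrow> (('w \<Rightarrow> real) \<Rightarrow> real) \<Rightarrow> real \<Rightarrow> real \<Rightarrow> ('w \<Rightarrow> real) \<Rightarrow> bool" where
  "G_normal H E \<sigma>l \<sigma>u X \<longleftrightarrow> X \<in> H \<and>
     (\<exists>X'\<in>H. ident_distr E X' X \<and> peng_indep E 1 (\<lambda>_. X) X' \<and>
        (\<forall>a\<ge>0. \<forall>b\<ge>0. ident_distr E (\<lambda>w. a * X w + b * X' w) (\<lambda>w. sqrt (a\<^sup>2 + b\<^sup>2) * X w))) \<and>
     (\<forall>a. E (\<lambda>w. a * (X w)\<^sup>2) / 2 = G_fun \<sigma>l \<sigma>u a)"

definition G_normal_seq ::
    "('w \<Rightarrow> real) set \<Rightarrow> (('w \<Rightarrow> real) \<Rightarrow> real) \<Rightarrow> real \<Rightarrow> real \<Rightarrow> (nat \<Rightarrow> 'w \<Rightarrow> real) \<Rightarrow> bool" where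
  "G_normal_seq H E \<sigma>l \<sigma>u Z \<longleftrightarrow>
     (\<forall>i. G_normal H E \<sigma>l \<sigma>u (Z i)) \<and>
     (\<forall>i j. ident_distr E (Z i) (Z j)) \<and>
     (\<forall>i. peng_indep E i Z (Z i))"


section \<open>Path space and G-expectation\<close>

text \<open>\<open>C([0,T];\<real>)\<close> with the uniform distance; paths are extensional functions on \<open>{0..T}\<close>.\<close>

definition path_space :: "real \<Rightarrow> (real \<Rightarrow> real) metric" where
  "path_space T = cfunspace (top_of_set {0..T}) euclidean_metric"

definition path_borel :: "real \<Rightarrow> (real \<Rightarrow> real) measure" where
  "path_borel T = sigma (mspace (path_space T)) {U. openin (mtopology_of (path_space T)) U}"

definition time_grid :: "real \<Rightarrow> nat \<Rightarrow> (nat \<Rightarrow> real) \<Rightarrow> bool" where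
  "time_grid T n t \<longleftrightarrow> 1 \<le> n \<and> 0 \<le> t 0 \<and> (\<forall>i. Suc i < n \<longrightarrow> t i < t (Suc i)) \<and> t (n - 1) \<le> T"

text \<open>
  With \<open>\<omega>\<close> a path, \<open>increment t \<omega>\<close> is \<open>(B\<^sub>t\<^sub>1, B\<^sub>t\<^sub>2 - B\<^sub>t\<^sub>1, \<dots>)\<close>; with \<open>\<omega>\<close> the identity it is
  \<open>(t\<^sub>1, t\<^sub>2 - t\<^sub>1, \<dots>)\<close>. Indices start at 0.
\<close>

definition increment :: "(nat \<Rightarrow> real) \<Rightarrow> (real \<Rightarrow> real) \<Rightarrow> nat \<Rightarrow> real" where
  "increment t \<omega> i = (if i = 0 then \<omega> (t 0) else \<omega> (t i) - \<omega> (t (i - 1)))"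

text \<open>
  Cylinder variables are written as functions of all \<open>\<omega> :: real \<Rightarrow> real\<close>. Since finitely many
  values of a continuous path are arbitrary, such a function is determined by its values on
  the path space.
\<close>

definition Lip_cyl :: "real \<Rightarrow> ((real \<Rightarrow> real) \<Rightarrow> real) set" where
  "Lip_cyl T = {X. \<exists>n t \<phi>. time_grid T n t \<and> \<phi> \<in> bdd_lipschitz n \<and> X = (\<lambda>\<omega>. \<phi> (increment t \<omega>))}"

text \<open>\<open>E\<close> is the expectation on \<open>Lip_cyl T\<close> under which the coordinate process is a
  \<open>G\<close>-Brownian motion, expressed through the sequence \<open>Z\<close> on the space with expectation \<open>E'\<close>.\<close>

definition G_expectation ::
    "real \<Rightarrow> (('w \<Rightarrow> real) \<Rightarrow> real) \<Rightarrow> (nat \<Rightarrow> 'w \<Rightarrow> real) \<Rightarrow> (((real \<Rightarrow> real) \<Rightarrow> real) \<Rightarrow> real) \<Rightarrow> bool"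
  where
  "G_expectation T E' Z E \<longleftrightarrow>
     (\<forall>n t \<phi>. time_grid T n t \<longrightarrow> \<phi> \<in> bdd_lipschitz n \<longrightarrow>
        E (\<lambda>\<omega>. \<phi> (increment t \<omega>)) = E' (\<lambda>w. \<phi> (\<lambda>i. sqrt (increment t (\<lambda>s. s) i) * Z i w)))"


section \<open>The completion of the cylinder variables\<close>

type_synonym cyl_seq = "nat \<Rightarrow> (real \<Rightarrow> real) \<Rightarrow> real"

definition LG_Cauchy :: "real \<Rightarrow> (((real \<Rightarrow> real) \<Rightarrow> real) \<Rightarrow> real) \<Rightarrow> cyl_seq set" where
  "LG_Cauchy T E = {X. (\<forall>n. X n \<in> Lip_cyl T) \<and>
     (\<forall>e>0. \<exists>N. \<forall>m\<ge>N. \<forall>n\<ge>N. E (\<lambda>\<omega>. \<bar>X m \<omega> - X n \<omega>\<bar>) < e)}"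

definition LG_rel :: "real \<Rightarrow> (((real \<Rightarrow> real) \<Rightarrow> real) \<Rightarrow> real) \<Rightarrow> (cyl_seq \<times> cyl_seq) set" where
  "LG_rel T E = {(X, Y). X \<in> LG_Cauchy T E \<and> Y \<in> LG_Cauchy T E \<and>
     (\<lambda>n. E (\<lambda>\<omega>. \<bar>X n \<omega> - Y n \<omega>\<bar>)) \<longlonglongrightarrow> 0}"

definition LG1 :: "real \<Rightarrow> (((real \<Rightarrow> real) \<Rightarrow> real) \<Rightarrow> real) \<Rightarrow> cyl_seq set set" where
  "LG1 T E = LG_Cauchy T E // LG_rel T E"

definition LG_const :: "real \<Rightarrow> (((real \<Rightarrow> real) \<Rightarrow> real) \<Rightarrow> real) \<Rightarrow> real \<Rightarrow> cyl_seq set" where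
  "LG_const T E c = LG_rel T E `` {\<lambda>_ _. c}"

definition LG_add ::
    "real \<Rightarrow> (((real \<Rightarrow> real) \<Rightarrow> real) \<Rightarrow> real) \<Rightarrow> cyl_seq set \<Rightarrow> cyl_seq set \<Rightarrow> cyl_seq set" where
  "LG_add T E \<xi> \<eta> = (\<Union>X\<in>\<xi>. \<Union>Y\<in>\<eta>. LG_rel T E `` {\<lambda>n \<omega>. X n \<omega> + Y n \<omega>})"

definition LG_scale ::
    "real \<Rightarrow> (((real \<Rightarrow> real) \<Rightarrow> real) \<Rightarrow> real) \<Rightarrow> real \<Rightarrow> cyl_seq set \<Rightarrow> cyl_seq set" where
  "LG_scale T E a \<xi> = (\<Union>X\<in>\<xi>. LG_rel T E `` {\<lambda>n \<omega>. a * X n \<omega>})"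

text \<open>\<open>\<xi> \<le> \<eta>\<close> means that the positive part of \<open>\<xi> - \<eta>\<close> vanishes in the completion.\<close>

definition LG_le :: "(((real \<Rightarrow> real) \<Rightarrow> real) \<Rightarrow> real) \<Rightarrow> cyl_seq set \<Rightarrow> cyl_seq set \<Rightarrow> bool" where
  "LG_le E \<xi> \<eta> \<longleftrightarrow> (\<forall>X\<in>\<xi>. \<forall>Y\<in>\<eta>. (\<lambda>n. E (\<lambda>\<omega>. max (X n \<omega> - Y n \<omega>) 0)) \<longlonglongrightarrow> 0)"

definition G_exp :: "(((real \<Rightarrow> real) \<Rightarrow> real) \<Rightarrow> real) \<Rightarrow> cyl_seq set \<Rightarrow> real" where
  "G_exp E \<xi> = (THE r. \<forall>X\<in>\<xi>. (\<lambda>n. E (X n)) \<longlonglongrightarrow> r)"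


section \<open>Representing probabilities\<close>

text \<open>
  Under a probability \<open>P\<close>, an element of the completion is regarded as a random variable by
  means of its \<open>L\<^sup>1(P)\<close>-limit, which is unique up to \<open>P\<close>-null sets. Such a limit exists for
  every \<open>P\<close> dominated by the \<open>G\<close>-expectation on cylinder variables.
\<close>

definition represents ::
    "(real \<Rightarrow> real) measure \<Rightarrow> cyl_seq set \<Rightarrow> ((real \<Rightarrow> real) \<Rightarrow> real) \<Rightarrow> bool" where
  "represents P \<xi> Y \<longleftrightarrow> integrable P Y \<and>
     (\<forall>X\<in>\<xi>. (\<forall>n. integrable P (X n)) \<and> (\<lambda>n. \<integral>\<omega>. \<bar>X n \<omega> - Y \<omega>\<bar> \<partial>P) \<longlonglongrightarrow> 0)"

definition P_exp :: "(real \<Rightarrow> real) measure \<Rightarrow> cyl_seq set \<Rightarrow> real" where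
  "P_exp P \<xi> = (\<integral>\<omega>. (SOME Y. represents P \<xi> Y) \<omega> \<partial>P)"

definition rep_probs ::
    "real \<Rightarrow> (((real \<Rightarrow> real) \<Rightarrow> real) \<Rightarrow> real) \<Rightarrow> (real \<Rightarrow> real) measure set" where
  "rep_probs T E = {P. prob_space P \<and> sets P = sets (path_borel T) \<and>
     (\<forall>\<xi>\<in>LG1 T E. (\<exists>Y. represents P \<xi> Y) \<and> P_exp P \<xi> \<le> G_exp E \<xi>)}"

definition max_probs ::
    "real \<Rightarrow> (((real \<Rightarrow> real) \<Rightarrow> real) \<Rightarrow> real) \<Rightarrow> cyl_seq set \<Rightarrow> (real \<Rightarrow> real) measure set" where
  "max_probs T E \<xi> = {P \<in> rep_probs T E. P_exp P \<xi> = G_exp E \<xi>}"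

definition crit_exp ::
    "real \<Rightarrow> (((real \<Rightarrow> real) \<Rightarrow> real) \<Rightarrow> real) \<Rightarrow> cyl_seq set \<Rightarrow> cyl_seq set \<Rightarrow> real" where
  "crit_exp T E \<xi> \<eta> = (SUP P\<in>max_probs T E \<xi>. P_exp P \<eta>)"

end

theory Submission
  imports Defs "HOL-Library.Function_Algebras"
begin

text \<open>
  Why the theorem holds. Write \<open>p\<close> for the \<open>G\<close>-expectation on the completion, a sublinear
  functional. Its directional derivative at \<open>\<xi>\<close>, \<open>q \<zeta> = lim (p (\<xi> + \<epsilon> \<zeta>) - p \<xi>) / \<epsilon>\<close> as \<open>\<epsilon>\<close> decreases to 0,
  is again sublinear, satisfies \<open>q \<le> p\<close>, and has \<open>q \<xi> = p \<xi>\<close> and \<open>q (- \<xi>) = - p \<xi>\<close>. If \<open>P\<close> is a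
  representing probability with \<open>E\<^sub>P \<xi> = p \<xi>\<close>, then \<open>E\<^sub>P \<eta> \<le> (p (\<xi> + \<epsilon> \<eta>) - p \<xi>) / \<epsilon>\<close> for all \<open>\<epsilon> > 0\<close>,
  hence \<open>E\<^sub>P \<eta> \<le> q \<eta>\<close>. For equality, differentiate \<open>q\<close> once more, at \<open>\<eta>\<close>, and take a linear functional
  \<open>f\<close> below this second derivative (Hahn-Banach). Then \<open>f \<le> q \<le> p\<close>, \<open>f \<xi> = p \<xi>\<close> and \<open>f \<eta> = q \<eta>\<close>. So
  it suffices that every linear functional below \<open>p\<close> is the expectation under a probability on the
  path space; the sublinearity of the supremum over the maximizers and its domination by \<open>p\<close> are then
  direct.

  The representation (\<open>linear_functional_represented\<close>) replaces the weak compactness of the set of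
  representing probabilities. Brownian scaling gives
  \<open>E (min 1 (a * \<bar>B\<^sub>t - B\<^sub>s\<bar>) ^ 4) \<le> a ^ 4 * C * (t - s)\<^sup>2\<close>. Restricted to cylinder variables, a linear functional
  below \<open>p\<close> is positive, and this bound makes it \<open>\<sigma>\<close>-smooth, by Tychonoff's theorem and Dini's argument
  on a product of compact intervals (\<open>sigma_smooth\<close>). The Daniell-Stone theorem
  (\<open>Daniell_Stone\<close>) then yields a probability on the space of all real functions. By
  Kolmogorov's continuity criterion, proved by dyadic chaining and the Borel-Cantelli lemma, the coordinate
  process has a continuous modification, whose law is the probability on the path space
  (\<open>path_measure_exists\<close>). Completeness of \<open>L\<^sup>1\<close> extends the representation to the completion.
\<close>

section \<open>Sublinear functionals and the Hahn-Banach theorem\<close>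

text \<open>
  Subadditivity and positive homogeneity on a linear subspace. Functionals are total functions;
  their values outside \<open>V\<close> are irrelevant.
\<close>

definition sublinear_on :: "'v::real_vector set \<Rightarrow> ('v \<Rightarrow> real) \<Rightarrow> bool" where
  "sublinear_on V p \<longleftrightarrow> (\<forall>x\<in>V. \<forall>y\<in>V. p (x + y) \<le> p x + p y) \<and>
     (\<forall>x\<in>V. \<forall>a\<ge>0. p (a *\<^sub>R x) = a * p x)"

lemma sublinear_onI:
  assumes "\<And>x y. x \<in> V \<Longrightarrow> y \<in> V \<Longrightarrow> p (x + y) \<le> p x + p y"
    and "\<And>x a. x \<in> V \<Longrightarrow> 0 \<le> a \<Longrightarrow> p (a *\<^sub>R x) = a * p x"
  shows "sublinear_on V p"
  using assms by (auto simp: sublinear_on_def)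

lemma sublinear_on_add: "sublinear_on V p \<Longrightarrow> x \<in> V \<Longrightarrow> y \<in> V \<Longrightarrow> p (x + y) \<le> p x + p y"
  by (auto simp: sublinear_on_def)

lemma sublinear_on_scale: "sublinear_on V p \<Longrightarrow> x \<in> V \<Longrightarrow> 0 \<le> a \<Longrightarrow> p (a *\<^sub>R x) = a * p x"
  by (auto simp: sublinear_on_def)

lemma sublinear_on_zero: "subspace V \<Longrightarrow> sublinear_on V p \<Longrightarrow> p 0 = 0"
  using sublinear_on_scale[of V p 0 0] by (auto simp: subspace_def)

lemma sublinear_on_minus:
  assumes "subspace V" "sublinear_on V p" "x \<in> V"
  shows "- p (- x) \<le> p x"
  using sublinear_on_add[OF assms(2,3), of "- x"] sublinear_on_zero[OF assms(1,2)]
    subspace_neg[OF assms(1,3)] by simp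

text \<open>
  The one-sided directional derivative of a sublinear functional \<open>p\<close> at \<open>x\<close> exists because the
  difference quotient is monotone in the step and bounded below by \<open>- p (- y)\<close>. It is again
  sublinear, it is dominated by \<open>p\<close>, and by its values at \<open>x\<close> and \<open>- x\<close> every linear functional
  below it agrees with \<open>p\<close> at \<open>x\<close>.
\<close>

lemma sublinear_directional_derivative:
  fixes V :: "'v::real_vector set"
  assumes V: "subspace V" and p: "sublinear_on V p" and x: "x \<in> V"
  obtains q where "sublinear_on V q" "\<And>y. y \<in> V \<Longrightarrow> q y \<le> p y" "q x = p x" "q (- x) = - p x"
    "\<And>y. y \<in> V \<Longrightarrow> ((\<lambda>e. (p (x + e *\<^sub>R y) - p x) / e) \<longlongrightarrow> q y) (at_right 0)"
proof -
  define d where "d y e = (p (x + e *\<^sub>R y) - p x) / e" for y e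
  define q where "q y = (INF e\<in>{0<..}. d y e)" for y
  have mem: "x + e *\<^sub>R y \<in> V" if "y \<in> V" for e y
    using V x that by (simp add: subspace_add subspace_scale)
  have mono: "d y e \<le> d y e'" if y: "y \<in> V" and e: "0 < e" "e \<le> e'" for y e e'
  proof -
    define s where "s = e / e'"
    have s: "0 < s" "s \<le> 1" "s * e' = e" using e by (auto simp: s_def)
    \<comment> \<open>convexity along the segment from the base point to the larger step\<close>
    have "x + e *\<^sub>R y = (1 - s) *\<^sub>R x + s *\<^sub>R (x + e' *\<^sub>R y)"
      using s by (simp add: algebra_simps)
    then have "p (x + e *\<^sub>R y) \<le> (1 - s) * p x + s * p (x + e' *\<^sub>R y)"
      using sublinear_on_add[OF p, of "(1 - s) *\<^sub>R x" "s *\<^sub>R (x + e' *\<^sub>R y)"]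
        sublinear_on_scale[OF p] x mem[OF y] V s by (simp add: subspace_scale)
    then have "p (x + e *\<^sub>R y) - p x \<le> s * (p (x + e' *\<^sub>R y) - p x)"
      by (simp add: algebra_simps)
    then have "d y e \<le> s * (p (x + e' *\<^sub>R y) - p x) / e"
      unfolding d_def using e by (intro divide_right_mono) auto
    also have "\<dots> = d y e'" using e by (simp add: d_def s_def)
    finally show ?thesis .
  qed
  have lower: "- p (- y) \<le> d y e" if y: "y \<in> V" and e: "0 < e" for y e
  proof -
    have "p (x + e *\<^sub>R y + e *\<^sub>R (- y)) \<le> p (x + e *\<^sub>R y) + e * p (- y)"
      using sublinear_on_add[OF p mem[OF y], of "e *\<^sub>R (- y)" e] sublinear_on_scale[OF p, of "- y" e]
        V y e by (simp add: subspace_scale subspace_neg del: scaleR_minus_right)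
    then show ?thesis using e by (simp add: d_def field_simps)
  qed
  have upper: "d y e \<le> p y" if y: "y \<in> V" and e: "0 < e" for y e
    using sublinear_on_add[OF p x, of "e *\<^sub>R y"] sublinear_on_scale[OF p y, of e] V y e
    by (simp add: d_def field_simps subspace_scale)
  have bdd: "bdd_below (d y ` {0<..})" if "y \<in> V" for y
    using lower[OF that] by (intro bdd_belowI2[of _ "- p (- y)"]) auto
  have q_le_d: "q y \<le> d y e" if "y \<in> V" "0 < e" for y e
    unfolding q_def using bdd[OF that(1)] that(2) by (intro cINF_lower) auto
  have lim: "(d y \<longlongrightarrow> q y) (at_right 0)" if y: "y \<in> V" for y
  proof (rule order_tendstoI)
    fix a assume "a < q y"
    then show "\<forall>\<^sub>F e in at_right 0. a < d y e"
      by (intro eventually_mono[OF eventually_at_right_less]) (use q_le_d[OF y] in \<open>force intro: less_le_trans\<close>)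
  next
    fix a assume "q y < a"
    then obtain e where e: "0 < e" "d y e < a"
      unfolding q_def using cINF_less_iff[OF _ bdd[OF y]] by auto
    have "d y e' < a" if "0 < e'" "e' < e" for e'
      using mono[OF y that(1), of e] that e by simp
    then show "\<forall>\<^sub>F e in at_right 0. d y e < a"
      unfolding eventually_at_right[OF e(1)] using e(1) by auto
  qed
  have scale: "q (a *\<^sub>R y) = a * q y" if y: "y \<in> V" and a: "0 \<le> a" for y a
  proof (cases "a = 0")
    case True
    have "d (0 *\<^sub>R y) = (\<lambda>_. 0)" by (auto simp: d_def)
    with lim[of "0 *\<^sub>R y"] V have "((\<lambda>_::real. 0) \<longlongrightarrow> q (0 *\<^sub>R y)) (at_right (0::real))"
      by (simp add: subspace_0)
    then have "q (0 *\<^sub>R y) = 0" using tendsto_const_iff trivial_limit_at_right_real by metis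
    with True show ?thesis by simp
  next
    case False
    with a have a: "0 < a" by simp
    have "((\<lambda>e. a * e) \<longlongrightarrow> a * 0) (at_right 0)" by (intro tendsto_intros)
    then have "filterlim (\<lambda>e. a * e) (at_right 0) (at_right (0::real))"
      using a by (auto simp: filterlim_at intro!: eventually_mono[OF eventually_at_right_less])
    then have "((\<lambda>e. a * d y (a * e)) \<longlongrightarrow> a * q y) (at_right 0)"
      by (intro tendsto_intros filterlim_compose[OF lim[OF y]])
    moreover have "(\<lambda>e. a * d y (a * e)) = d (a *\<^sub>R y)"
      using a by (auto simp: d_def fun_eq_iff mult.commute)
    ultimately have "(d (a *\<^sub>R y) \<longlongrightarrow> a * q y) (at_right 0)" by simp
    with lim[of "a *\<^sub>R y"] show ?thesis
      using V y tendsto_unique[OF trivial_limit_at_right_real] by (blast intro: subspace_scale)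
  qed
  have add: "q (y + z) \<le> q y + q z" if y: "y \<in> V" and z: "z \<in> V" for y z
  proof -
    \<comment> \<open>subadditivity as midpoint convexity: both directions are taken with the doubled step\<close>
    have half: "2 * q ((1 / 2) *\<^sub>R (y + z)) = q (y + z)"
      using scale[of "y + z" "1/2"] y z V by (simp add: subspace_add)
    have le: "2 * d ((1 / 2) *\<^sub>R (y + z)) e \<le> d y e + d z e" if e: "0 < e" for e
    proof -
      have "x + e *\<^sub>R (1 / 2) *\<^sub>R (y + z) = (1 / 2) *\<^sub>R (x + e *\<^sub>R y) + (1 / 2) *\<^sub>R (x + e *\<^sub>R z)"
        by (simp add: algebra_simps flip: scaleR_2)
      then have "2 * p (x + e *\<^sub>R (1 / 2) *\<^sub>R (y + z)) \<le> p (x + e *\<^sub>R y) + p (x + e *\<^sub>R z)"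
        using sublinear_on_add[OF p, of "(1 / 2) *\<^sub>R (x + e *\<^sub>R y)" "(1 / 2) *\<^sub>R (x + e *\<^sub>R z)"]
          sublinear_on_scale[OF p mem[OF y], of "1/2" e] sublinear_on_scale[OF p mem[OF z], of "1/2" e]
          mem[OF y] mem[OF z] V by (simp add: subspace_scale)
      then have "(2 * p (x + e *\<^sub>R (1 / 2) *\<^sub>R (y + z)) - 2 * p x) / e
          \<le> (p (x + e *\<^sub>R y) + p (x + e *\<^sub>R z) - 2 * p x) / e"
        using e by (intro divide_right_mono) auto
      then show ?thesis by (simp add: d_def add_divide_distrib diff_divide_distrib)
    qed
    have "2 * q ((1 / 2) *\<^sub>R (y + z)) \<le> q y + q z"
    proof (rule tendsto_le[OF trivial_limit_at_right_real])
      show "((\<lambda>e. d y e + d z e) \<longlongrightarrow> q y + q z) (at_right 0)"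
        by (intro tendsto_intros lim y z)
      show "((\<lambda>e. 2 * d ((1 / 2) *\<^sub>R (y + z)) e) \<longlongrightarrow> 2 * q ((1 / 2) *\<^sub>R (y + z))) (at_right 0)"
        using V y z by (intro tendsto_intros lim) (simp add: subspace_add subspace_scale)
      show "\<forall>\<^sub>F e in at_right 0. 2 * d ((1 / 2) *\<^sub>R (y + z)) e \<le> d y e + d z e"
        by (intro eventually_mono[OF eventually_at_right_less]) (rule le)
    qed
    with half show ?thesis by simp
  qed
  have q_le_p: "q y \<le> p y" if "y \<in> V" for y
    using q_le_d[OF that, of 1] upper[OF that, of 1] by simp
  have q_neg: "q (- x) = - p x"
  proof -
    have "q (- x) \<le> d (- x) 1" using q_le_d[of "- x" 1] x V by (simp add: subspace_neg)
    also have "\<dots> = - p x" using sublinear_on_zero[OF V p] by (simp add: d_def)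
    finally have "q (- x) \<le> - p x" .
    moreover have "- p x \<le> q (- x)"
      unfolding q_def using lower[of "- x"] x V by (intro cINF_greatest) (auto simp: subspace_neg)
    ultimately show ?thesis by simp
  qed
  have sub_q: "sublinear_on V q"
    by (intro sublinear_onI add scale)
  have "q x = p x"
    using sublinear_on_minus[OF V sub_q x] q_neg q_le_p[OF x] by simp
  then show ?thesis
    using that[OF sub_q q_le_p _ q_neg] lim by (simp add: d_def[abs_def])
qed

text \<open>
  Hahn-Banach theorem. By Zorn's lemma there is a minimal sublinear functional below \<open>p\<close>. By
  minimality it coincides with its directional derivative at any \<open>x\<close>, so it is odd, and an odd
  sublinear functional is linear.
\<close>

lemma sublinear_dominates_linear:
  fixes V :: "'v::real_vector set"
  assumes V: "subspace V" and p: "sublinear_on V p"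
  obtains f where "\<And>x y. x \<in> V \<Longrightarrow> y \<in> V \<Longrightarrow> f (x + y) = f x + f y"
    "\<And>a x. x \<in> V \<Longrightarrow> f (a *\<^sub>R x) = a * f x" "\<And>x. x \<in> V \<Longrightarrow> f x \<le> p x"
proof -
  \<comment> \<open>prescribing the values outside \<open>V\<close> makes a comparison on \<open>V\<close> one on the whole type\<close>
  define A where "A = {q. sublinear_on V q \<and> (\<forall>y\<in>V. q y \<le> p y) \<and> (\<forall>y. y \<notin> V \<longrightarrow> q y = (0::real))}"
  define P where "P q r \<longleftrightarrow> (\<forall>y. r y \<le> q y)" for q r :: "'v \<Rightarrow> real"
  have "\<exists>m\<in>A. \<forall>a\<in>A. P m a \<longrightarrow> a = m"
  proof (rule predicate_Zorn)
    show "partial_order_on A (relation_of P A)"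
      by (rule partial_order_on_relation_ofI) (auto simp: P_def fun_eq_iff intro: order_trans antisym)
  next
    fix C assume C: "C \<in> Chains (relation_of P A)"
    then have CA: "C \<subseteq> A" and tot: "\<And>q r. q \<in> C \<Longrightarrow> r \<in> C \<Longrightarrow> P q r \<or> P r q"
      by (auto simp: Chains_def relation_of_def)
    show "\<exists>u\<in>A. \<forall>a\<in>C. P a u"
    proof (cases "C = {}")
      case True
      have "(\<lambda>y. if y \<in> V then p y else 0) \<in> A"
        using p V by (auto simp: A_def sublinear_on_def subspace_add subspace_scale)
      then show ?thesis using True by auto
    next
      case False
      define u where "u y = (if y \<in> V then INF q\<in>C. q y else 0)" for y
      have sub: "sublinear_on V q" if "q \<in> C" for q using CA that by (auto simp: A_def)
      have bdd: "bdd_below ((\<lambda>q. q y) ` C)" if y: "y \<in> V" for y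
      proof (rule bdd_belowI2)
        fix q assume q: "q \<in> C"
        then have "q (- y) \<le> p (- y)" using CA y V by (auto simp: A_def subspace_neg)
        then show "- p (- y) \<le> q y"
          using sublinear_on_minus[OF V sub[OF q] y] by simp
      qed
      have u_le: "u y \<le> q y" if "q \<in> C" "y \<in> V" for q y
        unfolding u_def using bdd that by (auto intro: cINF_lower)
      have u_greatest: "b \<le> u y" if "\<And>q. q \<in> C \<Longrightarrow> b \<le> q y" "y \<in> V" for b y
        unfolding u_def using False that by (auto intro: cINF_greatest)
      have "sublinear_on V u"
      proof (rule sublinear_onI)
        fix x y assume x: "x \<in> V" and y: "y \<in> V"
        have "u (x + y) \<le> q x + r y" if q: "q \<in> C" and r: "r \<in> C" for q r
        proof -
          have "q (x + y) \<le> q x + r y \<or> r (x + y) \<le> q x + r y"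
            using tot[OF q r] sublinear_on_add[OF sub[OF q] x y] sublinear_on_add[OF sub[OF r] x y]
            unfolding P_def by (metis add_le_cancel_left add_le_cancel_right order_trans)
          then show ?thesis
            using u_le[OF q, of "x + y"] u_le[OF r, of "x + y"] x y V by (auto simp: subspace_add)
        qed
        then have "u (x + y) - q x \<le> r y" if "q \<in> C" "r \<in> C" for q r
          using that by (simp add: diff_le_eq add.commute)
        then have "u (x + y) - q x \<le> u y" if "q \<in> C" for q
          using that y by (intro u_greatest)
        then have "u (x + y) - u y \<le> q x" if "q \<in> C" for q
          using that by (simp add: diff_le_eq add.commute)
        then have "u (x + y) - u y \<le> u x"
          using x by (intro u_greatest)
        then show "u (x + y) \<le> u x + u y" by simp
      next
        fix x and a :: real assume x: "x \<in> V" and a: "0 \<le> a"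
        show "u (a *\<^sub>R x) = a * u x"
        proof (cases "a = 0")
          case True
          have "(\<lambda>q. q 0) ` C = {0}"
            using False sublinear_on_zero[OF V sub] by (auto simp: image_iff) 
          then show ?thesis using True V by (simp add: u_def subspace_0)
        next
          case False
          with a have a: "0 < a" by simp
          have eq: "q (a *\<^sub>R x) = a * q x" if "q \<in> C" for q
            using sublinear_on_scale[OF sub[OF that] x] a by simp
          have ax: "a *\<^sub>R x \<in> V" using x V by (simp add: subspace_scale)
          show ?thesis
          proof (rule antisym)
            have "u (a *\<^sub>R x) / a \<le> u x"
              using a u_le[OF _ ax] eq x by (intro u_greatest) (auto simp: field_simps)
            then show "u (a *\<^sub>R x) \<le> a * u x" using a by (simp add: field_simps)
            show "a * u x \<le> u (a *\<^sub>R x)"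
              using a u_le[OF _ x] ax by (intro u_greatest) (simp_all add: eq)
          qed
        qed
      qed
      moreover have "u y \<le> p y" if "y \<in> V" for y
        using False CA u_le[OF _ that] that by (force simp: A_def intro: order_trans)
      ultimately have "u \<in> A" by (auto simp: A_def u_def)
      moreover have "P a u" if "a \<in> C" for a
        unfolding P_def using u_le[OF that] CA that by (auto simp: A_def u_def)
      ultimately show ?thesis by blast
    qed
  qed
  then obtain f where fA: "f \<in> A" and minimal: "\<And>g. g \<in> A \<Longrightarrow> P f g \<Longrightarrow> g = f" by auto
  have f: "sublinear_on V f" and fp: "\<And>y. y \<in> V \<Longrightarrow> f y \<le> p y" using fA by (auto simp: A_def)
  have neg: "f (- x) = - f x" if x: "x \<in> V" for x
  proof -
    obtain q where q: "sublinear_on V q" "\<And>y. y \<in> V \<Longrightarrow> q y \<le> f y" "q (- x) = - f x"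
      using sublinear_directional_derivative[OF V f x] by metis
    define g where "g y = (if y \<in> V then q y else 0)" for y
    have "g \<in> A"
      unfolding A_def g_def using q(1,2) fp V
      by (auto simp: sublinear_on_def subspace_add subspace_scale intro: order_trans)
    moreover have "P f g" using q(2) fA by (auto simp: P_def g_def A_def)
    ultimately have "g = f" by (rule minimal)
    then show ?thesis using q(3) x V by (metis g_def subspace_neg)
  qed
  show ?thesis
  proof (rule that)
    fix x y assume x: "x \<in> V" and y: "y \<in> V"
    have "f (- (x + y)) \<le> f (- x) + f (- y)"
      using sublinear_on_add[OF f, of "- x" "- y"] x y V by (simp add: subspace_neg)
    then have "f x + f y \<le> f (x + y)" using neg[of "x + y"] neg[OF x] neg[OF y] x y V by (simp add: subspace_add)
    then show "f (x + y) = f x + f y" using sublinear_on_add[OF f x y] by simp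
  next
    fix a x assume x: "x \<in> V"
    show "f (a *\<^sub>R x) = a * f x"
    proof (cases "0 \<le> a")
      case False
      then have "f ((- a) *\<^sub>R (- x)) = - a * f (- x)"
        using x V by (intro sublinear_on_scale[OF f]) (auto simp: subspace_neg)
      then show ?thesis using neg[OF x] by simp
    qed (use sublinear_on_scale[OF f x] in auto)
  qed (rule fp)
qed

text \<open>
  Pointwise scalar multiplication, so that subspaces of function spaces are available.
\<close>

instantiation "fun" :: (type, real_vector) real_vector
begin

definition scaleR_fun :: "real \<Rightarrow> ('a \<Rightarrow> 'b) \<Rightarrow> 'a \<Rightarrow> 'b" where
  "scaleR_fun a f = (\<lambda>x. a *\<^sub>R f x)"

instance
  by standard (auto simp: scaleR_fun_def fun_eq_iff algebra_simps)

end

section \<open>The Daniell-Stone theorem\<close>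

lemma ennreal_sums_interval_lengths:
  fixes a b :: "nat \<Rightarrow> real"
  assumes le: "\<And>i. a i \<le> b i" "c \<le> d" and disj: "disjoint_family (\<lambda>i. {a i..<b i})"
    and un: "(\<Union>i. {a i..<b i}) = {c..<d}"
  shows "(\<lambda>i. b i - a i) sums (d - c)"
proof -
  have "(\<Sum>i. emeasure lborel {a i..<b i}) = emeasure lborel {c..<d}"
    using disj un by (subst suminf_emeasure) auto
  then have "(\<Sum>i. ennreal (b i - a i)) = ennreal (d - c)" using le by simp
  moreover have "(\<lambda>i. ennreal (b i - a i)) sums (\<Sum>i. ennreal (b i - a i))"
    by (simp add: summable_sums)
  ultimately have "(\<lambda>i. ennreal (b i - a i)) sums ennreal (d - c)" by simp
  then show ?thesis using le by (simp add: sums_ennreal)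
qed

lemma sum_truncations:
  fixes y :: real
  assumes "0 \<le> y"
  shows "(\<Sum>k<m. min 1 (max (y - real k) 0)) = min (real m) y"
  using assms by (induction m) (auto simp: min_def max_def)

text \<open>
  Daniell-Stone theorem, for a vector lattice \<open>L\<close> of bounded functions that contains the constants.
  The regions \<open>{(w, t). X w \<le> t \<and> t < Y w}\<close> between two elements of \<open>L\<close> form a semiring of sets,
  on which \<open>f Y - f X\<close> is countably additive: Lebesgue measure of the sections turns a countable
  partition into a series that converges pointwise, and then \<open>\<sigma>\<close>-smoothness applies.
  Caratheodory's theorem extends this to a measure on the product with the line. The measure
  sought is the image, under projection, of its restriction to the strip over \<open>{0..<1}\<close>. The
  integral formula is the layer-cake formula.
\<close>

lemma Daniell_Stone:
  fixes L :: "('a \<Rightarrow> real) set" and f :: "('a \<Rightarrow> real) \<Rightarrow> real"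
  assumes const: "\<And>c. (\<lambda>_. c) \<in> L"
    and add: "\<And>X Y. X \<in> L \<Longrightarrow> Y \<in> L \<Longrightarrow> (\<lambda>w. X w + Y w) \<in> L"
    and scale: "\<And>a X. X \<in> L \<Longrightarrow> (\<lambda>w. a * X w) \<in> L"
    and abs: "\<And>X. X \<in> L \<Longrightarrow> (\<lambda>w. \<bar>X w\<bar>) \<in> L"
    and bounded: "\<And>X. X \<in> L \<Longrightarrow> \<exists>K. \<forall>w. \<bar>X w\<bar> \<le> K"
    and f_add: "\<And>X Y. X \<in> L \<Longrightarrow> Y \<in> L \<Longrightarrow> f (\<lambda>w. X w + Y w) = f X + f Y"
    and f_scale: "\<And>a X. X \<in> L \<Longrightarrow> f (\<lambda>w. a * X w) = a * f X"
    and f_mono: "\<And>X Y. X \<in> L \<Longrightarrow> Y \<in> L \<Longrightarrow> (\<And>w. X w \<le> Y w) \<Longrightarrow> f X \<le> f Y"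
    and sigma: "\<And>X. (\<And>n. X n \<in> L) \<Longrightarrow> (\<And>n w. X (Suc n) w \<le> X n w) \<Longrightarrow>
       (\<And>w. (\<lambda>n. X n w) \<longlonglongrightarrow> 0) \<Longrightarrow> (\<lambda>n. f (X n)) \<longlonglongrightarrow> 0"
  obtains M where "finite_measure M" "space M = UNIV"
    "\<And>X. X \<in> L \<Longrightarrow> X \<in> borel_measurable M" "\<And>X. X \<in> L \<Longrightarrow> integral\<^sup>L M X = f X"
proof -
  have diff: "(\<lambda>w. X w - Y w) \<in> L" if "X \<in> L" "Y \<in> L" for X Y
    using add[OF that(1) scale[OF that(2), of "- 1"]] by simp
  have f_diff: "f (\<lambda>w. X w - Y w) = f X - f Y" if "X \<in> L" "Y \<in> L" for X Y
    using f_add[OF that(1) scale[OF that(2), of "- 1"]] f_scale[OF that(2), of "- 1"] by simp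
  have max_eq: "max x y = (1 / 2) * ((x + y) + \<bar>x - y\<bar>)" and
    min_eq: "min x y = (1 / 2) * ((x + y) - \<bar>x - y\<bar>)" for x y :: real
    by (auto simp: max_def min_def field_simps)
  have max: "(\<lambda>w. max (X w) (Y w)) \<in> L" if "X \<in> L" "Y \<in> L" for X Y
    unfolding max_eq by (intro scale add abs diff that)
  have min: "(\<lambda>w. min (X w) (Y w)) \<in> L" if "X \<in> L" "Y \<in> L" for X Y
    unfolding min_eq by (intro scale add abs diff that)
  have sum: "(\<lambda>w. \<Sum>k<m. X k w) \<in> L" if "\<And>k. X k \<in> L" for X and m :: nat
    by (induction m) (auto intro: const add that)
  have f_0: "f (\<lambda>_. 0) = 0" using f_scale[OF const, of 0 0] by simp
  have f_sum: "f (\<lambda>w. \<Sum>k<m. X k w) = (\<Sum>k<m. f (X k))" if "\<And>k. X k \<in> L" for X and m :: nat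
    by (induction m) (auto simp: f_0 f_add sum that)

  define G where "G X Y = {(w, t). X w \<le> t \<and> t < Y w}" for X Y :: "'a \<Rightarrow> real"
  define P where "P X Y \<longleftrightarrow> X \<in> L \<and> Y \<in> L \<and> (\<forall>w. X w \<le> Y w)" for X Y
  define \<mu> where "\<mu> = extend_measure UNIV {(X, Y). P X Y} (\<lambda>(X, Y). G X Y) (\<lambda>(X, Y). ennreal (f Y - f X))"
  have P_le: "f X \<le> f Y" if "P X Y" for X Y
    using that by (auto simp: P_def intro: f_mono)
  have semiring: "semiring_of_sets UNIV {G X Y | X Y. P X Y}"
  proof
    show "{G X Y | X Y. P X Y} \<subseteq> Pow UNIV" by auto
    have "G (\<lambda>_. 0) (\<lambda>_. 0) = {}" by (auto simp: G_def)
    then show "{} \<in> {G X Y | X Y. P X Y}" using const[of 0] by (force simp: P_def)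
  next
    fix a b assume "a \<in> {G X Y | X Y. P X Y}" "b \<in> {G X Y | X Y. P X Y}"
    then obtain X Y X' Y' where ab: "a = G X Y" "b = G X' Y'" and P: "P X Y" "P X' Y'" by blast
    have "a \<inter> b = G (\<lambda>w. max (X w) (X' w)) (\<lambda>w. max (max (X w) (X' w)) (min (Y w) (Y' w)))"
      by (auto simp: ab G_def)
    moreover have "P (\<lambda>w. max (X w) (X' w)) (\<lambda>w. max (max (X w) (X' w)) (min (Y w) (Y' w)))"
      using P by (auto simp: P_def intro!: max min)
    ultimately show "a \<inter> b \<in> {G X Y | X Y. P X Y}" by blast
    let ?A = "G X (\<lambda>w. min (Y w) (max (X w) (X' w)))" and ?B = "G (\<lambda>w. min (Y w) (max (X w) (Y' w))) Y"
    have "a - b = \<Union>{?A, ?B}"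
      using P by (auto simp: ab G_def P_def min_def max_def split: if_splits)
    moreover have "disjoint {?A, ?B}"
    proof -
      have "False" if "(w, t) \<in> ?A" "(w, t) \<in> ?B" for w t
      proof -
        have "X' w \<le> Y' w" using P(2) by (simp add: P_def)
        then show False using that by (auto simp: G_def min_def max_def split: if_splits)
      qed
      then have "?A \<inter> ?B = {}" by fast
      then show ?thesis by (auto simp: disjoint_def)
    qed
    moreover have "{?A, ?B} \<subseteq> {G X Y | X Y. P X Y}"
    proof -
      have "P X (\<lambda>w. min (Y w) (max (X w) (X' w)))" "P (\<lambda>w. min (Y w) (max (X w) (Y' w))) Y"
        using P by (auto simp: P_def intro!: max min)
      then show ?thesis by blast
    qed
    ultimately show "\<exists>C\<subseteq>{G X Y | X Y. P X Y}. finite C \<and> disjoint C \<and> a - b = \<Union>C"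
      by (intro exI[of _ "{?A, ?B}"]) auto
  qed
  have em: "emeasure \<mu> (G X Y) = ennreal (f Y - f X)" if "P X Y" for X Y
  proof (rule extend_measure_caratheodory_pair[OF \<mu>_def that semiring])
    fix X Y assume P: "P X Y" and "G X Y = {}"
    have "(w, X w) \<notin> G X Y" for w using \<open>G X Y = {}\<close> by simp
    then have "Y w \<le> X w" for w by (simp add: G_def not_less)
    then have "f Y \<le> f X" using P by (auto simp: P_def intro: f_mono)
    then show "ennreal (f Y - f X) = 0" by (simp add: ennreal_eq_0_iff)
  next
    fix X Y X' Y' assume P: "P X Y" "P X' Y'" and eq: "G X Y = G X' Y'"
    have "Y w - X w = Y' w - X' w" for w
    proof -
      have "(w, t) \<in> G X Y \<longleftrightarrow> (w, t) \<in> G X' Y'" for t using eq by simp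
      then have "{X w..<Y w} = {X' w..<Y' w}" by (simp add: set_eq_iff G_def)
      moreover have "X w \<le> Y w" "X' w \<le> Y' w" using P by (auto simp: P_def)
      ultimately show ?thesis by (cases "X w = Y w") (auto simp: Ico_eq_Ico)
    qed
    then have "(\<lambda>w. Y w - X w) = (\<lambda>w. Y' w - X' w)" by auto
    then have "f Y - f X = f Y' - f X'" using P by (metis P_def f_diff)
    then show "ennreal (f Y - f X) = ennreal (f Y' - f X')" by simp
  next
    fix A B and X Y
    assume AB: "\<And>n::nat. P (A n) (B n)" and P: "P X Y"
      and disj: "disjoint_family (\<lambda>n. G (A n) (B n))" and un: "(\<Union>i. G (A i) (B i)) = G X Y"
    have L: "A n \<in> L" "B n \<in> L" "X \<in> L" "Y \<in> L" for n using AB P by (auto simp: P_def)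
    have sums: "(\<lambda>i. B i w - A i w) sums (Y w - X w)" for w
    proof (rule ennreal_sums_interval_lengths)
      have "(w, t) \<notin> G (A m) (B m) \<inter> G (A n) (B n)" if "m \<noteq> n" for m n t
        using disj that by (simp add: disjoint_family_on_def)
      then show "disjoint_family (\<lambda>i. {A i w..<B i w})"
        by (simp add: disjoint_family_on_def set_eq_iff G_def)
      have "(\<exists>i. (w, t) \<in> G (A i) (B i)) \<longleftrightarrow> (w, t) \<in> G X Y" for t using un by blast
      then have "(\<exists>i. A i w \<le> t \<and> t < B i w) \<longleftrightarrow> X w \<le> t \<and> t < Y w" for t by (simp add: G_def)
      then show "(\<Union>i. {A i w..<B i w}) = {X w..<Y w}"
        by (simp add: set_eq_iff)
    qed (use AB P in \<open>auto simp: P_def\<close>)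
    define R where "R n w = (Y w - X w) - (\<Sum>i<n. B i w - A i w)" for n w
    have "(\<lambda>n. f (R n)) \<longlonglongrightarrow> 0"
    proof (rule sigma)
      show "R n \<in> L" for n unfolding R_def by (intro diff sum L)
      show "R (Suc n) w \<le> R n w" for n w
        using AB[of n] by (simp add: R_def P_def)
      show "(\<lambda>n. R n w) \<longlonglongrightarrow> 0" for w
        unfolding R_def using tendsto_diff[OF tendsto_const, OF sums[unfolded sums_def], of "Y w - X w" w] by simp
    qed
    moreover have "f (R n) = (f Y - f X) - (\<Sum>i<n. f (B i) - f (A i))" for n
      unfolding R_def[abs_def] by (simp add: f_diff f_sum diff sum L)
    ultimately have "(\<lambda>n. (f Y - f X) - ((f Y - f X) - (\<Sum>i<n. f (B i) - f (A i)))) \<longlonglongrightarrow> (f Y - f X) - 0"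
      by (intro tendsto_diff tendsto_const) simp
    then have "(\<lambda>i. f (B i) - f (A i)) sums (f Y - f X)" by (simp add: sums_def)
    then have "(\<lambda>i. ennreal (f (B i) - f (A i))) sums ennreal (f Y - f X)"
      using P_le AB P by (simp add: sums_ennreal)
    then show "(\<Sum>n. ennreal (f (B n) - f (A n))) = ennreal (f Y - f X)"
      by (rule sums_unique[symmetric])
  qed simp_all
  have sets_\<mu>: "G X Y \<in> sets \<mu>" if "P X Y" for X Y
    unfolding \<mu>_def using that by (subst sets_extend_measure) (auto intro: sigma_sets.Basic)
  have space_\<mu>: "space \<mu> = UNIV" unfolding \<mu>_def by (subst space_extend_measure) auto

  define strip where "strip = (UNIV :: 'a set) \<times> {0..<1::real}"
  have strip_eq: "strip = G (\<lambda>_. 0) (\<lambda>_. 1)" by (auto simp: strip_def G_def)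
  have P01: "P (\<lambda>_. 0) (\<lambda>_. 1)" by (simp add: P_def const)
  have strip_sets: "strip \<in> sets \<mu>" unfolding strip_eq by (rule sets_\<mu>[OF P01])
  define trunc where "trunc X k n w = min 1 (max (n * X w - k) 0)" for X :: "'a \<Rightarrow> real" and k n :: real and w
  have trunc_L: "trunc X k n \<in> L" if "X \<in> L" for X k n
    unfolding trunc_def by (intro min max diff scale const that)
  have P_trunc: "P (\<lambda>_. 0) (trunc X k n)" if "X \<in> L" for X k n
    using trunc_L[OF that] const by (auto simp: P_def trunc_def)
  have level_sets: "{w. c < X w} \<times> {0..<1} \<in> sets \<mu>" if X: "X \<in> L" for X and c :: real
  proof -
    \<comment> \<open>\<open>min 1 (max (n * (X w - c)) 0)\<close> increases to the indicator of \<open>{w. c < X w}\<close>\<close>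
    have "{w. c < X w} \<times> {0..<1} = (\<Union>n::nat. G (\<lambda>_. 0) (trunc X (n * c) n))"
    proof (intro equalityI subsetI)
      fix z assume "z \<in> {w. c < X w} \<times> {0..<1::real}"
      then obtain w t where z: "z = (w, t)" "c < X w" "0 \<le> t" "t < 1" by auto
      then obtain n :: nat where "1 < n * (X w - c)"
        using ex_less_of_nat_mult[of "X w - c" 1] by auto
      then have "z \<in> G (\<lambda>_. 0) (trunc X (n * c) n)"
        using z by (auto simp: G_def trunc_def algebra_simps)
      then show "z \<in> (\<Union>n::nat. G (\<lambda>_. 0) (trunc X (n * c) n))" by blast
    next
      fix z assume "z \<in> (\<Union>n::nat. G (\<lambda>_. 0) (trunc X (n * c) n))"
      then obtain n :: nat and w t where z: "z = (w, t)" "0 \<le> t" "t < trunc X (n * c) n w" by (auto simp: G_def)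
      then have "0 < n * (X w - c)" "t < 1" by (auto simp: trunc_def algebra_simps)
      then show "z \<in> {w. c < X w} \<times> {0..<1}" using z by (auto simp: zero_less_mult_iff)
    qed
    then show ?thesis using sets_\<mu>[OF P_trunc[OF X]] by auto
  qed

  define S where "S = {{w. c < X w} | X (c::real). X \<in> L}"
  define M where "M = distr (restrict_space \<mu> strip) (sigma UNIV S) fst"
  have space_M: "space M = UNIV" by (simp add: M_def space_measure_of_conv)
  have fst_meas: "fst \<in> measurable (restrict_space \<mu> strip) (sigma UNIV S)"
  proof (rule measurable_measure_of)
    fix y assume "y \<in> S"
    then obtain X c where y: "y = {w. c < X w}" and X: "X \<in> L" by (auto simp: S_def)
    have "fst -` y \<inter> space (restrict_space \<mu> strip) = {w. c < X w} \<times> {0..<1}"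
      by (auto simp: space_restrict_space space_\<mu> strip_def y)
    then show "fst -` y \<inter> space (restrict_space \<mu> strip) \<in> sets (restrict_space \<mu> strip)"
      using level_sets[OF X, of c] strip_sets
      by (auto simp: sets_restrict_space_iff space_\<mu> strip_def)
  qed auto
  have em_M: "emeasure M B = emeasure \<mu> (B \<times> {0..<1})" if "B \<in> sets M" for B
  proof -
    have "fst -` B \<inter> space (restrict_space \<mu> strip) = B \<times> {0..<1}"
      by (auto simp: space_restrict_space space_\<mu> strip_def)
    then show ?thesis
      using that strip_sets
      by (simp add: M_def emeasure_distr[OF fst_meas]) (subst emeasure_restrict_space, auto simp: space_\<mu> strip_def)
  qed
  have level_M: "{w. c < X w} \<in> sets M" if "X \<in> L" for X c
    using that by (auto simp: M_def S_def intro!: sigma_sets.Basic)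
  have em_UNIV: "emeasure M UNIV = ennreal (f (\<lambda>_. 1))"
    using em_M[of UNIV] sets.top[of M] em[OF P01] f_0 by (simp add: space_M strip_eq[unfolded strip_def])
  interpret M: finite_measure M
    by (rule finite_measureI) (simp add: space_M em_UNIV)
  have meas: "X \<in> borel_measurable M" if "X \<in> L" for X
    using level_M[OF that] by (simp add: borel_measurable_iff_greater space_M)
  have integrable: "integrable M X" if X: "X \<in> L" for X
  proof -
    obtain K where "\<And>w. \<bar>X w\<bar> \<le> K" using bounded[OF X] by auto
    then show ?thesis using meas[OF X] by (intro M.integrable_const_bound[of _ K]) auto
  qed
  have f1: "0 \<le> f (\<lambda>_. 1)" using P_le[OF P01] f_0 by simp
  have pos: "integral\<^sup>L M X = f X" if X: "X \<in> L" and nn: "\<And>w. 0 \<le> X w" for X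
  proof -
    \<comment> \<open>cut \<open>n * X\<close> into slices of height 1; both functionals of a slice lie between consecutive level measures\<close>
    have bound: "\<bar>integral\<^sup>L M X - f X\<bar> \<le> f (\<lambda>_. 1) / n" if n: "0 < n" for n :: nat
    proof -
      define a where "a k = measure M {w. real k < n * X w}" for k :: nat
      have a_sets: "{w. k < n * X w} \<in> sets M" for k :: real
        using level_M[OF scale[OF X]] .
      define v where "v k = trunc X (real k) (real n)" for k :: nat
      have vL: "v k \<in> L" for k unfolding v_def by (rule trunc_L[OF X])
      have P_v: "P (\<lambda>_. 0) (v k)" for k unfolding v_def by (rule P_trunc[OF X])
      have v_f: "a (Suc k) \<le> f (v k)" "f (v k) \<le> a k" for k
      proof -
        have m: "ennreal (f (v k)) = emeasure \<mu> (G (\<lambda>_. 0) (v k))" "0 \<le> f (v k)"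
          using em[OF P_trunc[OF X, of k n]] P_le[OF P_trunc[OF X, of k n]] f_0 by (auto simp: v_def)
        have a: "ennreal (a j) = emeasure \<mu> ({w. real j < n * X w} \<times> {0..<1})" for j
          using em_M[OF a_sets] by (simp add: a_def M.emeasure_eq_measure)
        have "ennreal (a (Suc k)) \<le> ennreal (f (v k))"
          unfolding a m(1) by (intro emeasure_mono sets_\<mu> P_v) (auto simp: G_def v_def trunc_def)
        then show "a (Suc k) \<le> f (v k)" using m(2) by simp
        have "ennreal (f (v k)) \<le> ennreal (a k)"
          unfolding a m(1) by (intro emeasure_mono level_sets[OF scale[OF X]]) (auto simp: G_def v_def trunc_def)
        then show "f (v k) \<le> a k" by (simp add: a_def)
      qed
      have v_int: "a (Suc k) \<le> integral\<^sup>L M (v k)" "integral\<^sup>L M (v k) \<le> a k" for k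
      proof -
        have ind: "a j = integral\<^sup>L M (indicator {w. real j < n * X w})" for j
          by (simp add: a_def space_M)
        have ind_int: "integrable M (indicator {w. real j < n * X w} :: 'a \<Rightarrow> real)" for j
          using a_sets by (intro integrable_real_indicator) (simp_all add: M.emeasure_eq_measure)
        show "a (Suc k) \<le> integral\<^sup>L M (v k)"
          unfolding ind
          by (intro integral_mono integrable[OF vL] ind_int) (auto simp: v_def trunc_def indicator_def)
        show "integral\<^sup>L M (v k) \<le> a k"
          unfolding ind
          by (intro integral_mono integrable[OF vL] ind_int) (auto simp: v_def trunc_def indicator_def)
      qed
      obtain K where K: "\<And>w. \<bar>X w\<bar> \<le> K" using bounded[OF X] by auto
      obtain m :: nat where m: "n * K \<le> m" using real_arch_simple by blast
      have X_eq: "X w = (1 / n) * (\<Sum>k<m. v k w)" for w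
      proof -
        have "n * X w \<le> m"
          using m K[of w] nn[of w] n by (smt (verit) mult_left_mono of_nat_0_le_iff)
        then show ?thesis
          using sum_truncations[of "n * X w" m] nn[of w] n by (simp add: v_def trunc_def min_def)
      qed
      then have X_sum: "X = (\<lambda>w. (1 / n) * (\<Sum>k<m. v k w))" by (rule ext)
      have "f X = f (\<lambda>w. (1 / n) * (\<Sum>k<m. v k w))" using X_sum by (rule arg_cong)
      also have "\<dots> = (1 / n) * (\<Sum>k<m. f (v k))" by (simp only: f_scale[OF sum[OF vL]] f_sum[OF vL])
      finally have "f X = (1 / n) * (\<Sum>k<m. f (v k))" .
      moreover have "integral\<^sup>L M X = integral\<^sup>L M (\<lambda>w. (1 / n) * (\<Sum>k<m. v k w))"
        using X_sum by (rule arg_cong)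
      then have "integral\<^sup>L M X = (1 / n) * (\<Sum>k<m. integral\<^sup>L M (v k))"
        using integrable[OF vL] by simp
      ultimately have "\<bar>integral\<^sup>L M X - f X\<bar> = (1 / n) * \<bar>\<Sum>k<m. integral\<^sup>L M (v k) - f (v k)\<bar>"
        by (simp add: sum_subtractf abs_mult flip: right_diff_distrib diff_divide_distrib)
      also have "\<dots> \<le> (1 / n) * (\<Sum>k<m. a k - a (Suc k))"
      proof (intro mult_left_mono order_trans[OF sum_abs] sum_mono)
        fix k show "\<bar>integral\<^sup>L M (v k) - f (v k)\<bar> \<le> a k - a (Suc k)"
          using v_f[of k] v_int[of k] by linarith
      qed simp
      also have "\<dots> = (1 / n) * (a 0 - a m)" by (simp add: sum_lessThan_telescope')
      also have "\<dots> \<le> (1 / n) * f (\<lambda>_. 1)"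
      proof (intro mult_left_mono)
        have "a 0 \<le> measure M (space M)" unfolding a_def by (rule M.bounded_measure)
        also have "\<dots> = f (\<lambda>_. 1)" using em_UNIV f1 by (simp add: measure_def space_M)
        finally show "a 0 - a m \<le> f (\<lambda>_. 1)" by (simp add: a_def add_increasing2 diff_le_eq)
      qed simp
      finally show ?thesis by simp
    qed
    have "(\<lambda>n. f (\<lambda>_. 1) / Suc n) \<longlonglongrightarrow> 0"
      using lim_const_over_n[THEN LIMSEQ_Suc] by blast
    then have "\<bar>integral\<^sup>L M X - f X\<bar> \<le> 0"
      by (rule LIMSEQ_le_const) (auto intro: bound simp del: of_nat_Suc)
    then show ?thesis by simp
  qed
  show ?thesis
  proof (rule that[OF M.finite_measure_axioms space_M meas])
    fix X assume X: "X \<in> L"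
    obtain K where K: "\<And>w. \<bar>X w\<bar> \<le> K" using bounded[OF X] by auto
    have nn: "0 \<le> X w + K" for w using K[of w] by linarith
    have "0 \<le> K" using K[of undefined] by linarith
    have "integral\<^sup>L M (\<lambda>w. X w + K) = f (\<lambda>w. X w + K)"
      by (rule pos[OF add[OF X const] nn])
    moreover have "integral\<^sup>L M (\<lambda>_. K) = f (\<lambda>_. K)"
      by (rule pos[OF const]) fact
    ultimately show "integral\<^sup>L M X = f X"
      using integrable[OF X] integrable[OF const, of K] f_add[OF X const, of K] by simp
  qed
qed

section \<open>Cylinder variables and the moment bound\<close>

text \<open>
  \<open>X\<close> is bounded and depends only on the coordinates in \<open>S\<close>, in a Lipschitz way. For finite
  non-empty \<open>S\<close> within \<open>{0..T}\<close> these are exactly the cylinder variables, without reference to an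
  ordered time grid and its increments. Enlarging \<open>S\<close> is harmless, which makes closure
  under algebraic operations immediate.
\<close>

definition depends_lipschitz :: "real set \<Rightarrow> ((real \<Rightarrow> real) \<Rightarrow> real) \<Rightarrow> bool" where
  "depends_lipschitz S X \<longleftrightarrow> (\<exists>K. \<forall>\<omega>. \<bar>X \<omega>\<bar> \<le> K) \<and>
     (\<exists>C\<ge>0. \<forall>\<omega> \<omega>'. \<bar>X \<omega> - X \<omega>'\<bar> \<le> C * (\<Sum>s\<in>S. \<bar>\<omega> s - \<omega>' s\<bar>))"

lemma depends_lipschitzI:
  assumes "\<And>\<omega>. \<bar>X \<omega>\<bar> \<le> K" "0 \<le> C"
    "\<And>\<omega> \<omega>'. \<bar>X \<omega> - X \<omega>'\<bar> \<le> C * (\<Sum>s\<in>S. \<bar>\<omega> s - \<omega>' s\<bar>)"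
  shows "depends_lipschitz S X"
  using assms unfolding depends_lipschitz_def by blast

lemma depends_lipschitzE:
  assumes "depends_lipschitz S X"
  obtains K C where "\<And>\<omega>. \<bar>X \<omega>\<bar> \<le> K" "0 \<le> C"
    "\<And>\<omega> \<omega>'. \<bar>X \<omega> - X \<omega>'\<bar> \<le> C * (\<Sum>s\<in>S. \<bar>\<omega> s - \<omega>' s\<bar>)"
  using assms unfolding depends_lipschitz_def by blast

lemma depends_lipschitz_cong:
  assumes "depends_lipschitz S X" "\<And>s. s \<in> S \<Longrightarrow> \<omega> s = \<omega>' s"
  shows "X \<omega> = X \<omega>'"
proof -
  obtain K C where "\<And>\<omega> \<omega>'. \<bar>X \<omega> - X \<omega>'\<bar> \<le> C * (\<Sum>s\<in>S. \<bar>\<omega> s - \<omega>' s\<bar>)"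
    using assms(1) by (rule depends_lipschitzE) blast
  from this[of \<omega> \<omega>'] show ?thesis using assms(2) by simp
qed

lemma depends_lipschitz_mono:
  assumes "depends_lipschitz S X" "S \<subseteq> S'" "finite S'"
  shows "depends_lipschitz S' X"
proof -
  obtain K C where *: "\<And>\<omega>. \<bar>X \<omega>\<bar> \<le> K" "0 \<le> C"
    "\<And>\<omega> \<omega>'. \<bar>X \<omega> - X \<omega>'\<bar> \<le> C * (\<Sum>s\<in>S. \<bar>\<omega> s - \<omega>' s\<bar>)"
    using assms(1) by (rule depends_lipschitzE) blast
  show ?thesis
  proof (rule depends_lipschitzI[OF *(1,2)])
    fix \<omega> \<omega>' :: "real \<Rightarrow> real"
    have "C * (\<Sum>s\<in>S. \<bar>\<omega> s - \<omega>' s\<bar>) \<le> C * (\<Sum>s\<in>S'. \<bar>\<omega> s - \<omega>' s\<bar>)"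
      using *(2) assms(2,3) by (intro mult_left_mono sum_mono2) auto
    with *(3)[of \<omega> \<omega>'] show "\<bar>X \<omega> - X \<omega>'\<bar> \<le> C * (\<Sum>s\<in>S'. \<bar>\<omega> s - \<omega>' s\<bar>)" by simp
  qed
qed

lemma depends_lipschitz_const: "depends_lipschitz S (\<lambda>_. c)"
  by (rule depends_lipschitzI[of _ "\<bar>c\<bar>" 0]) auto

lemma depends_lipschitz_add:
  assumes "depends_lipschitz S X" "depends_lipschitz S Y"
  shows "depends_lipschitz S (\<lambda>\<omega>. X \<omega> + Y \<omega>)"
proof -
  obtain K C where X: "\<And>\<omega>. \<bar>X \<omega>\<bar> \<le> K" "0 \<le> C"
    "\<And>\<omega> \<omega>'. \<bar>X \<omega> - X \<omega>'\<bar> \<le> C * (\<Sum>s\<in>S. \<bar>\<omega> s - \<omega>' s\<bar>)"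
    using assms(1) by (rule depends_lipschitzE) blast
  obtain K' C' where Y: "\<And>\<omega>. \<bar>Y \<omega>\<bar> \<le> K'" "0 \<le> C'"
    "\<And>\<omega> \<omega>'. \<bar>Y \<omega> - Y \<omega>'\<bar> \<le> C' * (\<Sum>s\<in>S. \<bar>\<omega> s - \<omega>' s\<bar>)"
    using assms(2) by (rule depends_lipschitzE) blast
  show ?thesis
  proof (rule depends_lipschitzI[of _ "K + K'" "C + C'"])
    fix \<omega> \<omega>'
    show "\<bar>X \<omega> + Y \<omega>\<bar> \<le> K + K'" using X(1)[of \<omega>] Y(1)[of \<omega>] by linarith
    show "\<bar>X \<omega> + Y \<omega> - (X \<omega>' + Y \<omega>')\<bar> \<le> (C + C') * (\<Sum>s\<in>S. \<bar>\<omega> s - \<omega>' s\<bar>)"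
      using X(3)[of \<omega> \<omega>'] Y(3)[of \<omega> \<omega>'] unfolding distrib_right by linarith
  qed (use X Y in simp)
qed

lemma depends_lipschitz_compose:
  fixes g :: "real \<Rightarrow> real"
  assumes "depends_lipschitz S X" and g: "\<And>x y. \<bar>g x - g y\<bar> \<le> c * \<bar>x - y\<bar>" and c: "0 \<le> c"
  shows "depends_lipschitz S (\<lambda>\<omega>. g (X \<omega>))"
proof -
  obtain K C where X: "\<And>\<omega>. \<bar>X \<omega>\<bar> \<le> K" "0 \<le> C"
    "\<And>\<omega> \<omega>'. \<bar>X \<omega> - X \<omega>'\<bar> \<le> C * (\<Sum>s\<in>S. \<bar>\<omega> s - \<omega>' s\<bar>)"
    using assms(1) by (rule depends_lipschitzE) blast
  show ?thesis
  proof (rule depends_lipschitzI[of _ "\<bar>g 0\<bar> + c * K" "c * C"])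
    fix \<omega> \<omega>'
    have "\<bar>g (X \<omega>) - g 0\<bar> \<le> c * K"
      using g[of "X \<omega>" 0] mult_left_mono[OF X(1)[of \<omega>] c] by simp
    then show "\<bar>g (X \<omega>)\<bar> \<le> \<bar>g 0\<bar> + c * K" by linarith
    have "c * \<bar>X \<omega> - X \<omega>'\<bar> \<le> c * (C * (\<Sum>s\<in>S. \<bar>\<omega> s - \<omega>' s\<bar>))"
      by (intro mult_left_mono X c)
    then show "\<bar>g (X \<omega>) - g (X \<omega>')\<bar> \<le> c * C * (\<Sum>s\<in>S. \<bar>\<omega> s - \<omega>' s\<bar>)"
      using g[of "X \<omega>" "X \<omega>'"] by simp
  qed (use X c in simp)
qed

text \<open>
  The path that vanishes off the time grid \<open>t 0, \<dots>, t (n - 1)\<close> and has increments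
  \<open>x 0, \<dots>, x (n - 1)\<close> along it. On a strictly increasing grid it is a right inverse of
  \<open>increment\<close> for the first \<open>n\<close> coordinates.
\<close>

definition grid_path :: "nat \<Rightarrow> (nat \<Rightarrow> real) \<Rightarrow> (nat \<Rightarrow> real) \<Rightarrow> real \<Rightarrow> real" where
  "grid_path n t x s = (if s \<in> t ` {..<n} then \<Sum>j\<le>inv_into {..<n} t s. x j else 0)"

lemma time_grid_strict_mono:
  assumes "time_grid T n t" "i < j" "j < n"
  shows "t i < t j"
  using assms(2,3)
proof (induction j)
  case (Suc j)
  then have "t j < t (Suc j)" using assms(1) by (auto simp: time_grid_def)
  with Suc show ?case by (cases "i = j") auto
qed simp

lemma time_grid_inj: "time_grid T n t \<Longrightarrow> inj_on t {..<n}"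
  by (intro linorder_inj_onI) (auto dest: time_grid_strict_mono)

lemma time_grid_subset:
  assumes "time_grid T n t"
  shows "t ` {..<n} \<subseteq> {0..T}"
proof -
  have "0 \<le> t i \<and> t i \<le> T" if "i < n" for i
  proof -
    have "t 0 \<le> t i" "t i \<le> t (n - 1)"
      using time_grid_strict_mono[OF assms, of 0 i] time_grid_strict_mono[OF assms, of i "n - 1"] that
      by (cases "i = 0"; cases "i = n - 1"; force)+
    then show ?thesis using assms by (simp add: time_grid_def)
  qed
  then show ?thesis by auto
qed

lemma exists_time_grid:
  assumes "finite S" "S \<noteq> {}" "S \<subseteq> {0..T}"
  obtains n t where "time_grid T n t" "t ` {..<n} = S"
proof
  define t where "t i = sorted_list_of_set S ! i" for i
  have mem: "t i \<in> S" if "i < card S" for i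
    using that assms(1) unfolding t_def by (metis length_sorted_list_of_set nth_mem set_sorted_list_of_set)
  have card: "0 < card S" using assms by (simp add: card_gt_0_iff)
  have strict: "t i < t (Suc i)" if "Suc i < card S" for i
    unfolding t_def using that strict_sorted_list_of_set[of S]
    by (intro sorted_wrt_nth_less[of "(<)"]) auto
  show "time_grid T (card S) t"
    unfolding time_grid_def using card mem[of 0] mem[of "card S - 1"] strict assms(3) by force
  show "t ` {..<card S} = S"
  proof (intro equalityI subsetI)
    fix x assume "x \<in> S"
    then obtain i where "i < length (sorted_list_of_set S)" "sorted_list_of_set S ! i = x"
      using assms(1) in_set_conv_nth[of x "sorted_list_of_set S"] by auto
    then show "x \<in> t ` {..<card S}" by (auto simp: t_def)
  qed (use mem in auto)
qed

lemma grid_path_at: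
  assumes "time_grid T n t" "i < n"
  shows "grid_path n t x (t i) = (\<Sum>j\<le>i. x j)"
  using assms time_grid_inj[OF assms(1)] by (simp add: grid_path_def inv_into_f_f)

lemma sum_increment: "(\<Sum>j\<le>i. increment t \<omega> j) = \<omega> (t i)"
  by (induction i) (auto simp: increment_def)

lemma grid_path_increment:
  assumes "time_grid T n t" "s \<in> t ` {..<n}"
  shows "grid_path n t (increment t \<omega>) s = \<omega> s"
  using assms by (auto simp: grid_path_at sum_increment)

lemma vnorm_ge: "i < n \<Longrightarrow> \<bar>x i\<bar> \<le> vnorm n x"
  unfolding vnorm_def using member_le_L2_set[of "{..<n}" i "\<lambda>i. \<bar>x i\<bar>"]
  by (simp add: L2_set_def)

lemma vnorm_nonneg: "0 \<le> vnorm n x"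
  by (simp add: vnorm_def)

lemma vnorm_le_sum: "vnorm n x \<le> (\<Sum>i<n. \<bar>x i\<bar>)"
  unfolding vnorm_def by (rule L2_set_le_sum_abs)

lemma bdd_lipschitzI:
  assumes "\<And>x. \<bar>\<phi> x\<bar> \<le> M" "0 \<le> C" "\<And>x y. \<bar>\<phi> x - \<phi> y\<bar> \<le> C * vnorm n (\<lambda>i. x i - y i)"
  shows "\<phi> \<in> bdd_lipschitz n"
  using assms unfolding bdd_lipschitz_def by blast

lemma bdd_lipschitz_grid_path:
  assumes t: "time_grid T n t" and X: "depends_lipschitz (t ` {..<n}) X"
  shows "(\<lambda>x. X (grid_path n t x)) \<in> bdd_lipschitz n"
proof -
  obtain K C where K: "\<And>\<omega>. \<bar>X \<omega>\<bar> \<le> K" "0 \<le> C"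
    "\<And>\<omega> \<omega>'. \<bar>X \<omega> - X \<omega>'\<bar> \<le> C * (\<Sum>s\<in>t ` {..<n}. \<bar>\<omega> s - \<omega>' s\<bar>)"
    using X by (rule depends_lipschitzE) blast
  have "\<bar>X (grid_path n t x) - X (grid_path n t y)\<bar> \<le> (C * (n * n)) * vnorm n (\<lambda>i. x i - y i)" for x y
  proof -
    have "(\<Sum>s\<in>t ` {..<n}. \<bar>grid_path n t x s - grid_path n t y s\<bar>)
        = (\<Sum>i<n. \<bar>\<Sum>j\<le>i. x j - y j\<bar>)"
      by (simp add: sum.reindex[OF time_grid_inj[OF t]] grid_path_at[OF t] sum_subtractf)
    also have "\<dots> \<le> (\<Sum>i<n. n * vnorm n (\<lambda>i. x i - y i))"
    proof (rule sum_mono)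
      fix i assume i: "i \<in> {..<n}"
      have "\<bar>\<Sum>j\<le>i. x j - y j\<bar> \<le> (\<Sum>j\<le>i. \<bar>x j - y j\<bar>)" by (rule sum_abs)
      also have "\<dots> \<le> (\<Sum>j\<le>i. vnorm n (\<lambda>i. x i - y i))"
        using i by (intro sum_mono vnorm_ge[of _ n "\<lambda>i. x i - y i"]) auto
      also have "\<dots> \<le> n * vnorm n (\<lambda>i. x i - y i)"
        using i vnorm_nonneg[of n "\<lambda>i. x i - y i"] by (simp add: mult_right_mono del: of_nat_Suc)
      finally show "\<bar>\<Sum>j\<le>i. x j - y j\<bar> \<le> n * vnorm n (\<lambda>i. x i - y i)" .
    qed
    finally have "(\<Sum>s\<in>t ` {..<n}. \<bar>grid_path n t x s - grid_path n t y s\<bar>)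
        \<le> n * (n * vnorm n (\<lambda>i. x i - y i))" by simp
    from mult_left_mono[OF this K(2)] K(3)[of "grid_path n t x" "grid_path n t y"]
    show ?thesis by (simp add: mult.assoc)
  qed
  then show ?thesis
    using K(1,2) by (intro bdd_lipschitzI[of _ K "C * (n * n)"]) auto
qed

lemma Lip_cyl_iff:
  "X \<in> Lip_cyl T \<longleftrightarrow> (\<exists>S. finite S \<and> S \<noteq> {} \<and> S \<subseteq> {0..T} \<and> depends_lipschitz S X)"
proof
  assume "X \<in> Lip_cyl T"
  then obtain n t \<phi> where t: "time_grid T n t" and \<phi>: "\<phi> \<in> bdd_lipschitz n"
    and X: "X = (\<lambda>\<omega>. \<phi> (increment t \<omega>))"
    by (auto simp: Lip_cyl_def)
  obtain K C where K: "\<And>x. \<bar>\<phi> x\<bar> \<le> K" "0 \<le> C"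
    "\<And>x y. \<bar>\<phi> x - \<phi> y\<bar> \<le> C * vnorm n (\<lambda>i. x i - y i)"
    using \<phi> unfolding bdd_lipschitz_def by blast
  have "depends_lipschitz (t ` {..<n}) X"
  proof (rule depends_lipschitzI[of _ K "C * (n * 2)"])
    fix \<omega> \<omega>' :: "real \<Rightarrow> real"
    let ?d = "\<Sum>s\<in>t ` {..<n}. \<bar>\<omega> s - \<omega>' s\<bar>"
    have d: "\<bar>\<omega> (t i) - \<omega>' (t i)\<bar> \<le> ?d" if "i < n" for i
      using that by (intro member_le_sum) auto
    have "\<bar>increment t \<omega> i - increment t \<omega>' i\<bar> \<le> 2 * ?d" if i: "i < n" for i
      using d[OF i] d[of "i - 1"] i by (cases "i = 0") (simp_all add: increment_def, linarith?)
    then have "vnorm n (\<lambda>i. increment t \<omega> i - increment t \<omega>' i) \<le> (\<Sum>i<n. 2 * ?d)"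
      by (intro order_trans[OF vnorm_le_sum] sum_mono) simp
    from mult_left_mono[OF this K(2)] K(3)[of "increment t \<omega>" "increment t \<omega>'"]
    show "\<bar>X \<omega> - X \<omega>'\<bar> \<le> C * (n * 2) * ?d" by (simp add: X mult.assoc)
  qed (use K X in auto)
  moreover have "t ` {..<n} \<noteq> {}" using t by (auto simp: time_grid_def lessThan_empty_iff)
  ultimately show "\<exists>S. finite S \<and> S \<noteq> {} \<and> S \<subseteq> {0..T} \<and> depends_lipschitz S X"
    using time_grid_subset[OF t] by blast
next
  assume "\<exists>S. finite S \<and> S \<noteq> {} \<and> S \<subseteq> {0..T} \<and> depends_lipschitz S X"
  then obtain S where S: "finite S" "S \<noteq> {}" "S \<subseteq> {0..T}" and X: "depends_lipschitz S X" by auto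
  obtain n t where t: "time_grid T n t" "t ` {..<n} = S"
    using exists_time_grid[OF S] .
  have "X \<omega> = X (grid_path n t (increment t \<omega>))" for \<omega>
    using grid_path_increment[OF t(1)] t(2) by (intro depends_lipschitz_cong[OF X]) simp
  then have "X = (\<lambda>\<omega>. (\<lambda>x. X (grid_path n t x)) (increment t \<omega>))" by auto
  moreover have "(\<lambda>x. X (grid_path n t x)) \<in> bdd_lipschitz n"
    using bdd_lipschitz_grid_path[OF t(1)] X t(2) by simp
  ultimately show "X \<in> Lip_cyl T"
    unfolding Lip_cyl_def using t(1) by blast
qed

lemma Lip_cyl_common:
  assumes "X \<in> Lip_cyl T" "Y \<in> Lip_cyl T"
  obtains S where "finite S" "S \<noteq> {}" "S \<subseteq> {0..T}" "depends_lipschitz S X" "depends_lipschitz S Y"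
proof -
  obtain S S' where "finite S" "S \<noteq> {}" "S \<subseteq> {0..T}" "depends_lipschitz S X"
    "finite S'" "S' \<subseteq> {0..T}" "depends_lipschitz S' Y"
    using assms unfolding Lip_cyl_iff by blast
  then show ?thesis
    by (intro that[of "S \<union> S'"]) (auto intro: depends_lipschitz_mono)
qed

lemma Lip_cyl_const: "0 \<le> T \<Longrightarrow> (\<lambda>_. c) \<in> Lip_cyl T"
  unfolding Lip_cyl_iff by (intro exI[of _ "{0}"]) (auto intro: depends_lipschitz_const)

lemma Lip_cyl_add: "X \<in> Lip_cyl T \<Longrightarrow> Y \<in> Lip_cyl T \<Longrightarrow> (\<lambda>\<omega>. X \<omega> + Y \<omega>) \<in> Lip_cyl T"
  by (rule Lip_cyl_common[of X T Y]) (auto simp: Lip_cyl_iff intro: depends_lipschitz_add)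

lemma Lip_cyl_compose:
  fixes g :: "real \<Rightarrow> real"
  assumes "X \<in> Lip_cyl T" "\<And>x y. \<bar>g x - g y\<bar> \<le> c * \<bar>x - y\<bar>" "0 \<le> c"
  shows "(\<lambda>\<omega>. g (X \<omega>)) \<in> Lip_cyl T"
  using assms(1) depends_lipschitz_compose[OF _ assms(2,3)] unfolding Lip_cyl_iff by blast

lemma Lip_cyl_scale: "X \<in> Lip_cyl T \<Longrightarrow> (\<lambda>\<omega>. a * X \<omega>) \<in> Lip_cyl T"
  by (rule Lip_cyl_compose[where c="\<bar>a\<bar>"]) (auto simp: abs_mult simp flip: right_diff_distrib)

lemma Lip_cyl_abs: "X \<in> Lip_cyl T \<Longrightarrow> (\<lambda>\<omega>. \<bar>X \<omega>\<bar>) \<in> Lip_cyl T"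
  by (rule Lip_cyl_compose[where c=1]) auto

lemma Lip_cyl_diff: "X \<in> Lip_cyl T \<Longrightarrow> Y \<in> Lip_cyl T \<Longrightarrow> (\<lambda>\<omega>. X \<omega> - Y \<omega>) \<in> Lip_cyl T"
  using Lip_cyl_add[of X T "\<lambda>\<omega>. (- 1) * Y \<omega>"] Lip_cyl_scale[of Y T "- 1"] by simp

lemma Lip_cyl_pos_part: "X \<in> Lip_cyl T \<Longrightarrow> (\<lambda>\<omega>. max (X \<omega>) 0) \<in> Lip_cyl T"
  by (rule Lip_cyl_compose[where c=1]) auto

lemma Lip_cyl_bounded: "X \<in> Lip_cyl T \<Longrightarrow> \<exists>K. \<forall>\<omega>. \<bar>X \<omega>\<bar> \<le> K"
  by (auto simp: Lip_cyl_iff depends_lipschitz_def)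

text \<open>
  For \<open>a \<ge> 0\<close> the truncated fourth power \<open>min 1 (a * \<bar>u\<bar>) ^ 4\<close> is bounded and Lipschitz, so that it
  may be applied to increments within the cylinder variables. It dominates the indicator of
  \<open>1 \<le> a * \<bar>u\<bar>\<close> and is dominated by \<open>a ^ 4 * u ^ 4\<close>.
\<close>

definition trunc4 :: "real \<Rightarrow> real \<Rightarrow> real" where
  "trunc4 a u = min 1 (a * \<bar>u\<bar>) ^ 4"

lemma trunc4_lipschitz:
  assumes "0 \<le> a"
  shows "\<bar>trunc4 a u - trunc4 a v\<bar> \<le> 4 * a * \<bar>u - v\<bar>"
proof -
  have "\<bar>min 1 (a * \<bar>u\<bar>) ^ 4 - min 1 (a * \<bar>v\<bar>) ^ 4\<bar> \<le> 4 * \<bar>min 1 (a * \<bar>u\<bar>) - min 1 (a * \<bar>v\<bar>)\<bar>"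
    using norm_power_diff[of "min 1 (a * \<bar>u\<bar>)" "min 1 (a * \<bar>v\<bar>)" 4] assms by simp
  also have "\<bar>min 1 (a * \<bar>u\<bar>) - min 1 (a * \<bar>v\<bar>)\<bar> \<le> \<bar>a * \<bar>u\<bar> - a * \<bar>v\<bar>\<bar>" by linarith
  also have "\<dots> \<le> a * \<bar>u - v\<bar>"
    using assms by (simp add: abs_mult flip: right_diff_distrib) (intro mult_left_mono abs_triangle_ineq3)
  finally show ?thesis by (simp add: trunc4_def)
qed

lemma trunc4_nonneg: "0 \<le> trunc4 a u"
  by (simp add: trunc4_def)

lemma trunc4_le_1: "0 \<le> a \<Longrightarrow> trunc4 a u \<le> 1"
  unfolding trunc4_def by (intro power_le_one) auto

lemma trunc4_le: "0 \<le> a \<Longrightarrow> trunc4 a u \<le> a ^ 4 * u ^ 4"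
  using power_mono[of "min 1 (a * \<bar>u\<bar>)" "a * \<bar>u\<bar>" 4] by (simp add: trunc4_def power_mult_distrib)

lemma trunc4_eq_1: "1 \<le> a * \<bar>u\<bar> \<Longrightarrow> trunc4 a u = 1"
  by (simp add: trunc4_def)

lemma trunc4_eq_0: "0 < a \<Longrightarrow> trunc4 a u = 0 \<longleftrightarrow> u = 0"
  by (auto simp: trunc4_def min_def)

lemma bdd_lipschitz_trunc4: "0 \<le> a \<Longrightarrow> i < n \<Longrightarrow> (\<lambda>x. trunc4 a (x i)) \<in> bdd_lipschitz n"
proof -
  assume a: "0 \<le> a" and i: "i < n"
  have "\<bar>trunc4 a (x i) - trunc4 a (y i)\<bar> \<le> (4 * a) * vnorm n (\<lambda>i. x i - y i)" for x y
    using trunc4_lipschitz[OF a, of "x i" "y i"] vnorm_ge[OF i, of "\<lambda>i. x i - y i"]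
      mult_left_mono[of "\<bar>x i - y i\<bar>" "vnorm n (\<lambda>i. x i - y i)" "4 * a"] a by simp
  moreover have "\<bar>trunc4 a (x i)\<bar> \<le> 1" for x
    using trunc4_le_1[OF a] trunc4_nonneg by simp
  ultimately show ?thesis
    using a by (intro bdd_lipschitzI[of _ 1 "4 * a"]) auto
qed

text \<open>
  What is used of the \<open>G\<close>-expectation: it is a sublinear expectation on the cylinder
  variables. The increments of the coordinate process obey the fourth moment bound of Kolmogorov's
  continuity criterion, and \<open>moment_0\<close> controls the tails of the coordinates.
\<close>

locale cylinder_expectation =
  fixes T :: real and E :: "((real \<Rightarrow> real) \<Rightarrow> real) \<Rightarrow> real" and C :: real
  assumes T_pos: "0 < T"
    and E_mono: "\<And>X Y. X \<in> Lip_cyl T \<Longrightarrow> Y \<in> Lip_cyl T \<Longrightarrow> (\<And>\<omega>. X \<omega> \<le> Y \<omega>) \<Longrightarrow> E X \<le> E Y"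
    and E_const: "\<And>c. E (\<lambda>_. c) = c"
    and E_add: "\<And>X Y. X \<in> Lip_cyl T \<Longrightarrow> Y \<in> Lip_cyl T \<Longrightarrow> E (\<lambda>\<omega>. X \<omega> + Y \<omega>) \<le> E X + E Y"
    and E_scale: "\<And>a X. X \<in> Lip_cyl T \<Longrightarrow> 0 \<le> a \<Longrightarrow> E (\<lambda>\<omega>. a * X \<omega>) = a * E X"
    and C_nonneg: "0 \<le> C"
    and moment: "\<And>a s t. 0 \<le> a \<Longrightarrow> 0 \<le> s \<Longrightarrow> s \<le> t \<Longrightarrow> t \<le> T \<Longrightarrow>
      E (\<lambda>\<omega>. trunc4 a (\<omega> t - \<omega> s)) \<le> a ^ 4 * C * (t - s)\<^sup>2"
    and moment_0: "\<And>a t. 0 \<le> a \<Longrightarrow> 0 \<le> t \<Longrightarrow> t \<le> T \<Longrightarrow> E (\<lambda>\<omega>. trunc4 a (\<omega> t)) \<le> a ^ 4 * C * T\<^sup>2"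

context cylinder_expectation
begin

lemma cyl_const [simp]: "(\<lambda>_. c) \<in> Lip_cyl T"
  using T_pos by (intro Lip_cyl_const) simp

end

lemma bdd_lipschitz_subset_loc_lipschitz: "bdd_lipschitz n \<subseteq> loc_lipschitz n"
proof
  fix \<phi> assume "\<phi> \<in> bdd_lipschitz n"
  then obtain C where C: "0 \<le> C" "\<And>x y. \<bar>\<phi> x - \<phi> y\<bar> \<le> C * vnorm n (\<lambda>i. x i - y i)"
    unfolding bdd_lipschitz_def by blast
  have "\<bar>\<phi> x - \<phi> y\<bar> \<le> C * (1 + vnorm n x ^ 0 + vnorm n y ^ 0) * vnorm n (\<lambda>i. x i - y i)" for x y
    using C(2)[of x y] mult_nonneg_nonneg[OF C(1) vnorm_nonneg[of n "\<lambda>i. x i - y i"]] by simp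
  with C(1) show "\<phi> \<in> loc_lipschitz n" unfolding loc_lipschitz_def by blast
qed

lemma loc_lipschitz_power4: "(\<lambda>x. x 0 ^ 4) \<in> loc_lipschitz 1"
proof -
  have *: "\<bar>x ^ 4 - y ^ 4\<bar> \<le> 4 * (1 + \<bar>x\<bar> ^ 3 + \<bar>y\<bar> ^ 3) * \<bar>x - y\<bar>" for x y :: real
  proof -
    define m where "m = max \<bar>x\<bar> \<bar>y\<bar>"
    have m: "\<bar>x\<bar> \<le> m" "\<bar>y\<bar> \<le> m" "0 \<le> m" by (auto simp: m_def)
    have "\<bar>x ^ 3 + x\<^sup>2 * y + x * y\<^sup>2 + y ^ 3\<bar> \<le> \<bar>x\<bar> ^ 3 + \<bar>x\<bar>\<^sup>2 * \<bar>y\<bar> + \<bar>x\<bar> * \<bar>y\<bar>\<^sup>2 + \<bar>y\<bar> ^ 3"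
      by (intro order_trans[OF abs_triangle_ineq] add_mono) (simp_all add: abs_mult power_abs)
    also have "\<dots> \<le> m ^ 3 + m\<^sup>2 * m + m * m\<^sup>2 + m ^ 3"
      using m by (intro add_mono mult_mono power_mono) auto
    also have "\<dots> = 4 * m ^ 3" by (simp add: power3_eq_cube power2_eq_square)
    also have "\<dots> \<le> 4 * (1 + \<bar>x\<bar> ^ 3 + \<bar>y\<bar> ^ 3)" by (simp add: m_def max_def)
    finally have "\<bar>x ^ 3 + x\<^sup>2 * y + x * y\<^sup>2 + y ^ 3\<bar> * \<bar>x - y\<bar> \<le> 4 * (1 + \<bar>x\<bar> ^ 3 + \<bar>y\<bar> ^ 3) * \<bar>x - y\<bar>"
      by (intro mult_right_mono) auto
    moreover have "x ^ 4 - y ^ 4 = (x ^ 3 + x\<^sup>2 * y + x * y\<^sup>2 + y ^ 3) * (x - y)"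
      by (simp add: algebra_simps power2_eq_square power3_eq_cube power4_eq_xxxx)
    ultimately show ?thesis by (simp add: abs_mult)
  qed
  have "vnorm 1 x = \<bar>x 0\<bar>" for x by (simp add: vnorm_def L2_set_def lessThan_Suc)
  with * have "\<forall>x y. \<bar>x 0 ^ 4 - y 0 ^ 4\<bar> \<le> 4 * (1 + vnorm 1 x ^ 3 + vnorm 1 y ^ 3) * vnorm 1 (\<lambda>i. x i - y i)"
    by simp
  then show ?thesis
    unfolding loc_lipschitz_def mem_Collect_eq by (intro exI[of _ "4::real"] exI[of _ "3::nat"] conjI) auto
qed

text \<open>
  For two cylinder variables over a common grid, the random path \<open>\<Psi> n t w\<close> below transports their
  \<open>E\<close>-expectations to the space carrying the sequence \<open>Z\<close>, so \<open>E\<close> inherits sublinearity. The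
  moment bound is scaling: an increment over a time span \<open>h\<close> has the law of \<open>sqrt h * Z i\<close>, whose
  fourth moment is \<open>h\<^sup>2\<close> times the finite one of \<open>Z i\<close>.
\<close>

lemma cylinder_expectation_of_G_expectation:
  fixes H :: "('w \<Rightarrow> real) set"
  assumes T: "0 < T" and H: "sublinear_expectation_space H E'" and Z: "G_normal_seq H E' \<sigma>l \<sigma>u Z"
    and E: "G_expectation T E' Z E"
  obtains C where "cylinder_expectation T E C"
proof -
  have H_scale: "(\<lambda>w. a * X w) \<in> H" if "X \<in> H" for a X
    using H that unfolding sublinear_expectation_space_def by blast
  have H_comp: "(\<lambda>w. \<phi> (\<lambda>i. X i w)) \<in> H" if "\<And>i. i < n \<Longrightarrow> X i \<in> H" "\<phi> \<in> loc_lipschitz n" for n X \<phi>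
    using H that unfolding sublinear_expectation_space_def by blast
  have "sublinear_expectation H (\<lambda>X Y. \<forall>w. X w \<le> Y w) (\<lambda>c _. c)
       (\<lambda>X Y w. X w + Y w) (\<lambda>a X w. a * X w) E'"
    using H unfolding sublinear_expectation_space_def by blast
  then have E'_mono: "\<And>X Y. X \<in> H \<Longrightarrow> Y \<in> H \<Longrightarrow> (\<And>w. X w \<le> Y w) \<Longrightarrow> E' X \<le> E' Y"
    and E'_const: "\<And>c. E' (\<lambda>_. c) = c"
    and E'_add: "\<And>X Y. X \<in> H \<Longrightarrow> Y \<in> H \<Longrightarrow> E' (\<lambda>w. X w + Y w) \<le> E' X + E' Y"
    and E'_scale: "\<And>X a. X \<in> H \<Longrightarrow> 0 \<le> a \<Longrightarrow> E' (\<lambda>w. a * X w) = a * E' X"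
    unfolding sublinear_expectation_def by blast+
  have Z_H: "Z i \<in> H" for i using Z by (auto simp: G_normal_seq_def G_normal_def)
  have E_eq: "E (\<lambda>\<omega>. \<phi> (increment t \<omega>)) = E' (\<lambda>w. \<phi> (\<lambda>i. sqrt (increment t (\<lambda>s. s) i) * Z i w))"
    if "time_grid T n t" "\<phi> \<in> bdd_lipschitz n" for n t \<phi>
    using E that unfolding G_expectation_def by blast
  have comp_H: "(\<lambda>w. \<phi> (\<lambda>i. sqrt (increment t (\<lambda>s. s) i) * Z i w)) \<in> H"
    if "\<phi> \<in> bdd_lipschitz n" for n t \<phi>
    by (rule H_comp[where X="\<lambda>i w. sqrt (increment t (\<lambda>s. s) i) * Z i w" and n=n,
          OF H_scale[OF Z_H] subsetD[OF bdd_lipschitz_subset_loc_lipschitz that]])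
  define \<Psi> where "\<Psi> n t w = grid_path n t (\<lambda>i. sqrt (increment t (\<lambda>s. s) i) * Z i w)" for n t w
  have E_grid: "E X = E' (\<lambda>w. X (\<Psi> n t w))" "(\<lambda>w. X (\<Psi> n t w)) \<in> H"
    if t: "time_grid T n t" and X: "depends_lipschitz (t ` {..<n}) X" for n t X
  proof -
    note \<phi> = bdd_lipschitz_grid_path[OF t X]
    have "X = (\<lambda>\<omega>. X (grid_path n t (increment t \<omega>)))"
      by (intro ext depends_lipschitz_cong[OF X]) (simp add: grid_path_increment[OF t])
    then show "E X = E' (\<lambda>w. X (\<Psi> n t w))" using E_eq[OF t \<phi>] by (simp add: \<Psi>_def)
    show "(\<lambda>w. X (\<Psi> n t w)) \<in> H" using comp_H[OF \<phi>] by (simp add: \<Psi>_def)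
  qed
  have common: "\<exists>n t. time_grid T n t \<and> depends_lipschitz (t ` {..<n}) X \<and> depends_lipschitz (t ` {..<n}) Y"
    if XY: "X \<in> Lip_cyl T" "Y \<in> Lip_cyl T" for X Y
  proof -
    obtain S where S: "finite S" "S \<noteq> {}" "S \<subseteq> {0..T}" and dep: "depends_lipschitz S X" "depends_lipschitz S Y"
      by (rule Lip_cyl_common[OF XY])
    obtain n t where "time_grid T n t" "t ` {..<n} = S" by (rule exists_time_grid[OF S])
    with dep show ?thesis by blast
  qed
  define m where "m i = E' (\<lambda>w. Z i w ^ 4)" for i
  have Z4_H: "(\<lambda>w. Z i w ^ 4) \<in> H" for i
    using H_comp[OF _ loc_lipschitz_power4, of "\<lambda>_. Z i"] Z_H by simp
  have m_nonneg: "0 \<le> m i" for i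
  proof -
    have "E' (\<lambda>w. 0 * Z i w ^ 4) \<le> E' (\<lambda>w. Z i w ^ 4)"
      by (intro E'_mono Z4_H H_scale) simp
    then show ?thesis using E'_const[of 0] by (simp add: m_def)
  qed
  have E_trunc4: "E (\<lambda>\<omega>. trunc4 a (increment t \<omega> i)) \<le> a ^ 4 * (increment t (\<lambda>s. s) i)\<^sup>2 * m i"
    if t: "time_grid T n t" and i: "i < n" and a: "0 \<le> a" and nn: "0 \<le> increment t (\<lambda>s. s) i" for n t i a
  proof -
    define d where "d = increment t (\<lambda>s. s) i"
    note \<phi> = bdd_lipschitz_trunc4[OF a i]
    have "E (\<lambda>\<omega>. trunc4 a (increment t \<omega> i)) = E' (\<lambda>w. trunc4 a (sqrt d * Z i w))"
      using E_eq[OF t \<phi>] by (simp add: d_def)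
    also have "\<dots> \<le> E' (\<lambda>w. (a ^ 4 * d\<^sup>2) * Z i w ^ 4)"
    proof (intro E'_mono H_scale Z4_H)
      show "(\<lambda>w. trunc4 a (sqrt d * Z i w)) \<in> H" using comp_H[OF \<phi>, of t] by (simp add: d_def)
      have "sqrt d ^ 4 = d\<^sup>2"
        using nn power_mult[of "sqrt d" 2 2] by (simp add: d_def)
      then show "trunc4 a (sqrt d * Z i w) \<le> (a ^ 4 * d\<^sup>2) * Z i w ^ 4" for w
        using trunc4_le[OF a, of "sqrt d * Z i w"] by (simp add: power_mult_distrib mult.assoc)
    qed
    also have "\<dots> = a ^ 4 * d\<^sup>2 * m i"
      unfolding m_def using a by (intro E'_scale Z4_H) simp
    finally show ?thesis by (simp add: d_def)
  qed
  define C where "C = max (m 0) (m 1)"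
  have "cylinder_expectation T E C"
  proof
    fix X Y assume XY: "X \<in> Lip_cyl T" "Y \<in> Lip_cyl T"
    obtain n t where t: "time_grid T n t" and
      dep: "depends_lipschitz (t ` {..<n}) X" "depends_lipschitz (t ` {..<n}) Y"
      using common[OF XY] by auto
    show "E X \<le> E Y" if "\<And>\<omega>. X \<omega> \<le> Y \<omega>"
      unfolding E_grid(1)[OF t dep(1)] E_grid(1)[OF t dep(2)]
      by (intro E'_mono E_grid[OF t] dep that)
    show "E (\<lambda>\<omega>. X \<omega> + Y \<omega>) \<le> E X + E Y"
      unfolding E_grid(1)[OF t dep(1)] E_grid(1)[OF t dep(2)] E_grid(1)[OF t depends_lipschitz_add[OF dep]]
      by (intro E'_add E_grid[OF t] dep)
  next
    fix c :: real
    have t: "time_grid T 1 (\<lambda>_. 0)" using T by (simp add: time_grid_def)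
    show "E (\<lambda>_. c) = c"
      using E_grid(1)[OF t depends_lipschitz_const] by (simp add: E'_const)
  next
    fix a X assume X: "X \<in> Lip_cyl T" and a: "0 \<le> (a::real)"
    obtain n t where t: "time_grid T n t" and dep: "depends_lipschitz (t ` {..<n}) X"
      using common[OF X X] by auto
    have dep': "depends_lipschitz (t ` {..<n}) (\<lambda>\<omega>. a * X \<omega>)"
      using a by (intro depends_lipschitz_compose[OF dep, of "\<lambda>x. a * x" a])
        (auto simp: abs_mult simp flip: right_diff_distrib)
    show "E (\<lambda>\<omega>. a * X \<omega>) = a * E X"
      unfolding E_grid(1)[OF t dep'] E_grid(1)[OF t dep]
      by (intro E'_scale E_grid[OF t] dep a)
  next
    fix a s t :: real assume a: "0 \<le> a" and st: "0 \<le> s" "s \<le> t" "t \<le> T"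
    show "E (\<lambda>\<omega>. trunc4 a (\<omega> t - \<omega> s)) \<le> a ^ 4 * C * (t - s)\<^sup>2"
    proof (cases "s = t")
      case True
      have t: "time_grid T 1 (\<lambda>_. 0)" using T by (simp add: time_grid_def)
      show ?thesis
        using E_grid(1)[OF t depends_lipschitz_const, of 0] by (simp add: True trunc4_def E'_const)
    next
      case False
      define g where "g i = (if i = 0 then s else t)" for i :: nat
      have g: "time_grid T 2 g" using st False by (auto simp: time_grid_def g_def)
      have "E (\<lambda>\<omega>. trunc4 a (\<omega> t - \<omega> s)) \<le> a ^ 4 * (t - s)\<^sup>2 * m 1"
        using E_trunc4[OF g, of 1 a] a st by (simp add: increment_def g_def)
      also have "\<dots> \<le> a ^ 4 * (t - s)\<^sup>2 * C" by (intro mult_left_mono) (auto simp: C_def)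
      finally show ?thesis by (simp add: mult_ac)
    qed
  next
    fix a t :: real assume a: "0 \<le> a" and t: "0 \<le> t" "t \<le> T"
    have g: "time_grid T 1 (\<lambda>_. t)" using t by (auto simp: time_grid_def)
    have "E (\<lambda>\<omega>. trunc4 a (\<omega> t)) \<le> a ^ 4 * t\<^sup>2 * m 0"
      using E_trunc4[OF g, of 0 a] a t by (simp add: increment_def)
    also have "\<dots> \<le> a ^ 4 * T\<^sup>2 * C"
      using a t m_nonneg[of 0] by (intro mult_mono power_mono) (auto simp: C_def)
    finally show "E (\<lambda>\<omega>. trunc4 a (\<omega> t)) \<le> a ^ 4 * C * T\<^sup>2" by (simp add: mult_ac)
  qed (use T m_nonneg in \<open>auto simp: C_def le_max_iff_disj\<close>)
  then show ?thesis by (rule that)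
qed

section \<open>Linear functionals below the sublinear expectation\<close>

lemma depends_lipschitz_continuous:
  assumes "depends_lipschitz S X"
  shows "continuous_on UNIV X"
proof -
  obtain K C where X: "\<And>\<omega>. \<bar>X \<omega>\<bar> \<le> K" "0 \<le> C"
    "\<And>\<omega> \<omega>'. \<bar>X \<omega> - X \<omega>'\<bar> \<le> C * (\<Sum>s\<in>S. \<bar>\<omega> s - \<omega>' s\<bar>)"
    using assms by (rule depends_lipschitzE) blast
  have "(X \<longlongrightarrow> X \<omega>) (at \<omega>)" for \<omega>
  proof (rule LIM_zero_cancel, rule Lim_null_comparison)
    have coord: "((\<lambda>\<omega>'. \<omega>' s) \<longlongrightarrow> \<omega> s) (at \<omega>)" for s
      using continuous_on_product_coordinates[of s] unfolding continuous_on_def by blast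
    have "((\<lambda>\<omega>'. C * (\<Sum>s\<in>S. \<bar>\<omega>' s - \<omega> s\<bar>)) \<longlongrightarrow> C * (\<Sum>s\<in>S. \<bar>\<omega> s - \<omega> s\<bar>)) (at \<omega>)"
      by (intro tendsto_intros coord)
    then show "((\<lambda>\<omega>'. C * (\<Sum>s\<in>S. \<bar>\<omega>' s - \<omega> s\<bar>)) \<longlongrightarrow> 0) (at \<omega>)" by simp
  qed (use X in auto)
  then show ?thesis by (simp add: continuous_on_def)
qed

lemma compact_box_fun:
  fixes B :: "'a \<Rightarrow> real set"
  assumes "\<And>s. compact (B s)"
  shows "compact {\<omega>. \<forall>s. \<omega> s \<in> B s}"
proof -
  have "compactin (product_topology (\<lambda>_. euclidean) UNIV) (PiE UNIV B)"
    using assms by (simp add: compactin_PiE)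
  moreover have "PiE UNIV B = {\<omega>. \<forall>s. \<omega> s \<in> B s}" by auto
  ultimately show ?thesis by (simp add: euclidean_product_topology)
qed

text \<open>
  A linear functional on the cylinder variables below the sublinear expectation. Such a functional
  is automatically positive and normalised.
\<close>

locale dominated_functional = cylinder_expectation +
  fixes f :: "((real \<Rightarrow> real) \<Rightarrow> real) \<Rightarrow> real"
  assumes f_add: "\<And>X Y. X \<in> Lip_cyl T \<Longrightarrow> Y \<in> Lip_cyl T \<Longrightarrow> f (\<lambda>\<omega>. X \<omega> + Y \<omega>) = f X + f Y"
    and f_scale: "\<And>a X. X \<in> Lip_cyl T \<Longrightarrow> f (\<lambda>\<omega>. a * X \<omega>) = a * f X"
    and f_le: "\<And>X. X \<in> Lip_cyl T \<Longrightarrow> f X \<le> E X"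
begin

lemma f_mono:
  assumes "X \<in> Lip_cyl T" "Y \<in> Lip_cyl T" "\<And>\<omega>. X \<omega> \<le> Y \<omega>"
  shows "f X \<le> f Y"
proof -
  have "f (\<lambda>\<omega>. X \<omega> + (- 1) * Y \<omega>) \<le> E (\<lambda>\<omega>. X \<omega> + (- 1) * Y \<omega>)"
    using assms by (intro f_le Lip_cyl_add Lip_cyl_scale)
  also have "\<dots> \<le> E (\<lambda>_. 0)"
    using assms by (intro E_mono Lip_cyl_add Lip_cyl_scale) auto
  finally have "f (\<lambda>\<omega>. X \<omega> + (- 1) * Y \<omega>) \<le> 0" by (simp add: E_const)
  moreover have "f (\<lambda>\<omega>. X \<omega> + (- 1) * Y \<omega>) = f X + (- 1) * f Y"
    using assms by (simp only: f_add[OF assms(1) Lip_cyl_scale[OF assms(2)]] f_scale)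
  ultimately show ?thesis by simp
qed

lemma f_const: "f (\<lambda>_. c) = c"
proof (rule antisym)
  show "f (\<lambda>_. c) \<le> c" using f_le[of "\<lambda>_. c"] by (simp add: E_const)
  have "f (\<lambda>_. - c) \<le> - c" using f_le[of "\<lambda>_. - c"] by (simp add: E_const)
  then show "c \<le> f (\<lambda>_. c)" using f_scale[of "\<lambda>_. c" "- 1"] by simp
qed

lemma sum_cyl: "finite S \<Longrightarrow> (\<And>s. s \<in> S \<Longrightarrow> X s \<in> Lip_cyl T) \<Longrightarrow> (\<lambda>\<omega>. \<Sum>s\<in>S. X s \<omega>) \<in> Lip_cyl T"
  by (induction S rule: finite_induct) (auto intro: Lip_cyl_add)

lemma f_sum: "finite S \<Longrightarrow> (\<And>s. s \<in> S \<Longrightarrow> X s \<in> Lip_cyl T) \<Longrightarrow> f (\<lambda>\<omega>. \<Sum>s\<in>S. X s \<omega>) = (\<Sum>s\<in>S. f (X s))"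
  by (induction S rule: finite_induct) (auto simp: f_const f_add sum_cyl)

text \<open>
  A dominated functional is \<open>\<sigma>\<close>-smooth. The functions \<open>X n\<close> depend on countably many coordinates
  \<open>D\<close> in total. Choose scales \<open>a d > 0\<close> so small that \<open>f\<close> is at most \<open>\<epsilon> / 2 ^ idx d\<close> on the
  truncated fourth power of the coordinate \<open>d\<close> at scale \<open>a d\<close>. The box of all \<open>\<omega>\<close> that vanish off
  \<open>D\<close> and satisfy \<open>\<bar>\<omega> d\<bar> \<le> 1 / a d\<close> for \<open>d \<in> D\<close> is compact by Tychonoff's theorem, so the convergence
  is uniform there by Dini's argument. If \<open>\<omega>\<close> violates the bound at a coordinate on which \<open>X N\<close> depends,
  then \<open>X N \<omega>\<close> is at most a constant times the sum of the truncated fourth powers.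
\<close>

lemma sigma_smooth:
  assumes X: "\<And>n. X n \<in> Lip_cyl T" and dec: "\<And>n \<omega>. X (Suc n) \<omega> \<le> X n \<omega>"
    and lim: "\<And>\<omega>. (\<lambda>n. X n \<omega>) \<longlonglongrightarrow> 0"
  shows "(\<lambda>n. f (X n)) \<longlonglongrightarrow> 0"
proof -
  have dec': "X n \<omega> \<le> X m \<omega>" if "m \<le> n" for m n \<omega>
    using dec lift_Suc_antimono_le[of "\<lambda>n. X n \<omega>" m n] that by blast
  have nonneg: "0 \<le> X n \<omega>" for n \<omega>
    using dec lim[of \<omega>] by (intro decseq_ge[of "\<lambda>n. X n \<omega>"]) (auto intro: decseq_SucI)
  obtain K where K: "\<And>\<omega>. X 0 \<omega> \<le> K" using Lip_cyl_bounded[OF X, of 0] by (auto simp: abs_le_iff)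
  have K0: "0 \<le> K" using K[of undefined] nonneg[of 0 undefined] by linarith
  have "\<forall>n. \<exists>S. finite S \<and> S \<subseteq> {0..T} \<and> depends_lipschitz S (X n)"
    using X unfolding Lip_cyl_iff by blast
  then obtain S where S: "\<And>n. finite (S n)" "\<And>n. S n \<subseteq> {0..T}" "\<And>n. depends_lipschitz (S n) (X n)"
    by metis
  define D where "D = (\<Union>n. S n)"
  have D: "countable D" "D \<subseteq> {0..T}" using S(1,2) by (auto simp: D_def intro: countable_finite)
  define idx where "idx = to_nat_on D"
  have idx: "inj_on idx D" unfolding idx_def by (rule inj_on_to_nat_on[OF D(1)])
  have main: "\<exists>N. \<forall>n\<ge>N. f (X n) \<le> \<epsilon> + 2 * K * \<epsilon>" if \<epsilon>: "0 < \<epsilon>" for \<epsilon>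
  proof -
    define a where "a d = min 1 (\<epsilon> * (1 / 2) ^ idx d / (C * T\<^sup>2 + 1))" for d
    have CT: "0 < C * T\<^sup>2 + 1" using C_nonneg by (simp add: add_nonneg_pos)
    have a_pos: "0 < a d" for d using \<epsilon> CT by (simp add: a_def)
    have a_small: "a d ^ 4 * C * T\<^sup>2 \<le> \<epsilon> * (1 / 2) ^ idx d" for d
    proof -
      have "a d ^ 4 \<le> a d" using a_pos[of d] power_decreasing[of 1 4 "a d"] by (simp add: a_def)
      then have "a d ^ 4 * (C * T\<^sup>2) \<le> a d * (C * T\<^sup>2 + 1)"
        using C_nonneg a_pos[of d] by (intro mult_mono) auto
      also have "\<dots> \<le> \<epsilon> * (1 / 2) ^ idx d / (C * T\<^sup>2 + 1) * (C * T\<^sup>2 + 1)"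
        using CT by (intro mult_right_mono) (auto simp: a_def)
      finally show ?thesis using CT by (simp add: mult.assoc)
    qed
    have trunc_cyl: "(\<lambda>\<omega>. trunc4 (a d) (\<omega> d)) \<in> Lip_cyl T" if "d \<in> D" for d
      using that D(2) less_imp_le[OF a_pos] trunc4_le_1 trunc4_nonneg trunc4_lipschitz
      unfolding Lip_cyl_iff by (intro exI[of _ "{d}"]) (auto intro!: depends_lipschitzI[of _ 1 "4 * a d"])
    define B where "B s = (if s \<in> D then {- (1 / a s)..1 / a s} else {0})" for s
    define Kc where "Kc = {\<omega>. \<forall>s. \<omega> s \<in> B s}"
    have "compact Kc" unfolding Kc_def by (intro compact_box_fun) (auto simp: B_def)
    have "\<exists>N. Kc \<inter> {\<omega>. \<epsilon> \<le> X N \<omega>} = {}"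
    proof (rule ccontr)
      assume "\<nexists>N. Kc \<inter> {\<omega>. \<epsilon> \<le> X N \<omega>} = {}"
      then have ne: "Kc \<inter> {\<omega>. \<epsilon> \<le> X N \<omega>} \<noteq> {}" for N by blast
      have "Kc \<inter> \<Inter>(range (\<lambda>n. {\<omega>. \<epsilon> \<le> X n \<omega>})) \<noteq> {}"
      proof (rule compact_imp_fip[OF \<open>compact Kc\<close>])
        fix F assume "F \<in> range (\<lambda>n. {\<omega>. \<epsilon> \<le> X n \<omega>})"
        then show "closed F"
          using depends_lipschitz_continuous[OF S(3)] by (auto intro!: closed_Collect_le)
      next
        fix F assume "finite F" "F \<subseteq> range (\<lambda>n. {\<omega>. \<epsilon> \<le> X n \<omega>})"
        then obtain I where I: "finite I" "F = (\<lambda>n. {\<omega>. \<epsilon> \<le> X n \<omega>}) ` I"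
          by (meson finite_subset_image)
        have "{\<omega>. \<epsilon> \<le> X (Max (insert 0 I)) \<omega>} \<subseteq> \<Inter>F"
          using I dec' by (auto intro: order_trans)
        with ne show "Kc \<inter> \<Inter>F \<noteq> {}" by blast
      qed
      then obtain \<omega> where "\<And>n. \<epsilon> \<le> X n \<omega>" by auto
      then have "\<epsilon> \<le> 0" using lim[of \<omega>] by (intro LIMSEQ_le_const) auto
      with \<epsilon> show False by simp
    qed
    then obtain N where "Kc \<inter> {\<omega>. \<epsilon> \<le> X N \<omega>} = {}" ..
    then have N: "X N \<omega> < \<epsilon>" if "\<omega> \<in> Kc" for \<omega>
      using that by (auto simp: disjoint_iff not_le)
    have SD: "S N \<subseteq> D" by (auto simp: D_def)
    let ?Y = "\<lambda>\<omega>. \<Sum>d\<in>S N. trunc4 (a d) (\<omega> d)"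
    have Y: "?Y \<in> Lip_cyl T" using SD by (intro sum_cyl S trunc_cyl) auto
    have bound: "X N \<omega> \<le> \<epsilon> + K * ?Y \<omega>" for \<omega>
    proof (cases "\<exists>d\<in>S N. 1 \<le> a d * \<bar>\<omega> d\<bar>")
      case True
      then obtain d where d: "d \<in> S N" "1 \<le> a d * \<bar>\<omega> d\<bar>" by blast
      have "1 \<le> ?Y \<omega>"
        using member_le_sum[of d "S N" "\<lambda>d. trunc4 (a d) (\<omega> d)"] d S(1) trunc4_eq_1[OF d(2)]
        by (simp add: trunc4_nonneg)
      then have "K * 1 \<le> K * ?Y \<omega>" using K0 by (intro mult_left_mono)
      then show ?thesis using dec'[of 0 N \<omega>] K[of \<omega>] \<epsilon> by simp
    next
      case False
      \<comment> \<open>setting the coordinates outside \<open>S N\<close> to 0 moves \<open>\<omega>\<close> into the box without changing \<open>X N\<close>\<close>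
      define \<omega>' where "\<omega>' s = (if s \<in> S N then \<omega> s else 0)" for s
      have "\<omega>' \<in> Kc"
        unfolding Kc_def
      proof (intro CollectI allI)
        fix s
        show "\<omega>' s \<in> B s"
        proof (cases "s \<in> S N")
          case True
          then have "\<bar>\<omega> s\<bar> \<le> 1 / a s" using False a_pos[of s] by (force simp: field_simps)
          then show ?thesis using True SD by (auto simp: \<omega>'_def B_def abs_le_iff)
        qed (use a_pos[of s] in \<open>auto simp: \<omega>'_def B_def less_imp_le\<close>)
      qed
      then have "X N \<omega>' < \<epsilon>" by (rule N)
      moreover have "X N \<omega> = X N \<omega>'"
        by (rule depends_lipschitz_cong[OF S(3)]) (simp add: \<omega>'_def)
      moreover have "0 \<le> K * ?Y \<omega>" using K0 by (intro mult_nonneg_nonneg sum_nonneg trunc4_nonneg)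
      ultimately show ?thesis by simp
    qed
    have "f (X N) \<le> f (\<lambda>\<omega>. \<epsilon> + K * ?Y \<omega>)"
      by (intro f_mono X Lip_cyl_add cyl_const Lip_cyl_scale Y bound)
    also have "\<dots> = \<epsilon> + K * (\<Sum>d\<in>S N. f (\<lambda>\<omega>. trunc4 (a d) (\<omega> d)))"
      using f_add[OF cyl_const Lip_cyl_scale[OF Y], of \<epsilon> K] f_scale[OF Y, of K]
        f_sum[OF S(1), of N "\<lambda>d \<omega>. trunc4 (a d) (\<omega> d)"] SD trunc_cyl by (auto simp: f_const)
    also have "\<dots> \<le> \<epsilon> + K * (\<Sum>d\<in>S N. \<epsilon> * (1 / 2) ^ idx d)"
    proof (intro add_left_mono mult_left_mono sum_mono K0)
      fix d assume "d \<in> S N"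
      then have d: "d \<in> D" using SD by blast
      have "f (\<lambda>\<omega>. trunc4 (a d) (\<omega> d)) \<le> E (\<lambda>\<omega>. trunc4 (a d) (\<omega> d))"
        by (rule f_le[OF trunc_cyl[OF d]])
      also have "\<dots> \<le> a d ^ 4 * C * T\<^sup>2" using d D(2) a_pos[of d] by (intro moment_0) auto
      finally show "f (\<lambda>\<omega>. trunc4 (a d) (\<omega> d)) \<le> \<epsilon> * (1 / 2) ^ idx d" using a_small[of d] by linarith
    qed
    also have "(\<Sum>d\<in>S N. \<epsilon> * (1 / 2) ^ idx d) = \<epsilon> * (\<Sum>j\<in>idx ` S N. (1 / 2) ^ j)"
      using inj_on_subset[OF idx SD] by (simp add: sum.reindex sum_distrib_left)
    also have "\<epsilon> + K * (\<epsilon> * (\<Sum>j\<in>idx ` S N. (1 / 2) ^ j)) \<le> \<epsilon> + K * (\<epsilon> * 2)"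
    proof (intro add_left_mono mult_left_mono K0)
      have "(\<Sum>j\<in>idx ` S N. (1 / 2) ^ j) \<le> (\<Sum>j. (1 / 2 :: real) ^ j)"
        using S(1) by (intro sum_le_suminf) auto
      then show "(\<Sum>j\<in>idx ` S N. (1 / 2) ^ j) \<le> (2 :: real)" by (simp add: suminf_geometric)
    qed (use \<epsilon> in simp)
    finally have "f (X N) \<le> \<epsilon> + 2 * K * \<epsilon>" by (simp add: mult_ac)
    moreover have "f (X n) \<le> f (X N)" if "N \<le> n" for n using that by (intro f_mono X dec')
    ultimately show ?thesis by (meson order_trans)
  qed
  have f_nonneg: "0 \<le> f (X n)" for n using f_mono[OF cyl_const X, of 0] nonneg f_const by metis
  show ?thesis
  proof (rule LIMSEQ_I)
    fix r :: real assume r: "0 < r"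
    define \<epsilon> where "\<epsilon> = r / (2 * (1 + 2 * K))"
    have "\<epsilon> * (1 + 2 * K) = r / 2"
      using K0 by (simp add: \<epsilon>_def divide_eq_eq add_pos_nonneg)
    then have "\<epsilon> + 2 * K * \<epsilon> = r / 2" by (simp add: algebra_simps)
    then have \<epsilon>: "0 < \<epsilon>" "\<epsilon> + 2 * K * \<epsilon> < r"
      using r K0 unfolding \<epsilon>_def by (auto intro!: divide_pos_pos)
    then obtain N where "\<forall>n\<ge>N. f (X n) \<le> \<epsilon> + 2 * K * \<epsilon>" using main by blast
    then show "\<exists>N. \<forall>n\<ge>N. norm (f (X n) - 0) < r"
      using \<epsilon>(2) f_nonneg by (auto intro!: exI[of _ N] le_less_trans[of "f (X _)" "\<epsilon> + 2 * K * \<epsilon>" r])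
  qed
qed

end

section \<open>Measurability in the path space\<close>

lemma path_mem_iff: "g \<in> mspace (path_space T) \<longleftrightarrow> g \<in> extensional {0..T} \<and> continuous_on {0..T} g"
proof -
  have "Metric_space.mbounded (UNIV :: real set) dist (g ` {0..T})" if "continuous_on {0..T} g"
  proof -
    have "bounded (g ` {0..T})"
      using that by (intro compact_imp_bounded compact_continuous_image) auto
    then show ?thesis
      by (metis Met_TC.mbounded_def bounded_subset_cball mcball_eq_cball)
  qed
  then show ?thesis by (auto simp: path_space_def)
qed

lemma path_dist_le:
  assumes "0 \<le> T" "g \<in> mspace (path_space T)" "h \<in> mspace (path_space T)"
  shows "mdist (path_space T) g h \<le> r \<longleftrightarrow> (\<forall>s\<in>{0..T}. \<bar>g s - h s\<bar> \<le> r)"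
proof -
  have "mdist (path_space T) g h \<le> r \<longleftrightarrow>
      (\<forall>s\<in>topspace (top_of_set {0..T}). mdist euclidean_metric (g s) (h s) \<le> r)"
    unfolding path_space_def
    by (rule cfunspace_mdist_le[OF assms(2,3)[unfolded path_space_def]]) (use assms(1) in simp)
  then show ?thesis by (simp add: dist_real_def)
qed

lemma path_open_iff:
  "openin (mtopology_of (path_space T)) U \<longleftrightarrow> U \<subseteq> mspace (path_space T) \<and>
     (\<forall>g\<in>U. \<exists>r>0. \<forall>h\<in>mspace (path_space T). mdist (path_space T) g h < r \<longrightarrow> h \<in> U)"
  unfolding mtopology_of_def Metric_space.openin_mtopology[OF Metric_space_mspace_mdist]
  unfolding Metric_space.mball_def[OF Metric_space_mspace_mdist] by blast

lemma space_path_borel [simp]: "space (path_borel T) = mspace (path_space T)"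
  unfolding path_borel_def by (rule space_measure_of) (auto simp: path_open_iff)

lemma path_borel_open: "openin (mtopology_of (path_space T)) U \<Longrightarrow> U \<in> sets (path_borel T)"
  unfolding path_borel_def by (subst sets_measure_of) (auto simp: path_open_iff)

lemma Lip_cyl_path_measurable:
  assumes T: "0 \<le> T" and X: "X \<in> Lip_cyl T"
  shows "X \<in> borel_measurable (path_borel T)"
proof (rule borel_measurableI)
  fix V :: "real set" assume V: "open V"
  obtain S where S: "finite S" "S \<subseteq> {0..T}" "depends_lipschitz S X" using X unfolding Lip_cyl_iff by blast
  obtain K C where C: "0 \<le> C" "\<And>\<omega> \<omega>'. \<bar>X \<omega> - X \<omega>'\<bar> \<le> C * (\<Sum>s\<in>S. \<bar>\<omega> s - \<omega>' s\<bar>)"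
    using S(3) by (rule depends_lipschitzE) blast
  define c where "c = C * card S + 1"
  have c: "0 < c" using C(1) by (simp add: c_def add_nonneg_pos)
  have lip: "\<bar>X g - X h\<bar> \<le> c * mdist (path_space T) g h"
    if "g \<in> mspace (path_space T)" "h \<in> mspace (path_space T)" for g h
  proof -
    have nn: "0 \<le> mdist (path_space T) g h" by simp
    have "(\<Sum>s\<in>S. \<bar>g s - h s\<bar>) \<le> (\<Sum>s\<in>S. mdist (path_space T) g h)"
      using path_dist_le[OF T that, of "mdist (path_space T) g h"] S(2) by (intro sum_mono) auto
    then have "C * (\<Sum>s\<in>S. \<bar>g s - h s\<bar>) \<le> C * (card S * mdist (path_space T) g h)"
      using C(1) by (intro mult_left_mono) auto
    also have "\<dots> \<le> c * mdist (path_space T) g h" using nn by (simp add: c_def algebra_simps)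
    finally show ?thesis using C(2)[of g h] by simp
  qed
  have "openin (mtopology_of (path_space T)) (X -` V \<inter> mspace (path_space T))"
    unfolding path_open_iff
  proof (intro conjI ballI)
    fix g assume g: "g \<in> X -` V \<inter> mspace (path_space T)"
    then obtain e where e: "0 < e" "\<And>y. dist y (X g) < e \<Longrightarrow> y \<in> V"
      using V by (auto simp: open_dist)
    show "\<exists>r>0. \<forall>h\<in>mspace (path_space T). mdist (path_space T) g h < r \<longrightarrow> h \<in> X -` V \<inter> mspace (path_space T)"
    proof (intro exI[of _ "e / c"] conjI ballI impI)
      fix h assume h: "h \<in> mspace (path_space T)" "mdist (path_space T) g h < e / c"
      then have "c * mdist (path_space T) g h < e" using c by (simp add: field_simps)
      with lip[of g h] g h(1) have "dist (X h) (X g) < e" by (simp add: dist_real_def abs_minus_commute)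
      with e(2) h(1) show "h \<in> X -` V \<inter> mspace (path_space T)" by auto
    qed (use e c in simp)
  qed simp
  then show "X -` V \<inter> space (path_borel T) \<in> sets (path_borel T)"
    by (simp add: path_borel_open)
qed

text \<open>
  Bernstein polynomials on \<open>{0..T}\<close> with rational coefficients, indexed by the list of
  coefficients, which is meant to be non-empty (its length is the order plus one). They form a
  countable uniformly dense family, hence witness separability of the path space.
\<close>

definition rational_bernstein :: "real \<Rightarrow> rat list \<Rightarrow> real \<Rightarrow> real" where
  "rational_bernstein T qs s = (\<Sum>k\<le>length qs - 1. of_rat (qs ! k) * Bernstein (length qs - 1) k (s / T))"

lemma rational_bernstein_continuous: "0 < T \<Longrightarrow> continuous_on A (rational_bernstein T qs)"
  unfolding rational_bernstein_def[abs_def] Bernstein_def by (intro continuous_intros) auto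

lemma rational_bernstein_dense:
  assumes T: "0 < T" and g: "continuous_on {0..T} g" and e: "0 < e"
  obtains qs where "\<And>s. s \<in> {0..T} \<Longrightarrow> \<bar>g s - rational_bernstein T qs s\<bar> \<le> e"
proof -
  define h where "h x = g (T * x)" for x
  have "continuous_on {0..1} h"
    unfolding h_def using T
    by (intro continuous_on_compose2[OF g] continuous_intros) (auto simp: mult_left_le)
  from Bernstein_Weierstrass[OF this, of "e / 2"] e obtain N where
    N: "\<And>n x. N \<le> n \<Longrightarrow> x \<in> {0..1} \<Longrightarrow> \<bar>h x - (\<Sum>k\<le>n. h (k / n) * Bernstein n k x)\<bar> < e / 2"
    by auto
  have "\<exists>q. \<bar>h (k / N) - of_rat q\<bar> < e / 2" for k :: nat
  proof -
    obtain q where "h (k / N) - e / 2 < of_rat q" "of_rat q < h (k / N) + e / 2"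
      using of_rat_dense[of "h (k / N) - e / 2" "h (k / N) + e / 2"] e by auto
    then show ?thesis by (intro exI[of _ q]) linarith
  qed
  then obtain q where q: "\<And>k::nat. \<bar>h (k / N) - of_rat (q k)\<bar> < e / 2" by metis
  define qs where "qs = map q [0..<Suc N]"
  have len: "length qs = Suc N" and nth: "\<And>k. k \<le> N \<Longrightarrow> qs ! k = q k" 
    by (auto simp: qs_def simp del: upt_Suc)
  show ?thesis
  proof (rule that[of qs])
    fix s assume s: "s \<in> {0..T}"
    define x where "x = s / T"
    have x: "x \<in> {0..1}" "g s = h x" using s T by (auto simp: x_def h_def)
    have "\<bar>(\<Sum>k\<le>N. h (k / N) * Bernstein N k x) - rational_bernstein T qs s\<bar>
        = \<bar>\<Sum>k\<le>N. (h (k / N) - of_rat (q k)) * Bernstein N k x\<bar>"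
      by (simp add: rational_bernstein_def len nth x_def left_diff_distrib sum_subtractf)
    also have "\<dots> \<le> (\<Sum>k\<le>N. \<bar>(h (k / N) - of_rat (q k)) * Bernstein N k x\<bar>)" by (rule sum_abs)
    also have "\<dots> \<le> (\<Sum>k\<le>N. e / 2 * Bernstein N k x)"
    proof (rule sum_mono)
      fix k
      have "0 \<le> Bernstein N k x" using x by (intro Bernstein_nonneg) auto
      then show "\<bar>(h (k / N) - of_rat (q k)) * Bernstein N k x\<bar> \<le> e / 2 * Bernstein N k x"
        using mult_right_mono[OF less_imp_le[OF q[of k]], of "Bernstein N k x"] by (simp add: abs_mult)
    qed
    also have "\<dots> = e / 2" by (simp only: sum_distrib_left[symmetric] sum_Bernstein mult_1_right)
    finally show "\<bar>g s - rational_bernstein T qs s\<bar> \<le> e" using N[OF order_refl x(1)] x(2) by linarith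
  qed
qed

text \<open>
  A map into the path space is Borel measurable as soon as its coordinates are measurable. By
  separability every open set is a countable union of closed balls about Bernstein polynomials, and
  a closed ball is described by countably many coordinates.
\<close>

lemma measurable_path_borel:
  assumes T: "0 < T" and \<Phi>: "\<And>w. w \<in> space M \<Longrightarrow> \<Phi> w \<in> mspace (path_space T)"
    and coord: "\<And>s. s \<in> {0..T} \<Longrightarrow> (\<lambda>w. \<Phi> w s) \<in> borel_measurable M"
  shows "\<Phi> \<in> measurable M (path_borel T)"
  unfolding path_borel_def
proof (rule measurable_measure_of)
  show "{U. openin (mtopology_of (path_space T)) U} \<subseteq> Pow (mspace (path_space T))"
    by (auto simp: path_open_iff)
next
  fix U assume "U \<in> {U. openin (mtopology_of (path_space T)) U}"
  then have U: "U \<subseteq> mspace (path_space T)"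
    "\<And>g. g \<in> U \<Longrightarrow> \<exists>r>0. \<forall>h\<in>mspace (path_space T). mdist (path_space T) g h < r \<longrightarrow> h \<in> U"
    by (auto simp: path_open_iff)
  obtain D where D: "countable D" "D \<subseteq> {0..T}" "{0..T} \<subseteq> closure D"
    using separable[of "{0..T}"] by auto
  define B where "B = (\<lambda>(qs, n). {h \<in> mspace (path_space T).
    \<forall>s\<in>{0..T}. \<bar>h s - rational_bernstein T qs s\<bar> \<le> 1 / real (Suc n)})"
  have U_eq: "U = (\<Union>i\<in>{i. B i \<subseteq> U}. B i)"
  proof (intro equalityI subsetI)
    fix g assume g: "g \<in> U"
    then obtain r where r: "0 < r" "\<And>h. h \<in> mspace (path_space T) \<Longrightarrow> mdist (path_space T) g h < r \<Longrightarrow> h \<in> U"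
      using U(2) by blast
    obtain n where n: "1 / real (Suc n) < r / 2" using nat_approx_posE[of "r / 2"] r by auto
    have g': "g \<in> mspace (path_space T)" "continuous_on {0..T} g" using g U(1) by (auto simp: path_mem_iff)
    obtain qs where qs: "\<And>s. s \<in> {0..T} \<Longrightarrow> \<bar>g s - rational_bernstein T qs s\<bar> \<le> 1 / real (Suc n)"
      using rational_bernstein_dense[OF T g'(2), of "1 / real (Suc n)"] by auto
    have "B (qs, n) \<subseteq> U"
    proof
      fix h assume "h \<in> B (qs, n)"
      then have h: "h \<in> mspace (path_space T)"
        "\<And>s. s \<in> {0..T} \<Longrightarrow> \<bar>h s - rational_bernstein T qs s\<bar> \<le> 1 / real (Suc n)"
        by (auto simp: B_def)
      have "\<bar>g s - h s\<bar> \<le> 2 * (1 / real (Suc n))" if "s \<in> {0..T}" for s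
        using qs[OF that] h(2)[OF that] by linarith
      then have "mdist (path_space T) g h \<le> 2 * (1 / real (Suc n))"
        using T by (subst path_dist_le[OF _ g'(1) h(1)]) auto
      then show "h \<in> U" using n h(1) by (intro r(2)) auto
    qed
    moreover have "g \<in> B (qs, n)" using g'(1) qs by (auto simp: B_def)
    ultimately show "g \<in> (\<Union>i\<in>{i. B i \<subseteq> U}. B i)" by blast
  qed auto
  have B_meas: "\<Phi> -` B i \<inter> space M \<in> sets M" for i
  proof -
    obtain qs n where i: "i = (qs, n)" by (cases i)
    have "\<Phi> -` B i \<inter> space M =
      {w \<in> space M. \<forall>s\<in>D. \<bar>\<Phi> w s - rational_bernstein T qs s\<bar> \<le> 1 / real (Suc n)}"
    proof (intro equalityI subsetI)
      fix w assume w: "w \<in> {w \<in> space M. \<forall>s\<in>D. \<bar>\<Phi> w s - rational_bernstein T qs s\<bar> \<le> 1 / real (Suc n)}"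
      let ?A = "{s \<in> {0..T}. \<bar>\<Phi> w s - rational_bernstein T qs s\<bar> \<le> 1 / real (Suc n)}"
      have "continuous_on {0..T} (\<Phi> w)" using \<Phi>[of w] w by (simp add: path_mem_iff)
      then have "closed ?A"
        using T by (intro continuous_on_closed_Collect_le continuous_intros rational_bernstein_continuous) auto
      moreover have "D \<subseteq> ?A" using w D(2) by auto
      ultimately have "closure D \<subseteq> ?A" by (rule closure_minimal[rotated])
      then show "w \<in> \<Phi> -` B i \<inter> space M" using w D(3) \<Phi>[of w] by (auto simp: B_def i)
    qed (use D(2) in \<open>auto simp: B_def i\<close>)
    moreover have "\<dots> \<in> sets M"
    proof (intro sets.sets_Collect_countable_All' D(1))
      fix s assume "s \<in> D"
      then have [measurable]: "(\<lambda>w. \<Phi> w s) \<in> borel_measurable M" using D(2) coord by blast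
      show "{w \<in> space M. \<bar>\<Phi> w s - rational_bernstein T qs s\<bar> \<le> 1 / real (Suc n)} \<in> sets M"
        by measurable
    qed
    ultimately show ?thesis by simp
  qed
  have "\<Phi> -` U \<inter> space M = (\<Union>i\<in>{i. B i \<subseteq> U}. \<Phi> -` B i \<inter> space M)"
    by (subst U_eq) auto
  moreover have "\<dots> \<in> sets M" using B_meas by (intro sets.countable_UN') auto
  ultimately show "\<Phi> -` U \<inter> space M \<in> sets M" by simp
qed (use \<Phi> in auto)

section \<open>Continuous modification\<close>

text \<open>
  The dyadic points of level \<open>k\<close> in \<open>{0..T}\<close> and, for a time \<open>s \<ge> 0\<close>, the index of the largest one that
  does not exceed \<open>s\<close>.
\<close>

definition dyadic :: "real \<Rightarrow> nat \<Rightarrow> nat \<Rightarrow> real" where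
  "dyadic T k j = T * real j / 2 ^ k"

definition dyadic_index :: "real \<Rightarrow> nat \<Rightarrow> real \<Rightarrow> nat" where
  "dyadic_index T k s = nat \<lfloor>s / T * 2 ^ k\<rfloor>"

abbreviation dyadic_floor :: "real \<Rightarrow> nat \<Rightarrow> real \<Rightarrow> real" where
  "dyadic_floor T k s \<equiv> dyadic T k (dyadic_index T k s)"

lemma dyadic_double: "dyadic T (Suc k) (2 * j) = dyadic T k j"
  by (simp add: dyadic_def)

lemma dyadic_index_bounds:
  assumes "0 < T" "0 \<le> s"
  shows "real (dyadic_index T k s) \<le> s / T * 2 ^ k" "s / T * 2 ^ k < real (dyadic_index T k s) + 1"
proof -
  have "real (dyadic_index T k s) = \<lfloor>s / T * 2 ^ k\<rfloor>"
    using assms by (simp add: dyadic_index_def)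
  then show "real (dyadic_index T k s) \<le> s / T * 2 ^ k" "s / T * 2 ^ k < real (dyadic_index T k s) + 1"
    by linarith+
qed

lemma dyadic_floor_bounds:
  assumes "0 < T" "0 \<le> s"
  shows "0 \<le> dyadic_floor T k s" "dyadic_floor T k s \<le> s" "s < dyadic_floor T k s + T / 2 ^ k"
  using dyadic_index_bounds[OF assms, of k] assms by (simp_all add: dyadic_def field_simps)

lemma dyadic_index_le:
  assumes "0 < T" "0 \<le> s" "s \<le> T"
  shows "dyadic_index T k s \<le> 2 ^ k"
proof -
  have "real (dyadic_index T k s) \<le> s / T * 2 ^ k" by (rule dyadic_index_bounds) fact+
  also have "\<dots> \<le> 1 * 2 ^ k" using assms by (intro mult_right_mono) auto
  finally have "real (dyadic_index T k s) \<le> real (2 ^ k)" by simp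
  then show ?thesis by (simp only: of_nat_le_iff)
qed

lemma dyadic_index_Suc:
  assumes "0 < T" "0 \<le> s"
  shows "dyadic_index T (Suc k) s = 2 * dyadic_index T k s \<or>
    dyadic_index T (Suc k) s = Suc (2 * dyadic_index T k s)"
proof -
  have "s / T * 2 ^ Suc k = 2 * (s / T * 2 ^ k)" by simp
  then have "real (dyadic_index T (Suc k) s) < 2 * real (dyadic_index T k s) + 2"
    "2 * real (dyadic_index T k s) < real (dyadic_index T (Suc k) s) + 1"
    using dyadic_index_bounds[OF assms, of k] dyadic_index_bounds[OF assms, of "Suc k"] by linarith+
  then show ?thesis by linarith
qed

lemma dyadic_index_close:
  assumes "0 < T" "0 \<le> s" "s \<le> t" "t - s < T / 2 ^ k"
  shows "dyadic_index T k t = dyadic_index T k s \<or> dyadic_index T k t = Suc (dyadic_index T k s)"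
proof -
  have "t / T * 2 ^ k < s / T * 2 ^ k + 1" "s / T * 2 ^ k \<le> t / T * 2 ^ k"
    using assms by (simp_all add: field_simps)
  then have "real (dyadic_index T k t) < real (dyadic_index T k s) + 2"
    "real (dyadic_index T k s) < real (dyadic_index T k t) + 1"
    using dyadic_index_bounds[of T s k] dyadic_index_bounds[of T t k] assms by auto
  then show ?thesis by linarith
qed

text \<open>
  A function is regular at level \<open>k\<close> if its increments between neighbouring dyadic points are at most
  \<open>(9 / 10) ^ k\<close>. The ratio is chosen with \<open>1 / 2 < (9 / 10) ^ 4 < 1\<close>: the probability of failure
  at level \<open>k\<close> is of order \<open>2 ^ k * (1 / 4) ^ k / (9 / 10) ^ (4 * k)\<close>, hence summable, and so are the
  increments themselves. A function that is regular at all levels from \<open>k0\<close> on has limits along the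
  dyadic approximations of every time, and these limits form a continuous path.
\<close>

definition dyadic_regular :: "real \<Rightarrow> nat \<Rightarrow> (real \<Rightarrow> real) \<Rightarrow> bool" where
  "dyadic_regular T k \<omega> \<longleftrightarrow> (\<forall>j<2 ^ k. \<bar>\<omega> (dyadic T k (Suc j)) - \<omega> (dyadic T k j)\<bar> \<le> (9 / 10) ^ k)"

definition dyadic_limit :: "real \<Rightarrow> (real \<Rightarrow> real) \<Rightarrow> real \<Rightarrow> real" where
  "dyadic_limit T \<omega> s = lim (\<lambda>n. \<omega> (dyadic_floor T n s))"

context
  fixes T :: real and \<omega> :: "real \<Rightarrow> real" and k0 :: nat
  assumes T: "0 < T" and reg: "\<And>k. k0 \<le> k \<Longrightarrow> dyadic_regular T k \<omega>"
begin

lemma chaining: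
  assumes k: "k0 \<le> k" "k \<le> n" and s: "0 \<le> s" "s \<le> T"
  shows "\<bar>\<omega> (dyadic_floor T n s) - \<omega> (dyadic_floor T k s)\<bar> \<le> 10 * ((9 / 10) ^ k - (9 / 10) ^ n)"
  using k(2)
proof (induction n rule: dec_induct)
  case (step n)
  have "\<bar>\<omega> (dyadic_floor T (Suc n) s) - \<omega> (dyadic_floor T n s)\<bar> \<le> (9 / 10) ^ Suc n"
  proof (cases "dyadic_index T (Suc n) s = 2 * dyadic_index T n s")
    case True
    then show ?thesis by (simp add: dyadic_double del: power_Suc)
  next
    case False
    then have eq: "dyadic_index T (Suc n) s = Suc (2 * dyadic_index T n s)"
      using dyadic_index_Suc[OF T s(1), of n] by blast
    then have "2 * dyadic_index T n s < 2 ^ Suc n"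
      using dyadic_index_le[OF T s, of "Suc n"] by linarith
    moreover have "dyadic_regular T (Suc n) \<omega>" using k(1) step.hyps by (intro reg) simp
    ultimately have "\<bar>\<omega> (dyadic T (Suc n) (Suc (2 * dyadic_index T n s))) - \<omega> (dyadic T (Suc n) (2 * dyadic_index T n s))\<bar>
        \<le> (9 / 10) ^ Suc n"
      unfolding dyadic_regular_def by blast
    then show ?thesis by (simp only: eq dyadic_double)
  qed
  \<comment> \<open>the bound telescopes: \<open>10 * (9 / 10) ^ k\<close> is the sum of \<open>(9 / 10) ^ j\<close> over \<open>j \<ge> k\<close>\<close>
  moreover have "10 * (9 / 10) ^ n - 10 * (9 / 10) ^ Suc n = (9 / 10 :: real) ^ n"
    "(9 / 10 :: real) ^ Suc n \<le> (9 / 10) ^ n" by simp_all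
  ultimately show ?case using step.IH unfolding right_diff_distrib by linarith
qed simp

lemma dyadic_limit:
  assumes s: "0 \<le> s" "s \<le> T"
  shows "(\<lambda>n. \<omega> (dyadic_floor T n s)) \<longlonglongrightarrow> dyadic_limit T \<omega> s"
    and "k0 \<le> k \<Longrightarrow> \<bar>dyadic_limit T \<omega> s - \<omega> (dyadic_floor T k s)\<bar> \<le> 10 * (9 / 10) ^ k"
proof -
  have bound: "\<bar>\<omega> (dyadic_floor T n s) - \<omega> (dyadic_floor T k s)\<bar> \<le> 10 * (9 / 10) ^ k"
    if "k0 \<le> k" "k \<le> n" for k n
  proof -
    have "10 * ((9 / 10 :: real) ^ k - (9 / 10) ^ n) \<le> 10 * (9 / 10) ^ k" by simp
    then show ?thesis by (rule order_trans[OF chaining[OF that s]])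
  qed
  have "Cauchy (\<lambda>n. \<omega> (dyadic_floor T n s))"
  proof (rule CauchyI)
    fix e :: real assume e: "0 < e"
    have "(\<lambda>k. 20 * (9 / 10 :: real) ^ k) \<longlonglongrightarrow> 20 * 0" by (intro tendsto_intros) auto
    then have "eventually (\<lambda>k. 20 * (9 / 10 :: real) ^ k < e) sequentially"
      using e by (intro order_tendstoD) auto
    then obtain k where k: "20 * (9 / 10 :: real) ^ k < e" "k0 \<le> k"
      using eventually_ge_at_top[of k0] by (metis (no_types, lifting) eventually_sequentially nle_le order_trans)
    have "norm (\<omega> (dyadic_floor T m s) - \<omega> (dyadic_floor T n s)) < e" if "k \<le> m" "k \<le> n" for m n
      using bound[OF k(2) that(1)] bound[OF k(2) that(2)] k(1) unfolding real_norm_def by linarith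
    then show "\<exists>M. \<forall>m\<ge>M. \<forall>n\<ge>M. norm (\<omega> (dyadic_floor T m s) - \<omega> (dyadic_floor T n s)) < e" by blast
  qed
  then show lim: "(\<lambda>n. \<omega> (dyadic_floor T n s)) \<longlonglongrightarrow> dyadic_limit T \<omega> s"
    unfolding dyadic_limit_def by (simp add: Cauchy_convergent_iff convergent_LIMSEQ_iff)
  show "\<bar>dyadic_limit T \<omega> s - \<omega> (dyadic_floor T k s)\<bar> \<le> 10 * (9 / 10) ^ k" if "k0 \<le> k"
  proof (rule LIMSEQ_le_const2)
    show "(\<lambda>n. \<bar>\<omega> (dyadic_floor T n s) - \<omega> (dyadic_floor T k s)\<bar>)
        \<longlonglongrightarrow> \<bar>dyadic_limit T \<omega> s - \<omega> (dyadic_floor T k s)\<bar>"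
      by (intro tendsto_intros lim)
  qed (use bound[OF that] in blast)
qed

lemma dyadic_limit_close:
  assumes k: "k0 \<le> k" and s: "0 \<le> s" "s \<le> t" "t \<le> T" "t - s < T / 2 ^ k"
  shows "\<bar>dyadic_limit T \<omega> t - dyadic_limit T \<omega> s\<bar> \<le> 21 * (9 / 10) ^ k"
proof -
  have "\<bar>\<omega> (dyadic_floor T k t) - \<omega> (dyadic_floor T k s)\<bar> \<le> (9 / 10) ^ k"
  proof (cases "dyadic_index T k t = dyadic_index T k s")
    case False
    then have eq: "dyadic_index T k t = Suc (dyadic_index T k s)"
      using dyadic_index_close[OF T s(1,2,4)] by blast
    then have "dyadic_index T k s < 2 ^ k"
      using dyadic_index_le[OF T, of t k] s by linarith
    then show ?thesis using reg[OF k] unfolding dyadic_regular_def eq by blast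
  qed simp
  then show ?thesis
    using dyadic_limit(2)[of s k] dyadic_limit(2)[of t k] k s by linarith
qed

lemma dyadic_limit_continuous: "continuous_on {0..T} (dyadic_limit T \<omega>)"
  unfolding continuous_on_iff
proof (intro ballI allI impI)
  fix s e :: real assume s: "s \<in> {0..T}" and e: "0 < e"
  have "(\<lambda>k. 21 * (9 / 10 :: real) ^ k) \<longlonglongrightarrow> 21 * 0" by (intro tendsto_intros) auto
  then have "eventually (\<lambda>k. 21 * (9 / 10 :: real) ^ k < e) sequentially"
    using e by (intro order_tendstoD) auto
  then obtain k where k: "21 * (9 / 10 :: real) ^ k < e" "k0 \<le> k"
    using eventually_ge_at_top[of k0] by (metis (no_types, lifting) eventually_sequentially nle_le order_trans)
  show "\<exists>d>0. \<forall>t\<in>{0..T}. dist t s < d \<longrightarrow> dist (dyadic_limit T \<omega> t) (dyadic_limit T \<omega> s) < e"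
  proof (intro exI[of _ "T / 2 ^ k"] conjI ballI impI)
    fix t assume t: "t \<in> {0..T}" "dist t s < T / 2 ^ k"
    show "dist (dyadic_limit T \<omega> t) (dyadic_limit T \<omega> s) < e"
    proof (cases "s \<le> t")
      case True
      then show ?thesis
        using dyadic_limit_close[OF k(2), of s t] s t k(1) by (simp add: dist_real_def)
    next
      case False
      then show ?thesis
        using dyadic_limit_close[OF k(2), of t s] s t k(1) by (simp add: dist_real_def abs_minus_commute)
    qed
  qed (use T in simp)
qed

end

context dominated_functional
begin

lemma increment_cyl:
  assumes "0 \<le> a" "s \<in> {0..T}" "t \<in> {0..T}"
  shows "(\<lambda>\<omega>. trunc4 a (\<omega> t - \<omega> s)) \<in> Lip_cyl T"
proof -
  have "depends_lipschitz {s, t} (\<lambda>\<omega>. trunc4 a (\<omega> t - \<omega> s))"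
  proof (rule depends_lipschitzI[of _ 1 "8 * a"])
    fix \<omega> \<omega>' :: "real \<Rightarrow> real"
    show "\<bar>trunc4 a (\<omega> t - \<omega> s)\<bar> \<le> 1" using trunc4_le_1[OF assms(1)] trunc4_nonneg by simp
    have "\<bar>\<omega> t - \<omega>' t\<bar> \<le> (\<Sum>r\<in>{s, t}. \<bar>\<omega> r - \<omega>' r\<bar>)" "\<bar>\<omega> s - \<omega>' s\<bar> \<le> (\<Sum>r\<in>{s, t}. \<bar>\<omega> r - \<omega>' r\<bar>)"
      by (intro member_le_sum[where f="\<lambda>r. \<bar>\<omega> r - \<omega>' r\<bar>"]; simp)+
    then have "\<bar>(\<omega> t - \<omega> s) - (\<omega>' t - \<omega>' s)\<bar> \<le> 2 * (\<Sum>r\<in>{s, t}. \<bar>\<omega> r - \<omega>' r\<bar>)" by linarith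
    from mult_left_mono[OF this, of "4 * a"] trunc4_lipschitz[OF assms(1), of "\<omega> t - \<omega> s" "\<omega>' t - \<omega>' s"] assms(1)
    show "\<bar>trunc4 a (\<omega> t - \<omega> s) - trunc4 a (\<omega>' t - \<omega>' s)\<bar> \<le> 8 * a * (\<Sum>r\<in>{s, t}. \<bar>\<omega> r - \<omega>' r\<bar>)"
      by (simp only: mult.assoc) linarith
  qed (use assms in simp)
  then show ?thesis using assms unfolding Lip_cyl_iff by (intro exI[of _ "{s, t}"]) auto
qed

lemma coordinate_level_cyl:
  assumes "s \<in> {0..T}"
  shows "(\<lambda>\<omega>. min 1 (max (\<omega> s - c) 0)) \<in> Lip_cyl T"
proof -
  have "depends_lipschitz {s} (\<lambda>\<omega>. min 1 (max (\<omega> s - c) 0))"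
    by (rule depends_lipschitzI[of _ 1 1]) auto
  then show ?thesis using assms unfolding Lip_cyl_iff by blast
qed

text \<open>
  A dominated functional is the expectation under a probability on the path space. The
  Daniell-Stone theorem provides a probability on the space of all functions. By the Borel-Cantelli
  lemma almost every function is dyadically regular from some level on, so it has a continuous
  dyadic limit; at each fixed time the limit agrees with the function almost surely, because the
  fourth moment bound makes the dyadic approximations converge in probability. The law of the limit
  path is as required.
\<close>

lemma path_measure_exists:
  obtains P where "prob_space P" "sets P = sets (path_borel T)"
    "\<And>X. X \<in> Lip_cyl T \<Longrightarrow> integrable P X" "\<And>X. X \<in> Lip_cyl T \<Longrightarrow> integral\<^sup>L P X = f X"
proof -
  obtain M where fin: "finite_measure M" and space: "space M = UNIV"
    and meas: "\<And>X. X \<in> Lip_cyl T \<Longrightarrow> X \<in> borel_measurable M"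
    and int: "\<And>X. X \<in> Lip_cyl T \<Longrightarrow> integral\<^sup>L M X = f X"
  proof (rule Daniell_Stone[of "Lip_cyl T" f])
    show "\<And>X. X \<in> Lip_cyl T \<Longrightarrow> \<exists>K. \<forall>\<omega>. \<bar>X \<omega>\<bar> \<le> K" by (rule Lip_cyl_bounded)
  qed (auto intro: Lip_cyl_add Lip_cyl_scale Lip_cyl_abs f_add f_scale f_mono sigma_smooth)
  interpret M: finite_measure M by (rule fin)
  have integrable: "integrable M X" if X: "X \<in> Lip_cyl T" for X
  proof -
    obtain K where "\<And>\<omega>. \<bar>X \<omega>\<bar> \<le> K" using Lip_cyl_bounded[OF X] by auto
    then show ?thesis using meas[OF X] by (intro M.integrable_const_bound[of _ K]) auto
  qed
  have "measure M (space M) = 1" using int[of "\<lambda>_. 1"] f_const[of 1] by simp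
  then interpret M: prob_space M by (intro prob_spaceI) (simp add: M.emeasure_eq_measure)
  have coord [measurable]: "(\<lambda>\<omega>. \<omega> s) \<in> borel_measurable M" if s: "s \<in> {0..T}" for s
    unfolding borel_measurable_iff_greater
  proof
    fix c
    have "{\<omega> \<in> space M. 0 < min 1 (max (\<omega> s - c) 0)} \<in> sets M"
      using meas[OF coordinate_level_cyl[OF s, of c]] unfolding borel_measurable_iff_greater by blast
    moreover have "{\<omega> \<in> space M. 0 < min 1 (max (\<omega> s - c) 0)} = {\<omega> \<in> space M. c < \<omega> s}" by auto
    ultimately show "{\<omega> \<in> space M. c < \<omega> s} \<in> sets M" by simp
  qed
  have int_increment: "(\<integral>\<omega>. trunc4 a (\<omega> t - \<omega> s) \<partial>M) \<le> a ^ 4 * C * (t - s)\<^sup>2"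
    if "0 \<le> a" "0 \<le> s" "s \<le> t" "t \<le> T" for a s t
  proof -
    have cyl: "(\<lambda>\<omega>. trunc4 a (\<omega> t - \<omega> s)) \<in> Lip_cyl T" using that by (intro increment_cyl) auto
    show ?thesis
      using int[OF cyl] f_le[OF cyl] moment[OF that] by linarith
  qed

  have dy: "dyadic T k j \<in> {0..T}" if "j \<le> 2 ^ k" for k j
  proof -
    have "real j \<le> real (2 ^ k)" using that by (simp only: of_nat_le_iff)
    then show ?thesis using T_pos by (auto simp: dyadic_def divide_le_eq)
  qed
  define bad where "bad k = {\<omega> :: real \<Rightarrow> real. \<not> dyadic_regular T k \<omega>}" for k
  define badj where "badj k j = {\<omega> :: real \<Rightarrow> real. (9 / 10) ^ k < \<bar>\<omega> (dyadic T k (Suc j)) - \<omega> (dyadic T k j)\<bar>}" for k j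
  have bad_eq: "bad k = (\<Union>j<2 ^ k. badj k j)" for k
    by (auto simp: bad_def badj_def dyadic_regular_def not_le)
  have badj_sets: "badj k j \<in> sets M" if "j < 2 ^ k" for k j
  proof -
    have [measurable]: "(\<lambda>\<omega>. \<omega> (dyadic T k (Suc j))) \<in> borel_measurable M" "(\<lambda>\<omega>. \<omega> (dyadic T k j)) \<in> borel_measurable M"
      using that by (auto intro!: coord dy)
    have "{\<omega> \<in> space M. (9 / 10) ^ k < \<bar>\<omega> (dyadic T k (Suc j)) - \<omega> (dyadic T k j)\<bar>} \<in> sets M" by measurable
    then show ?thesis by (simp add: badj_def space)
  qed
  have bad_sets: "bad k \<in> sets M" for k unfolding bad_eq using badj_sets by (intro sets.finite_UN) auto
  have badj_le: "measure M (badj k j) \<le> C * T\<^sup>2 * ((10000 / 6561) ^ k / 4 ^ k)" if j: "j < 2 ^ k" for k j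
  proof -
    define a where "a = (10 / 9 :: real) ^ k"
    have a: "0 \<le> a" by (simp add: a_def)
    let ?s = "dyadic T k j" and ?t = "dyadic T k (Suc j)"
    have st: "?s \<in> {0..T}" "?t \<in> {0..T}" "?s \<le> ?t" "?t - ?s = T / 2 ^ k"
      using j dy[of j k] dy[of "Suc j" k] T_pos by (auto simp: dyadic_def field_simps)
    have "measure M (badj k j) = (\<integral>\<omega>. indicator (badj k j) \<omega> \<partial>M)"
      using badj_sets[OF j] by (simp add: space)
    also have "\<dots> \<le> (\<integral>\<omega>. trunc4 a (\<omega> ?t - \<omega> ?s) \<partial>M)"
    proof (rule integral_mono)
      show "integrable M (indicator (badj k j) :: _ \<Rightarrow> real)"
        using badj_sets[OF j] by (intro integrable_real_indicator) (simp_all add: M.emeasure_eq_measure)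
      show "integrable M (\<lambda>\<omega>. trunc4 a (\<omega> ?t - \<omega> ?s))"
        using st a by (intro integrable increment_cyl) auto
      fix \<omega>
      have "trunc4 a (\<omega> ?t - \<omega> ?s) = 1" if "\<omega> \<in> badj k j"
      proof (rule trunc4_eq_1)
        have "a * (9 / 10) ^ k = 1" by (simp add: a_def flip: power_mult_distrib)
        moreover have "a * (9 / 10) ^ k \<le> a * \<bar>\<omega> ?t - \<omega> ?s\<bar>"
          using that a by (intro mult_left_mono) (auto simp: badj_def)
        ultimately show "1 \<le> a * \<bar>\<omega> ?t - \<omega> ?s\<bar>" by simp
      qed
      then show "indicator (badj k j) \<omega> \<le> trunc4 a (\<omega> ?t - \<omega> ?s)"
        by (simp add: indicator_def trunc4_nonneg)
    qed
    also have "\<dots> \<le> a ^ 4 * C * (?t - ?s)\<^sup>2" using st a by (intro int_increment) auto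
    also have "\<dots> = C * T\<^sup>2 * ((10000 / 6561) ^ k / 4 ^ k)"
    proof -
      have "a ^ 4 = ((10 / 9) ^ 4) ^ k" "((2 :: real) ^ k)\<^sup>2 = (2\<^sup>2) ^ k"
        unfolding a_def by (simp_all only: power_mult[symmetric] mult.commute)
      then have "a ^ 4 = (10000 / 6561) ^ k" "((2 :: real) ^ k)\<^sup>2 = 4 ^ k"
        by (simp_all add: power_divide)
      then show ?thesis by (simp add: st(4) power_divide)
    qed
    finally show ?thesis .
  qed
  have bad_le: "measure M (bad k) \<le> C * T\<^sup>2 * (5000 / 6561) ^ k" for k
  proof -
    have "measure M (bad k) \<le> (\<Sum>j<2 ^ k. measure M (badj k j))"
      unfolding bad_eq using badj_sets by (intro M.finite_measure_subadditive_finite) auto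
    also have "\<dots> \<le> (\<Sum>j<(2::nat) ^ k. C * T\<^sup>2 * ((10000 / 6561) ^ k / 4 ^ k))"
      by (rule sum_mono) (use badj_le in auto)
    also have "\<dots> = C * T\<^sup>2 * (2 ^ k * (10000 / 6561) ^ k / 4 ^ k)" by simp
    also have "2 ^ k * (10000 / 6561) ^ k / 4 ^ k = (5000 / 6561 :: real) ^ k"
      by (simp flip: power_mult_distrib power_divide)
    finally show ?thesis .
  qed
  have "AE \<omega> in M. eventually (\<lambda>k. \<omega> \<in> space M - bad k) sequentially"
  proof (rule borel_cantelli_AE1[OF bad_sets])
    have "summable (\<lambda>k. C * T\<^sup>2 * (5000 / 6561 :: real) ^ k)"
      by (intro summable_mult summable_geometric) auto
    then show "summable (\<lambda>k. measure M (bad k))"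
      by (rule summable_comparison_test'[where N=0]) (use bad_le in auto)
  qed (simp add: M.emeasure_eq_measure)
  then have regular: "AE \<omega> in M. \<exists>k0. \<forall>k\<ge>k0. dyadic_regular T k \<omega>"
    by (auto simp: eventually_sequentially bad_def space)

  define G where "G = {\<omega>. \<exists>k0. \<forall>k\<ge>k0. dyadic_regular T k \<omega>}"
  have "G = (\<Union>k0. \<Inter>k\<in>{k0..}. space M - bad k)" by (auto simp: G_def bad_def space)
  also have "\<dots> \<in> sets M" using bad_sets by (intro sets.countable_UN' sets.countable_INT') auto
  finally have G_sets [measurable]: "G \<in> sets M" .
  \<comment> \<open>the zero path on the null set where the dyadic limit need not be continuous\<close>
  define \<Phi> where "\<Phi> \<omega> = (\<lambda>s\<in>{0..T}. if \<omega> \<in> G then dyadic_limit T \<omega> s else 0)" for \<omega>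
  have \<Phi>_mem: "\<Phi> \<omega> \<in> mspace (path_space T)" for \<omega>
  proof (cases "\<omega> \<in> G")
    case True
    then have "continuous_on {0..T} (dyadic_limit T \<omega>)"
      using T_pos by (auto simp: G_def intro: dyadic_limit_continuous)
    then have "continuous_on {0..T} (\<Phi> \<omega>)"
      by (rule continuous_on_eq) (simp add: \<Phi>_def True)
    then show ?thesis by (simp add: path_mem_iff \<Phi>_def)
  next
    case False
    have "continuous_on {0..T} (\<Phi> \<omega>)"
      by (rule continuous_on_eq[of _ "\<lambda>_. 0"]) (simp_all add: \<Phi>_def False)
    then show ?thesis by (simp add: path_mem_iff \<Phi>_def)
  qed
  have floor_mem: "dyadic_floor T n s \<in> {0..T}" if "s \<in> {0..T}" for n s
    using dyadic_floor_bounds[OF T_pos, of s n] that by auto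
  have \<Phi>_coord [measurable]: "(\<lambda>\<omega>. \<Phi> \<omega> s) \<in> borel_measurable M" if s: "s \<in> {0..T}" for s
  proof -
    have [measurable]: "(\<lambda>\<omega>. dyadic_limit T \<omega> s) \<in> borel_measurable M"
      unfolding dyadic_limit_def using coord[OF floor_mem[OF s]] by (intro borel_measurable_lim_metric)
    have "(\<lambda>\<omega>. if \<omega> \<in> G then dyadic_limit T \<omega> s else 0) \<in> borel_measurable M" by measurable
    then show ?thesis using s by (simp add: \<Phi>_def)
  qed
  have \<Phi>_meas: "\<Phi> \<in> measurable M (path_borel T)"
    by (rule measurable_path_borel[OF T_pos \<Phi>_mem \<Phi>_coord])
  have modification: "AE \<omega> in M. \<Phi> \<omega> s = \<omega> s" if s: "s \<in> {0..T}" for s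
  proof -
    have [measurable]: "(\<lambda>\<omega>. \<omega> s) \<in> borel_measurable M" "(\<lambda>\<omega>. \<Phi> \<omega> s) \<in> borel_measurable M"
      "(\<lambda>\<omega>. \<omega> (dyadic_floor T n s)) \<in> borel_measurable M" for n
      using s coord \<Phi>_coord floor_mem by auto
    have cont: "continuous_on UNIV (trunc4 1)" unfolding trunc4_def[abs_def] by (intro continuous_intros)
    have trunc4_meas [measurable]: "trunc4 1 \<in> borel_measurable borel" using cont by (rule borel_measurable_continuous_onI)
    have "(\<lambda>n. \<integral>\<omega>. trunc4 1 (\<omega> s - \<omega> (dyadic_floor T n s)) \<partial>M) \<longlonglongrightarrow> (\<integral>\<omega>. trunc4 1 (\<omega> s - \<Phi> \<omega> s) \<partial>M)"
    proof (rule integral_dominated_convergence[where w="\<lambda>_. 1"])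
      show "AE \<omega> in M. (\<lambda>n. trunc4 1 (\<omega> s - \<omega> (dyadic_floor T n s))) \<longlonglongrightarrow> trunc4 1 (\<omega> s - \<Phi> \<omega> s)"
        using regular
      proof eventually_elim
        fix \<omega> assume "\<exists>k0. \<forall>k\<ge>k0. dyadic_regular T k \<omega>"
        then have "(\<lambda>n. \<omega> (dyadic_floor T n s)) \<longlonglongrightarrow> dyadic_limit T \<omega> s" "\<omega> \<in> G"
          using s by (auto simp: G_def intro: dyadic_limit(1)[OF T_pos])
        then have "(\<lambda>n. \<omega> s - \<omega> (dyadic_floor T n s)) \<longlonglongrightarrow> \<omega> s - \<Phi> \<omega> s"
          using s by (intro tendsto_intros) (simp add: \<Phi>_def)
        then show "(\<lambda>n. trunc4 1 (\<omega> s - \<omega> (dyadic_floor T n s))) \<longlonglongrightarrow> trunc4 1 (\<omega> s - \<Phi> \<omega> s)"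
          by (intro continuous_on_tendsto_compose[OF cont]) auto
      qed
    qed (use trunc4_le_1[of 1] trunc4_nonneg in auto)
    moreover have "(\<lambda>n. \<integral>\<omega>. trunc4 1 (\<omega> s - \<omega> (dyadic_floor T n s)) \<partial>M) \<longlonglongrightarrow> 0"
    proof (rule tendsto_sandwich[OF _ _ tendsto_const])
      show "\<forall>\<^sub>F n in sequentially. (\<integral>\<omega>. trunc4 1 (\<omega> s - \<omega> (dyadic_floor T n s)) \<partial>M) \<le> C * (T / 2 ^ n)\<^sup>2"
      proof (intro always_eventually allI)
        fix n
        let ?r = "dyadic_floor T n s"
        have r: "0 \<le> ?r" "?r \<le> s" "s - ?r \<le> T / 2 ^ n" using dyadic_floor_bounds[OF T_pos, of s n] s by auto
        then have "(\<integral>\<omega>. trunc4 1 (\<omega> s - \<omega> ?r) \<partial>M) \<le> 1 ^ 4 * C * (s - ?r)\<^sup>2"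
          using s by (intro int_increment) auto
        also have "\<dots> \<le> 1 ^ 4 * C * (T / 2 ^ n)\<^sup>2"
          using r C_nonneg by (intro mult_left_mono power_mono) auto
        finally show "(\<integral>\<omega>. trunc4 1 (\<omega> s - \<omega> ?r) \<partial>M) \<le> C * (T / 2 ^ n)\<^sup>2" by simp
      qed
      have "(\<lambda>n. T * (1 / 2) ^ n) \<longlonglongrightarrow> T * 0"
        by (intro tendsto_mult tendsto_const LIMSEQ_realpow_zero) auto
      then have "(\<lambda>n. C * (T * (1 / 2) ^ n)\<^sup>2) \<longlonglongrightarrow> C * (T * 0)\<^sup>2"
        by (rule tendsto_mult[OF tendsto_const tendsto_power])
      then show "(\<lambda>n. C * (T / 2 ^ n)\<^sup>2) \<longlonglongrightarrow> 0" by (simp add: power_one_over)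
    qed (auto intro!: always_eventually integral_nonneg_AE simp: trunc4_nonneg)
    ultimately have "(\<integral>\<omega>. trunc4 1 (\<omega> s - \<Phi> \<omega> s) \<partial>M) = 0" by (rule LIMSEQ_unique)
    moreover have "integrable M (\<lambda>\<omega>. trunc4 1 (\<omega> s - \<Phi> \<omega> s))"
      using trunc4_le_1[of 1] trunc4_nonneg by (intro M.integrable_const_bound[of _ 1]) auto
    ultimately have "AE \<omega> in M. trunc4 1 (\<omega> s - \<Phi> \<omega> s) = 0"
      by (subst (asm) integral_nonneg_eq_0_iff_AE) (auto simp: trunc4_nonneg)
    then show ?thesis by eventually_elim (simp add: trunc4_eq_0)
  qed
  define P where "P = distr M (path_borel T) \<Phi>"
  have \<Phi>_X: "AE \<omega> in M. X (\<Phi> \<omega>) = X \<omega>" if X: "X \<in> Lip_cyl T" for X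
  proof -
    obtain S where S: "finite S" "S \<subseteq> {0..T}" "depends_lipschitz S X" using X unfolding Lip_cyl_iff by blast
    have "AE \<omega> in M. \<forall>s\<in>S. \<Phi> \<omega> s = \<omega> s"
      using S modification by (intro AE_finite_allI) auto
    then show ?thesis by eventually_elim (rule depends_lipschitz_cong[OF S(3)], auto)
  qed
  have X_meas: "X \<in> borel_measurable (path_borel T)" if "X \<in> Lip_cyl T" for X
    using Lip_cyl_path_measurable[OF _ that] T_pos by simp
  show ?thesis
  proof (rule that[of P])
    show "prob_space P" unfolding P_def by (rule M.prob_space_distr[OF \<Phi>_meas])
    show "sets P = sets (path_borel T)" by (simp add: P_def)
  next
    fix X assume X: "X \<in> Lip_cyl T"
    have [measurable]: "X \<in> borel_measurable (path_borel T)" "X \<in> borel_measurable M"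
      using X_meas meas X by auto
    note \<Phi>_meas [measurable]
    have X\<Phi> [measurable]: "(\<lambda>\<omega>. X (\<Phi> \<omega>)) \<in> borel_measurable M" by measurable
    have "integrable M (\<lambda>\<omega>. X (\<Phi> \<omega>)) \<longleftrightarrow> integrable M X"
      by (rule integrable_cong_AE) (use \<Phi>_X[OF X] in auto)
    then show "integrable P X"
      unfolding P_def using integrable[OF X] by (simp add: integrable_distr_eq)
    have "integral\<^sup>L P X = (\<integral>\<omega>. X (\<Phi> \<omega>) \<partial>M)"
      unfolding P_def by (rule integral_distr) measurable
    also have "\<dots> = integral\<^sup>L M X"
      by (rule integral_cong_AE) (use \<Phi>_X[OF X] in auto)
    finally show "integral\<^sup>L P X = f X" using int[OF X] by simp
  qed
qed

end

section \<open>The completion and its representing probabilities\<close>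

lemma L1_complete:
  fixes s :: "nat \<Rightarrow> 'a \<Rightarrow> real"
  assumes s [measurable]: "\<And>n. integrable M (s n)"
    and cauchy: "\<And>e. 0 < e \<Longrightarrow> \<exists>N. \<forall>m\<ge>N. \<forall>n\<ge>N. (\<integral>x. \<bar>s m x - s n x\<bar> \<partial>M) < e"
  obtains Y where "integrable M Y" "(\<lambda>n. \<integral>x. \<bar>s n x - Y x\<bar> \<partial>M) \<longlonglongrightarrow> 0"
proof -
  obtain r where r: "strict_mono r" "AE x in M. Cauchy (\<lambda>i. s (r i) x)"
    using cauchy_L1_AE_cauchy_subseq[of M s] s cauchy by (auto simp: real_norm_def)
  define Y where "Y x = lim (\<lambda>i. s (r i) x)" for x
  have [measurable]: "s n \<in> borel_measurable M" for n using s[of n] by auto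
  have Y_meas [measurable]: "Y \<in> borel_measurable M"
    unfolding Y_def by (intro borel_measurable_lim_metric) measurable
  have conv: "AE x in M. (\<lambda>i. s (r i) x) \<longlonglongrightarrow> Y x"
    using r(2) unfolding Y_def by eventually_elim (simp add: Cauchy_convergent_iff convergent_LIMSEQ_iff)
  have main: "\<exists>N. \<forall>n\<ge>N. integrable M (\<lambda>x. s n x - Y x) \<and> (\<integral>x. \<bar>s n x - Y x\<bar> \<partial>M) \<le> e" if e: "0 < e" for e
  proof -
    obtain N where N: "\<And>m n. N \<le> m \<Longrightarrow> N \<le> n \<Longrightarrow> (\<integral>x. \<bar>s m x - s n x\<bar> \<partial>M) < e" using cauchy[OF e] by blast
    have "integrable M (\<lambda>x. s n x - Y x) \<and> (\<integral>x. \<bar>s n x - Y x\<bar> \<partial>M) \<le> e" if n: "N \<le> n" for n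
    proof -
      have "(\<integral>\<^sup>+x. ennreal \<bar>s n x - Y x\<bar> \<partial>M) = (\<integral>\<^sup>+x. liminf (\<lambda>i. ennreal \<bar>s n x - s (r i) x\<bar>) \<partial>M)"
      proof (rule nn_integral_cong_AE, use conv in eventually_elim)
        fix x assume "(\<lambda>i. s (r i) x) \<longlonglongrightarrow> Y x"
        then have "(\<lambda>i. ennreal \<bar>s n x - s (r i) x\<bar>) \<longlonglongrightarrow> ennreal \<bar>s n x - Y x\<bar>"
          by (intro tendsto_ennrealI tendsto_intros)
        then show "ennreal \<bar>s n x - Y x\<bar> = liminf (\<lambda>i. ennreal \<bar>s n x - s (r i) x\<bar>)"
          by (rule lim_imp_Liminf[OF sequentially_bot, symmetric])
      qed
      also have "\<dots> \<le> liminf (\<lambda>i. \<integral>\<^sup>+x. ennreal \<bar>s n x - s (r i) x\<bar> \<partial>M)"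
        by (rule nn_integral_liminf) measurable
      also have "\<dots> \<le> limsup (\<lambda>i. \<integral>\<^sup>+x. ennreal \<bar>s n x - s (r i) x\<bar> \<partial>M)"
        by (rule Liminf_le_Limsup) simp
      also have "\<dots> \<le> ennreal e"
      proof (rule Limsup_bounded)
        have "(\<integral>\<^sup>+x. ennreal \<bar>s n x - s (r i) x\<bar> \<partial>M) \<le> ennreal e" if "N \<le> i" for i
        proof -
          have "N \<le> r i" using that seq_suble[OF r(1), of i] by simp
          then show ?thesis
            using N[OF n, of "r i"] s by (subst nn_integral_eq_integral) (auto intro!: ennreal_leI)
        qed
        then show "\<forall>\<^sub>F i in sequentially. (\<integral>\<^sup>+x. ennreal \<bar>s n x - s (r i) x\<bar> \<partial>M) \<le> ennreal e"
          by (auto simp: eventually_sequentially)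
      qed
      finally have le: "(\<integral>\<^sup>+x. ennreal \<bar>s n x - Y x\<bar> \<partial>M) \<le> ennreal e" .
      then have int: "integrable M (\<lambda>x. s n x - Y x)"
        by (intro integrableI_bounded) (auto intro: le_less_trans simp: real_norm_def)
      have "ennreal (\<integral>x. \<bar>s n x - Y x\<bar> \<partial>M) \<le> ennreal e"
        using le int by (subst (asm) nn_integral_eq_integral) auto
      then show ?thesis using int e by (simp add: ennreal_le_iff)
    qed
    then show ?thesis by blast
  qed
  obtain N where "integrable M (\<lambda>x. s N x - Y x)" using main[of 1] by auto
  from Bochner_Integration.integrable_diff[OF s[of N] this] have "integrable M Y" by simp
  moreover have "(\<lambda>n. \<integral>x. \<bar>s n x - Y x\<bar> \<partial>M) \<longlonglongrightarrow> 0"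
  proof (rule LIMSEQ_I)
    fix e :: real assume "0 < e"
    then obtain N where "\<forall>n\<ge>N. (\<integral>x. \<bar>s n x - Y x\<bar> \<partial>M) \<le> e / 2" using main[of "e / 2"] by auto
    with \<open>0 < e\<close> show "\<exists>N. \<forall>n\<ge>N. norm ((\<integral>x. \<bar>s n x - Y x\<bar> \<partial>M) - 0) < e"
      by (intro exI[of _ N]) force
  qed
  ultimately show ?thesis by (rule that)
qed

context cylinder_expectation
begin

text \<open>
  Functionals on the completion are handled on the linear space \<open>V\<close> of Cauchy sequences; \<open>cls X\<close> is
  the element of the completion represented by \<open>X\<close>.
\<close>

abbreviation "V \<equiv> LG_Cauchy T E"
abbreviation "cls X \<equiv> LG_rel T E `` {X}"

text \<open>
  The extended sublinear expectation, as a functional of Cauchy sequences.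
\<close>

definition E_lim :: "cyl_seq \<Rightarrow> real" where
  "E_lim X = lim (\<lambda>n. E (X n))"

lemma E_nonneg: "X \<in> Lip_cyl T \<Longrightarrow> (\<And>\<omega>. 0 \<le> X \<omega>) \<Longrightarrow> 0 \<le> E X"
  using E_mono[of "\<lambda>_. 0" X] by (simp add: E_const)

lemma E_diff_le:
  assumes "X \<in> Lip_cyl T" "Y \<in> Lip_cyl T"
  shows "E X - E Y \<le> E (\<lambda>\<omega>. X \<omega> - Y \<omega>)"
  using E_add[OF Lip_cyl_diff[OF assms] assms(2)] by simp

lemma E_abs_diff_le:
  assumes "X \<in> Lip_cyl T" "Y \<in> Lip_cyl T"
  shows "\<bar>E X - E Y\<bar> \<le> E (\<lambda>\<omega>. \<bar>X \<omega> - Y \<omega>\<bar>)"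
proof -
  have "E (\<lambda>\<omega>. X \<omega> - Y \<omega>) \<le> E (\<lambda>\<omega>. \<bar>X \<omega> - Y \<omega>\<bar>)" "E (\<lambda>\<omega>. Y \<omega> - X \<omega>) \<le> E (\<lambda>\<omega>. \<bar>X \<omega> - Y \<omega>\<bar>)"
    by (intro E_mono Lip_cyl_diff Lip_cyl_abs assms; simp)+
  then show ?thesis using E_diff_le[OF assms] E_diff_le[OF assms(2,1)] by linarith
qed

lemma E_triangle:
  assumes "X \<in> Lip_cyl T" "Y \<in> Lip_cyl T" "Z \<in> Lip_cyl T" "\<And>\<omega>. Z \<omega> \<le> X \<omega> + Y \<omega>"
  shows "E Z \<le> E X + E Y"
  using E_mono[OF assms(3) Lip_cyl_add[OF assms(1,2)] assms(4)] E_add[OF assms(1,2)] by linarith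

lemma V_cyl: "X \<in> V \<Longrightarrow> X n \<in> Lip_cyl T"
  by (simp add: LG_Cauchy_def)

lemma V_D: "X \<in> V \<Longrightarrow> 0 < e \<Longrightarrow> \<exists>N. \<forall>m\<ge>N. \<forall>n\<ge>N. E (\<lambda>\<omega>. \<bar>X m \<omega> - X n \<omega>\<bar>) < e"
  by (simp add: LG_Cauchy_def)

lemma V_I:
  assumes "\<And>n. X n \<in> Lip_cyl T" "\<And>e. 0 < e \<Longrightarrow> \<exists>N. \<forall>m\<ge>N. \<forall>n\<ge>N. E (\<lambda>\<omega>. \<bar>X m \<omega> - X n \<omega>\<bar>) < e"
  shows "X \<in> V"
  using assms by (simp add: LG_Cauchy_def)

lemma V_const: "Z \<in> Lip_cyl T \<Longrightarrow> (\<lambda>_. Z) \<in> V"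
  by (rule V_I) (auto simp: E_const)

lemma V_add:
  assumes X: "X \<in> V" and Y: "Y \<in> V"
  shows "(\<lambda>n \<omega>. X n \<omega> + Y n \<omega>) \<in> V"
proof (rule V_I)
  fix e :: real assume "0 < e"
  then obtain N N' where N: "\<forall>m\<ge>N. \<forall>n\<ge>N. E (\<lambda>\<omega>. \<bar>X m \<omega> - X n \<omega>\<bar>) < e / 2"
    "\<forall>m\<ge>N'. \<forall>n\<ge>N'. E (\<lambda>\<omega>. \<bar>Y m \<omega> - Y n \<omega>\<bar>) < e / 2"
    using V_D[OF X, of "e / 2"] V_D[OF Y, of "e / 2"] by auto
  have le: "E (\<lambda>\<omega>. \<bar>X m \<omega> + Y m \<omega> - (X n \<omega> + Y n \<omega>)\<bar>)
      \<le> E (\<lambda>\<omega>. \<bar>X m \<omega> - X n \<omega>\<bar>) + E (\<lambda>\<omega>. \<bar>Y m \<omega> - Y n \<omega>\<bar>)" for m n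
    by (intro E_triangle Lip_cyl_abs Lip_cyl_diff Lip_cyl_add V_cyl X Y) linarith
  have "E (\<lambda>\<omega>. \<bar>X m \<omega> + Y m \<omega> - (X n \<omega> + Y n \<omega>)\<bar>) < e"
    if "max N N' \<le> m" "max N N' \<le> n" for m n
  proof -
    have "E (\<lambda>\<omega>. \<bar>X m \<omega> - X n \<omega>\<bar>) < e / 2" "E (\<lambda>\<omega>. \<bar>Y m \<omega> - Y n \<omega>\<bar>) < e / 2"
      using N that by auto
    with le[of m n] show ?thesis by linarith
  qed
  then show "\<exists>N. \<forall>m\<ge>N. \<forall>n\<ge>N. E (\<lambda>\<omega>. \<bar>X m \<omega> + Y m \<omega> - (X n \<omega> + Y n \<omega>)\<bar>) < e" by blast
qed (intro Lip_cyl_add V_cyl X Y)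

lemma E_abs_scale:
  assumes "X \<in> Lip_cyl T" "Y \<in> Lip_cyl T"
  shows "E (\<lambda>\<omega>. \<bar>a * X \<omega> - a * Y \<omega>\<bar>) = \<bar>a\<bar> * E (\<lambda>\<omega>. \<bar>X \<omega> - Y \<omega>\<bar>)"
  using E_scale[OF Lip_cyl_abs[OF Lip_cyl_diff[OF assms]], of "\<bar>a\<bar>"]
  by (simp flip: abs_mult right_diff_distrib)

lemma V_scale:
  assumes X: "X \<in> V"
  shows "(\<lambda>n \<omega>. a * X n \<omega>) \<in> V"
proof (rule V_I)
  fix e :: real assume e: "0 < e"
  then obtain N where N: "\<forall>m\<ge>N. \<forall>n\<ge>N. E (\<lambda>\<omega>. \<bar>X m \<omega> - X n \<omega>\<bar>) < e / (\<bar>a\<bar> + 1)"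
    using V_D[OF X, of "e / (\<bar>a\<bar> + 1)"] by (auto simp: add_nonneg_pos)
  have "E (\<lambda>\<omega>. \<bar>a * X m \<omega> - a * X n \<omega>\<bar>) < e" if "N \<le> m" "N \<le> n" for m n
  proof -
    have nn: "0 \<le> E (\<lambda>\<omega>. \<bar>X m \<omega> - X n \<omega>\<bar>)"
      by (intro E_nonneg Lip_cyl_abs Lip_cyl_diff V_cyl X) simp
    have "\<bar>a\<bar> * E (\<lambda>\<omega>. \<bar>X m \<omega> - X n \<omega>\<bar>) \<le> (\<bar>a\<bar> + 1) * E (\<lambda>\<omega>. \<bar>X m \<omega> - X n \<omega>\<bar>)"
      using nn by (intro mult_right_mono) auto
    also have "\<dots> < e" using N that by (simp add: pos_less_divide_eq add_nonneg_pos mult.commute)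
    finally show ?thesis by (simp add: E_abs_scale V_cyl X)
  qed
  then show "\<exists>N. \<forall>m\<ge>N. \<forall>n\<ge>N. E (\<lambda>\<omega>. \<bar>a * X m \<omega> - a * X n \<omega>\<bar>) < e" by blast
qed (intro Lip_cyl_scale V_cyl X)

lemma subspace_V: "subspace V"
  unfolding subspace_def plus_fun_def scaleR_fun_def zero_fun_def real_scaleR_def
  using V_const[OF cyl_const, of 0] V_add V_scale by blast

lemma E_lim: "X \<in> V \<Longrightarrow> (\<lambda>n. E (X n)) \<longlonglongrightarrow> E_lim X"
proof -
  assume X: "X \<in> V"
  have "Cauchy (\<lambda>n. E (X n))"
  proof (rule CauchyI)
    fix e :: real assume "0 < e"
    then obtain N where N: "\<forall>m\<ge>N. \<forall>n\<ge>N. E (\<lambda>\<omega>. \<bar>X m \<omega> - X n \<omega>\<bar>) < e" using V_D[OF X] by blast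
    have "norm (E (X m) - E (X n)) < e" if "N \<le> m" "N \<le> n" for m n
      using N that E_abs_diff_le[OF V_cyl V_cyl, OF X X, of m n] by (auto intro: le_less_trans)
    then show "\<exists>M. \<forall>m\<ge>M. \<forall>n\<ge>M. norm (E (X m) - E (X n)) < e" by blast
  qed
  then show ?thesis by (simp add: E_lim_def Cauchy_convergent_iff convergent_LIMSEQ_iff)
qed

lemma E_lim_const: "E_lim (\<lambda>_. Z) = E Z"
  by (simp add: E_lim_def)

lemma sublinear_E_lim: "sublinear_on V E_lim"
proof (rule sublinear_onI)
  fix X Y assume X: "X \<in> V" and Y: "Y \<in> V"
  have "(\<lambda>n. E (\<lambda>\<omega>. X n \<omega> + Y n \<omega>)) \<longlonglongrightarrow> E_lim (X + Y)"
    using E_lim[OF V_add[OF X Y]] by (simp add: plus_fun_def)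
  moreover have "(\<lambda>n. E (X n) + E (Y n)) \<longlonglongrightarrow> E_lim X + E_lim Y"
    by (intro tendsto_intros E_lim X Y)
  ultimately show "E_lim (X + Y) \<le> E_lim X + E_lim Y"
    by (rule LIMSEQ_le) (use E_add V_cyl X Y in blast)
next
  fix X and a :: real assume X: "X \<in> V" and a: "0 \<le> a"
  have "(\<lambda>n. a * E (X n)) \<longlonglongrightarrow> a * E_lim X" by (intro tendsto_intros E_lim X)
  then have "(\<lambda>n. E (\<lambda>\<omega>. a * X n \<omega>)) \<longlonglongrightarrow> a * E_lim X"
    using E_scale[OF V_cyl[OF X] a] by simp
  moreover have "(\<lambda>n. E (\<lambda>\<omega>. a * X n \<omega>)) \<longlonglongrightarrow> E_lim (a *\<^sub>R X)"
    using E_lim[OF V_scale[OF X, of a]] by (simp add: scaleR_fun_def)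
  ultimately show "E_lim (a *\<^sub>R X) = a * E_lim X" by (rule LIMSEQ_unique[rotated])
qed

lemma rel_iff: "(X, Y) \<in> LG_rel T E \<longleftrightarrow> X \<in> V \<and> Y \<in> V \<and> (\<lambda>n. E (\<lambda>\<omega>. \<bar>X n \<omega> - Y n \<omega>\<bar>)) \<longlonglongrightarrow> 0"
  by (simp add: LG_rel_def)

lemma E_abs_tendsto_0:
  assumes "u \<longlonglongrightarrow> 0" "\<And>n. X n \<in> Lip_cyl T" "\<And>n. Y n \<in> Lip_cyl T"
    "\<And>n. E (\<lambda>\<omega>. \<bar>X n \<omega> - Y n \<omega>\<bar>) \<le> u n"
  shows "(\<lambda>n. E (\<lambda>\<omega>. \<bar>X n \<omega> - Y n \<omega>\<bar>)) \<longlonglongrightarrow> 0"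
  using assms by (intro tendsto_sandwich[OF _ _ tendsto_const assms(1)] always_eventually allI)
    (auto intro!: E_nonneg Lip_cyl_abs Lip_cyl_diff)

lemma equiv_rel: "equiv V (LG_rel T E)"
proof (rule equivI)
  show "LG_rel T E \<subseteq> V \<times> V" by (auto simp: rel_iff)
  show "refl_on V (LG_rel T E)" by (auto simp: refl_on_def rel_iff E_const)
  show "sym (LG_rel T E)" by (auto simp: sym_def rel_iff abs_minus_commute)
  show "trans (LG_rel T E)"
  proof (rule transI)
    fix X Y Z assume XY: "(X, Y) \<in> LG_rel T E" and YZ: "(Y, Z) \<in> LG_rel T E"
    have "(\<lambda>n. E (\<lambda>\<omega>. \<bar>X n \<omega> - Y n \<omega>\<bar>) + E (\<lambda>\<omega>. \<bar>Y n \<omega> - Z n \<omega>\<bar>)) \<longlonglongrightarrow> 0 + 0"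
      using XY YZ by (intro tendsto_add) (auto simp: rel_iff)
    then have "(\<lambda>n. E (\<lambda>\<omega>. \<bar>X n \<omega> - Z n \<omega>\<bar>)) \<longlonglongrightarrow> 0"
      using XY YZ unfolding add_0_right
      by (intro E_abs_tendsto_0[of "\<lambda>n. E (\<lambda>\<omega>. \<bar>X n \<omega> - Y n \<omega>\<bar>) + E (\<lambda>\<omega>. \<bar>Y n \<omega> - Z n \<omega>\<bar>)"] E_triangle
          Lip_cyl_abs Lip_cyl_diff V_cyl) (auto simp: rel_iff)
    then show "(X, Z) \<in> LG_rel T E" using XY YZ by (simp add: rel_iff)
  qed
qed

lemma rel_add:
  assumes "(X, X') \<in> LG_rel T E" "(Y, Y') \<in> LG_rel T E"
  shows "(\<lambda>n \<omega>. X n \<omega> + Y n \<omega>, \<lambda>n \<omega>. X' n \<omega> + Y' n \<omega>) \<in> LG_rel T E"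
proof -
  have mem: "X \<in> V" "X' \<in> V" "Y \<in> V" "Y' \<in> V" using assms by (auto simp: rel_iff)
  have "(\<lambda>n. E (\<lambda>\<omega>. \<bar>X n \<omega> - X' n \<omega>\<bar>) + E (\<lambda>\<omega>. \<bar>Y n \<omega> - Y' n \<omega>\<bar>)) \<longlonglongrightarrow> 0 + 0"
    using assms by (intro tendsto_add) (auto simp: rel_iff)
  then have "(\<lambda>n. E (\<lambda>\<omega>. \<bar>(X n \<omega> + Y n \<omega>) - (X' n \<omega> + Y' n \<omega>)\<bar>)) \<longlonglongrightarrow> 0"
    unfolding add_0_right
    by (rule E_abs_tendsto_0)
      (intro E_triangle Lip_cyl_abs Lip_cyl_diff Lip_cyl_add V_cyl mem; linarith)+
  then show ?thesis using V_add mem by (simp add: rel_iff)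
qed

lemma rel_scale:
  assumes "(X, X') \<in> LG_rel T E"
  shows "(\<lambda>n \<omega>. a * X n \<omega>, \<lambda>n \<omega>. a * X' n \<omega>) \<in> LG_rel T E"
proof -
  have mem: "X \<in> V" "X' \<in> V" using assms by (auto simp: rel_iff)
  have "(\<lambda>n. \<bar>a\<bar> * E (\<lambda>\<omega>. \<bar>X n \<omega> - X' n \<omega>\<bar>)) \<longlonglongrightarrow> \<bar>a\<bar> * 0"
    using assms by (intro tendsto_mult tendsto_const) (auto simp: rel_iff)
  then show ?thesis using V_scale mem by (simp add: rel_iff E_abs_scale V_cyl)
qed

lemma cls_mem: "X \<in> V \<Longrightarrow> X \<in> cls X"
  by (rule equiv_class_self[OF equiv_rel])

lemma cls_LG1: "X \<in> V \<Longrightarrow> cls X \<in> LG1 T E"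
  by (simp add: LG1_def quotientI)

lemma LG1_E:
  assumes "\<xi> \<in> LG1 T E"
  obtains X where "X \<in> V" "\<xi> = cls X"
  using assms unfolding LG1_def by (rule quotientE)

lemma LG_add_cls:
  assumes "X \<in> V" "Y \<in> V"
  shows "LG_add T E (cls X) (cls Y) = cls (\<lambda>n \<omega>. X n \<omega> + Y n \<omega>)"
proof -
  have "cls (\<lambda>n \<omega>. X' n \<omega> + Y' n \<omega>) = cls (\<lambda>n \<omega>. X n \<omega> + Y n \<omega>)" if "X' \<in> cls X" "Y' \<in> cls Y" for X' Y'
    using that rel_add[of X X' Y Y'] equiv_class_eq[OF equiv_rel] by blast
  then show ?thesis using cls_mem[OF assms(1)] cls_mem[OF assms(2)] unfolding LG_add_def by blast
qed

lemma LG_scale_cls: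
  assumes "X \<in> V"
  shows "LG_scale T E a (cls X) = cls (\<lambda>n \<omega>. a * X n \<omega>)"
proof -
  have "cls (\<lambda>n \<omega>. a * X' n \<omega>) = cls (\<lambda>n \<omega>. a * X n \<omega>)" if "X' \<in> cls X" for X'
    using that rel_scale[of X X' a] equiv_class_eq[OF equiv_rel] by blast
  then show ?thesis using cls_mem[OF assms] unfolding LG_scale_def by blast
qed

lemma G_exp_cls:
  assumes X: "X \<in> V"
  shows "G_exp E (cls X) = E_lim X"
proof -
  have "(\<lambda>n. E (Y n)) \<longlonglongrightarrow> E_lim X" if "Y \<in> cls X" for Y
  proof -
    have Y: "Y \<in> V" "(\<lambda>n. E (\<lambda>\<omega>. \<bar>X n \<omega> - Y n \<omega>\<bar>)) \<longlonglongrightarrow> 0" using that by (auto simp: rel_iff)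
    have "(\<lambda>n. E (X n) - E (Y n)) \<longlonglongrightarrow> 0"
      by (rule Lim_null_comparison[OF _ Y(2)]) (use E_abs_diff_le V_cyl X Y(1) in auto)
    from tendsto_diff[OF E_lim[OF X] this] show ?thesis by simp
  qed
  then show ?thesis
    unfolding G_exp_def using cls_mem[OF X] by (intro the_equality) (auto intro: LIMSEQ_unique)
qed

lemma represented_tendsto:
  assumes rep: "\<exists>Y. represents P \<zeta> Y" and X: "X \<in> \<zeta>"
  shows "integrable P (X n)" "(\<lambda>n. integral\<^sup>L P (X n)) \<longlonglongrightarrow> P_exp P \<zeta>"
proof -
  define Y where "Y = (SOME Y. represents P \<zeta> Y)"
  have "represents P \<zeta> Y" unfolding Y_def by (rule someI_ex[OF rep])
  then have Y: "integrable P Y" "\<And>n. integrable P (X n)" "(\<lambda>n. \<integral>\<omega>. \<bar>X n \<omega> - Y \<omega>\<bar> \<partial>P) \<longlonglongrightarrow> 0"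
    using X by (auto simp: represents_def)
  then show "integrable P (X n)" by blast
  have "(\<lambda>n. integral\<^sup>L P (X n) - integral\<^sup>L P Y) \<longlonglongrightarrow> 0"
  proof (rule Lim_null_comparison[OF _ Y(3)], intro always_eventually allI)
    fix n
    have "integral\<^sup>L P (X n) - integral\<^sup>L P Y = (\<integral>\<omega>. X n \<omega> - Y \<omega> \<partial>P)" using Y by simp
    then show "norm (integral\<^sup>L P (X n) - integral\<^sup>L P Y) \<le> (\<integral>\<omega>. \<bar>X n \<omega> - Y \<omega>\<bar> \<partial>P)"
      using integral_norm_bound[of P "\<lambda>\<omega>. X n \<omega> - Y \<omega>"] by (simp only: real_norm_def)
  qed
  then show "(\<lambda>n. integral\<^sup>L P (X n)) \<longlonglongrightarrow> P_exp P \<zeta>"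
    unfolding P_exp_def Y_def[symmetric] by (rule LIM_zero_cancel)
qed

lemma P_exp_tendsto:
  assumes P: "P \<in> rep_probs T E" and X: "X \<in> V"
  shows "integrable P (X n)" "(\<lambda>n. integral\<^sup>L P (X n)) \<longlonglongrightarrow> P_exp P (cls X)"
proof -
  have "\<exists>Y. represents P (cls X) Y" using P cls_LG1[OF X] by (auto simp: rep_probs_def)
  then show "integrable P (X n)" "(\<lambda>n. integral\<^sup>L P (X n)) \<longlonglongrightarrow> P_exp P (cls X)"
    using represented_tendsto cls_mem[OF X] by blast+
qed

lemma P_exp_le_G_exp: "P \<in> rep_probs T E \<Longrightarrow> \<xi> \<in> LG1 T E \<Longrightarrow> P_exp P \<xi> \<le> G_exp E \<xi>"
  by (simp add: rep_probs_def)

lemma P_exp_const_seq: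
  assumes P: "P \<in> rep_probs T E" and Z: "Z \<in> Lip_cyl T"
  shows "integrable P Z" "P_exp P (cls (\<lambda>_. Z)) = integral\<^sup>L P Z" "integral\<^sup>L P Z \<le> E Z"
proof -
  note V = V_const[OF Z]
  show "integrable P Z" using P_exp_tendsto(1)[OF P V] by simp
  have "(\<lambda>n. integral\<^sup>L P Z) \<longlonglongrightarrow> P_exp P (cls (\<lambda>_. Z))" using P_exp_tendsto(2)[OF P V] by simp
  then show eq: "P_exp P (cls (\<lambda>_. Z)) = integral\<^sup>L P Z" by (rule LIMSEQ_unique) simp
  show "integral\<^sup>L P Z \<le> E Z"
    using P_exp_le_G_exp[OF P cls_LG1[OF V]] G_exp_cls[OF V] by (simp add: eq E_lim_const)
qed

lemma P_exp_add:
  assumes P: "P \<in> rep_probs T E" and "\<xi> \<in> LG1 T E" "\<eta> \<in> LG1 T E"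
  shows "P_exp P (LG_add T E \<xi> \<eta>) = P_exp P \<xi> + P_exp P \<eta>"
proof -
  obtain X where X: "X \<in> V" "\<xi> = cls X" by (rule LG1_E[OF assms(2)])
  obtain Y where Y: "Y \<in> V" "\<eta> = cls Y" by (rule LG1_E[OF assms(3)])
  have "(\<lambda>n. integral\<^sup>L P (X n) + integral\<^sup>L P (Y n)) \<longlonglongrightarrow> P_exp P \<xi> + P_exp P \<eta>"
    unfolding X(2) Y(2) by (intro tendsto_intros P_exp_tendsto P X Y)
  moreover have "(\<integral>\<omega>. X n \<omega> + Y n \<omega> \<partial>P) = integral\<^sup>L P (X n) + integral\<^sup>L P (Y n)" for n
    using P_exp_tendsto(1)[OF P] X Y by simp
  ultimately have "(\<lambda>n. \<integral>\<omega>. X n \<omega> + Y n \<omega> \<partial>P) \<longlonglongrightarrow> P_exp P \<xi> + P_exp P \<eta>" by simp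
  moreover have "(\<lambda>n. \<integral>\<omega>. X n \<omega> + Y n \<omega> \<partial>P) \<longlonglongrightarrow> P_exp P (LG_add T E \<xi> \<eta>)"
    using P_exp_tendsto(2)[OF P V_add[OF X(1) Y(1)]] by (simp add: X(2) Y(2) LG_add_cls X(1) Y(1))
  ultimately show ?thesis by (rule LIMSEQ_unique[rotated])
qed

lemma P_exp_scale:
  assumes P: "P \<in> rep_probs T E" and "\<xi> \<in> LG1 T E"
  shows "P_exp P (LG_scale T E a \<xi>) = a * P_exp P \<xi>"
proof -
  obtain X where X: "X \<in> V" "\<xi> = cls X" by (rule LG1_E[OF assms(2)])
  have "(\<lambda>n. a * integral\<^sup>L P (X n)) \<longlonglongrightarrow> a * P_exp P \<xi>"
    unfolding X(2) by (intro tendsto_intros P_exp_tendsto P X)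
  then have "(\<lambda>n. \<integral>\<omega>. a * X n \<omega> \<partial>P) \<longlonglongrightarrow> a * P_exp P \<xi>" by simp
  moreover have "(\<lambda>n. \<integral>\<omega>. a * X n \<omega> \<partial>P) \<longlonglongrightarrow> P_exp P (LG_scale T E a \<xi>)"
    using P_exp_tendsto(2)[OF P V_scale[OF X(1), of a]] by (simp add: X(2) LG_scale_cls X(1))
  ultimately show ?thesis by (rule LIMSEQ_unique[rotated])
qed

lemma P_exp_const:
  assumes P: "P \<in> rep_probs T E"
  shows "P_exp P (LG_const T E c) = c"
proof -
  have "prob_space P" using P by (simp add: rep_probs_def)
  then show ?thesis
    using P_exp_const_seq(2)[OF P cyl_const, of c] by (simp add: LG_const_def prob_space.prob_space)
qed

lemma P_exp_mono:
  assumes P: "P \<in> rep_probs T E" and "\<xi> \<in> LG1 T E" "\<eta> \<in> LG1 T E" and le: "LG_le E \<xi> \<eta>"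
  shows "P_exp P \<xi> \<le> P_exp P \<eta>"
proof -
  obtain X where X: "X \<in> V" "\<xi> = cls X" by (rule LG1_E[OF assms(2)])
  obtain Y where Y: "Y \<in> V" "\<eta> = cls Y" by (rule LG1_E[OF assms(3)])
  have "(\<lambda>n. integral\<^sup>L P (X n) - integral\<^sup>L P (Y n)) \<longlonglongrightarrow> P_exp P \<xi> - P_exp P \<eta>"
    unfolding X(2) Y(2) by (intro tendsto_intros P_exp_tendsto P X Y)
  moreover have "(\<lambda>n. E (\<lambda>\<omega>. max (X n \<omega> - Y n \<omega>) 0)) \<longlonglongrightarrow> 0"
    using le cls_mem X Y by (auto simp: LG_le_def)
  ultimately have "P_exp P \<xi> - P_exp P \<eta> \<le> 0"
  proof (rule LIMSEQ_le, intro exI allI impI)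
    fix n
    have cyl: "(\<lambda>\<omega>. max (X n \<omega> - Y n \<omega>) 0) \<in> Lip_cyl T"
      by (intro Lip_cyl_pos_part Lip_cyl_diff V_cyl X Y)
    have "integral\<^sup>L P (X n) - integral\<^sup>L P (Y n) = (\<integral>\<omega>. X n \<omega> - Y n \<omega> \<partial>P)"
      using P_exp_tendsto(1)[OF P] X Y by simp
    also have "\<dots> \<le> (\<integral>\<omega>. max (X n \<omega> - Y n \<omega>) 0 \<partial>P)"
      by (intro integral_mono P_exp_const_seq(1)[OF P] Lip_cyl_diff V_cyl X Y cyl) simp
    also have "\<dots> \<le> E (\<lambda>\<omega>. max (X n \<omega> - Y n \<omega>) 0)" by (rule P_exp_const_seq(3)[OF P cyl])
    finally show "integral\<^sup>L P (X n) - integral\<^sup>L P (Y n) \<le> E (\<lambda>\<omega>. max (X n \<omega> - Y n \<omega>) 0)" .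
  qed
  then show ?thesis by simp
qed

text \<open>
  Representation theorem: a linear functional on the Cauchy sequences below the extended
  sublinear expectation is the expectation under one of the representing probabilities.
\<close>

lemma linear_functional_represented:
  assumes lin_add: "\<And>X Y. X \<in> V \<Longrightarrow> Y \<in> V \<Longrightarrow> f (X + Y) = f X + f Y"
    and lin_scale: "\<And>a X. X \<in> V \<Longrightarrow> f (a *\<^sub>R X) = a * f X"
    and lin_le: "\<And>X. X \<in> V \<Longrightarrow> f X \<le> E_lim X"
  obtains P where "P \<in> rep_probs T E" "\<And>X. X \<in> V \<Longrightarrow> P_exp P (cls X) = f X"
proof -
  define g where "g Z = f (\<lambda>_. Z)" for Z :: "(real \<Rightarrow> real) \<Rightarrow> real"
  interpret dominated_functional T E C g
  proof
    fix X Y assume "X \<in> Lip_cyl T" "Y \<in> Lip_cyl T"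
    then show "g (\<lambda>\<omega>. X \<omega> + Y \<omega>) = g X + g Y"
      using lin_add[OF V_const V_const, of X Y] by (simp add: g_def plus_fun_def)
  next
    fix a X assume "X \<in> Lip_cyl T"
    then show "g (\<lambda>\<omega>. a * X \<omega>) = a * g X"
      using lin_scale[OF V_const, of X a] by (simp add: g_def scaleR_fun_def)
  next
    fix X assume "X \<in> Lip_cyl T"
    then show "g X \<le> E X" using lin_le[OF V_const, of X] by (simp add: g_def E_lim_const)
  qed
  obtain P where P: "prob_space P" "sets P = sets (path_borel T)"
    "\<And>X. X \<in> Lip_cyl T \<Longrightarrow> integrable P X" "\<And>X. X \<in> Lip_cyl T \<Longrightarrow> integral\<^sup>L P X = g X"
    by (rule path_measure_exists) blast
  have P_le: "integral\<^sup>L P X \<le> E X" if "X \<in> Lip_cyl T" for X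
    using P(4)[OF that] g_def lin_le[OF V_const[OF that]] by (simp add: E_lim_const)
  have lim: "(\<lambda>n. integral\<^sup>L P (X n)) \<longlonglongrightarrow> f X" if X: "X \<in> V" for X
  proof (rule LIMSEQ_I)
    fix e :: real assume e: "0 < e"
    then obtain N where N: "\<forall>m\<ge>N. \<forall>n\<ge>N. E (\<lambda>\<omega>. \<bar>X m \<omega> - X n \<omega>\<bar>) < e / 2"
      using V_D[OF X, of "e / 2"] by auto
    have "\<bar>integral\<^sup>L P (X n) - f X\<bar> \<le> e / 2" if n: "N \<le> n" for n
    proof -
      \<comment> \<open>\<open>X\<close> is within \<open>e / 2\<close> of the constant sequence with value \<open>X n\<close>, from above and from below\<close>
      note Xn = V_cyl[OF X, of n]
      have close: "f W \<le> e / 2" if W: "W \<in> V" "\<And>m \<omega>. W m \<omega> \<le> \<bar>X m \<omega> - X n \<omega>\<bar>" for W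
      proof -
        have "E (W m) \<le> E (\<lambda>\<omega>. \<bar>X m \<omega> - X n \<omega>\<bar>)" for m
          by (intro E_mono V_cyl Lip_cyl_abs Lip_cyl_diff X W)
        then have "\<forall>m\<ge>N. E (W m) \<le> e / 2" using N n by (meson less_imp_le order_trans)
        then have "E_lim W \<le> e / 2" by (intro LIMSEQ_le_const2[OF E_lim[OF W(1)]]) blast
        then show ?thesis using lin_le[OF W(1)] by linarith
      qed
      have diff: "f X - integral\<^sup>L P (X n) = f (\<lambda>m \<omega>. X m \<omega> + (- 1) * X n \<omega>)"
        "integral\<^sup>L P (X n) - f X = f (\<lambda>m \<omega>. X n \<omega> + (- 1) * X m \<omega>)"
        using lin_add[OF X V_scale[OF V_const[OF Xn], of "- 1"]] lin_scale[OF V_const[OF Xn], of "- 1"]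
          lin_add[OF V_const[OF Xn] V_scale[OF X, of "- 1"]] lin_scale[OF X, of "- 1"] P(4)[OF Xn]
        by (simp_all add: g_def plus_fun_def scaleR_fun_def)
      have "f X - integral\<^sup>L P (X n) \<le> e / 2"
        unfolding diff(1) by (intro close V_add V_scale[OF V_const[OF Xn]] X) auto
      moreover have "integral\<^sup>L P (X n) - f X \<le> e / 2"
        unfolding diff(2) by (intro close V_add V_scale[OF X] V_const[OF Xn]) auto
      ultimately show ?thesis by linarith
    qed
    then show "\<exists>N. \<forall>n\<ge>N. norm (integral\<^sup>L P (X n) - f X) < e"
      using e by (intro exI[of _ N]) (force simp: real_norm_def)
  qed
  have rep: "\<exists>Y. represents P (cls X) Y" if X: "X \<in> V" for X
  proof -
    have int_le: "(\<integral>\<omega>. \<bar>X1 \<omega> - X2 \<omega>\<bar> \<partial>P) \<le> E (\<lambda>\<omega>. \<bar>X1 \<omega> - X2 \<omega>\<bar>)"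
      if "X1 \<in> Lip_cyl T" "X2 \<in> Lip_cyl T" for X1 X2
      by (intro P_le Lip_cyl_abs Lip_cyl_diff that)
    obtain Y where Y: "integrable P Y" "(\<lambda>n. \<integral>\<omega>. \<bar>X n \<omega> - Y \<omega>\<bar> \<partial>P) \<longlonglongrightarrow> 0"
    proof (rule L1_complete[of P X])
      show "integrable P (X n)" for n by (intro P V_cyl X)
      fix e :: real assume "0 < e"
      then obtain N where "\<forall>m\<ge>N. \<forall>n\<ge>N. E (\<lambda>\<omega>. \<bar>X m \<omega> - X n \<omega>\<bar>) < e" using V_D[OF X] by blast
      then show "\<exists>N. \<forall>m\<ge>N. \<forall>n\<ge>N. (\<integral>\<omega>. \<bar>X m \<omega> - X n \<omega>\<bar> \<partial>P) < e"
        using int_le[OF V_cyl V_cyl, OF X X] by (meson le_less_trans)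
    qed
    have "(\<lambda>n. \<integral>\<omega>. \<bar>X' n \<omega> - Y \<omega>\<bar> \<partial>P) \<longlonglongrightarrow> 0" if "X' \<in> cls X" for X'
    proof -
      have X': "X' \<in> V" "(\<lambda>n. E (\<lambda>\<omega>. \<bar>X n \<omega> - X' n \<omega>\<bar>)) \<longlonglongrightarrow> 0" using that by (auto simp: rel_iff)
      have lim0: "(\<lambda>n. E (\<lambda>\<omega>. \<bar>X n \<omega> - X' n \<omega>\<bar>) + (\<integral>\<omega>. \<bar>X n \<omega> - Y \<omega>\<bar> \<partial>P)) \<longlonglongrightarrow> 0 + 0"
        by (intro tendsto_add X' Y)
      show ?thesis
      proof (rule tendsto_sandwich[OF _ _ tendsto_const lim0[unfolded add_0_right]])
        show "\<forall>\<^sub>F n in sequentially. (\<integral>\<omega>. \<bar>X' n \<omega> - Y \<omega>\<bar> \<partial>P)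
            \<le> E (\<lambda>\<omega>. \<bar>X n \<omega> - X' n \<omega>\<bar>) + (\<integral>\<omega>. \<bar>X n \<omega> - Y \<omega>\<bar> \<partial>P)"
        proof (intro always_eventually allI)
          fix n
          have int: "integrable P (X n)" "integrable P (X' n)" by (intro P V_cyl X X')+
          have "(\<integral>\<omega>. \<bar>X' n \<omega> - Y \<omega>\<bar> \<partial>P) \<le> (\<integral>\<omega>. \<bar>X n \<omega> - X' n \<omega>\<bar> + \<bar>X n \<omega> - Y \<omega>\<bar> \<partial>P)"
            using int Y(1) by (intro integral_mono) auto
          also have "\<dots> = (\<integral>\<omega>. \<bar>X n \<omega> - X' n \<omega>\<bar> \<partial>P) + (\<integral>\<omega>. \<bar>X n \<omega> - Y \<omega>\<bar> \<partial>P)"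
            using int Y(1) by simp
          finally show "(\<integral>\<omega>. \<bar>X' n \<omega> - Y \<omega>\<bar> \<partial>P)
            \<le> E (\<lambda>\<omega>. \<bar>X n \<omega> - X' n \<omega>\<bar>) + (\<integral>\<omega>. \<bar>X n \<omega> - Y \<omega>\<bar> \<partial>P)"
            using int_le[OF V_cyl[OF X, of n] V_cyl[OF X'(1), of n]] by linarith
        qed
      qed (auto intro!: always_eventually)
    qed
    moreover have "integrable P (X' n)" if "X' \<in> cls X" for X' n
      using that by (intro P V_cyl) (auto simp: rel_iff)
    ultimately have "represents P (cls X) Y" using Y(1) by (simp add: represents_def)
    then show ?thesis by blast
  qed
  have P_exp_eq: "P_exp P (cls X) = f X" if X: "X \<in> V" for X
    using represented_tendsto(2)[OF rep[OF X] cls_mem[OF X]] lim[OF X] by (rule LIMSEQ_unique)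
  have "P \<in> rep_probs T E"
    unfolding rep_probs_def
  proof (intro CollectI conjI ballI P)
    fix \<xi> assume "\<xi> \<in> LG1 T E"
    then obtain X where X: "X \<in> V" "\<xi> = cls X" by (rule LG1_E)
    show "\<exists>Y. represents P \<xi> Y" using rep X by simp
    show "P_exp P \<xi> \<le> G_exp E \<xi>" using lin_le[OF X(1)] by (simp add: X P_exp_eq G_exp_cls)
  qed
  then show ?thesis using P_exp_eq by (rule that)
qed

end


section \<open>The right derivative of the expectation\<close>

context cylinder_expectation
begin

text \<open>
  The directional derivative \<open>p\<close> of the extended expectation at \<open>\<xi>\<close> gives the right derivative
  \<open>D = p \<eta>\<close>, and its own directional derivative at \<open>\<eta>\<close> dominates some linear functional. That functional
  takes the maximal value at \<open>\<xi>\<close> and the value \<open>D\<close> at \<open>\<eta>\<close>, and it is represented by a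
  probability. Every other maximizer for \<open>\<xi>\<close> is compared with \<open>D\<close> through the difference quotients.
\<close>

lemma right_derivative_attained:
  assumes \<xi>: "\<xi> \<in> LG1 T E" and \<eta>: "\<eta> \<in> LG1 T E"
  obtains P D where "P \<in> max_probs T E \<xi>" "P_exp P \<eta> = D"
    "((\<lambda>e. (G_exp E (LG_add T E \<xi> (LG_scale T E e \<eta>)) - G_exp E \<xi>) / e) \<longlongrightarrow> D) (at_right 0)"
    "\<And>Q. Q \<in> max_probs T E \<xi> \<Longrightarrow> P_exp Q \<eta> \<le> D"
proof -
  obtain X where X: "X \<in> V" "\<xi> = cls X" by (rule LG1_E[OF \<xi>])
  obtain Y where Y: "Y \<in> V" "\<eta> = cls Y" by (rule LG1_E[OF \<eta>])
  obtain p where p: "sublinear_on V p" "\<And>W. W \<in> V \<Longrightarrow> p W \<le> E_lim W" "p X = E_lim X" "p (- X) = - E_lim X"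
    "\<And>W. W \<in> V \<Longrightarrow> ((\<lambda>e. (E_lim (X + e *\<^sub>R W) - E_lim X) / e) \<longlongrightarrow> p W) (at_right 0)"
    by (rule sublinear_directional_derivative[OF subspace_V sublinear_E_lim X(1)]) blast
  obtain q where q: "sublinear_on V q" "\<And>W. W \<in> V \<Longrightarrow> q W \<le> p W" "q Y = p Y" "q (- Y) = - p Y"
    by (rule sublinear_directional_derivative[OF subspace_V p(1) Y(1)]) blast
  obtain f where f: "\<And>X Y. X \<in> V \<Longrightarrow> Y \<in> V \<Longrightarrow> f (X + Y) = f X + f Y"
    "\<And>a X. X \<in> V \<Longrightarrow> f (a *\<^sub>R X) = a * f X" "\<And>X. X \<in> V \<Longrightarrow> f X \<le> q X"
    by (rule sublinear_dominates_linear[OF subspace_V q(1)]) blast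
  have neg: "- W \<in> V" "f (- W) = - f W" if "W \<in> V" for W
    using subspace_neg[OF subspace_V that] f(2)[OF that, of "- 1"] by auto
  have fX: "f X = E_lim X"
    using f(3)[OF X(1)] f(3)[OF neg(1)[OF X(1)]] neg(2)[OF X(1)] q(2)[OF X(1)] q(2)[OF neg(1)[OF X(1)]] p(3,4)
    by linarith
  have fY: "f Y = p Y"
    using f(3)[OF Y(1)] f(3)[OF neg(1)[OF Y(1)]] neg(2)[OF Y(1)] q(3,4) by linarith
  have f_le: "f W \<le> E_lim W" if "W \<in> V" for W
    using f(3)[OF that] q(2)[OF that] p(2)[OF that] by linarith
  obtain P where P: "P \<in> rep_probs T E" "\<And>W. W \<in> V \<Longrightarrow> P_exp P (cls W) = f W"
  proof (rule linear_functional_represented[of f])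
    fix P assume "P \<in> rep_probs T E" "\<And>W. W \<in> V \<Longrightarrow> P_exp P (cls W) = f W"
    then show thesis by (rule that)
  qed (simp_all add: f(1,2) f_le)
  have G: "G_exp E (LG_add T E \<xi> (LG_scale T E e \<eta>)) = E_lim (X + e *\<^sub>R Y)" for e
    using X Y V_scale[OF Y(1), of e] V_add[OF X(1) V_scale[OF Y(1), of e]]
    by (simp add: LG_scale_cls LG_add_cls G_exp_cls plus_fun_def scaleR_fun_def)
  have G_\<xi>: "G_exp E \<xi> = E_lim X" using X by (simp add: G_exp_cls)
  have lim: "((\<lambda>e. (G_exp E (LG_add T E \<xi> (LG_scale T E e \<eta>)) - G_exp E \<xi>) / e) \<longlongrightarrow> p Y) (at_right 0)"
    using p(5)[OF Y(1)] by (simp add: G G_\<xi>)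
  show ?thesis
  proof (rule that[OF _ _ lim])
    show "P \<in> max_probs T E \<xi>" using P X fX by (simp add: max_probs_def G_exp_cls)
    show "P_exp P \<eta> = p Y" using P(2) Y fY by simp
    fix Q assume "Q \<in> max_probs T E \<xi>"
    then have Q: "Q \<in> rep_probs T E" "P_exp Q \<xi> = G_exp E \<xi>" by (auto simp: max_probs_def)
    show "P_exp Q \<eta> \<le> p Y"
    proof (rule tendsto_lowerbound[OF lim])
      have "P_exp Q \<eta> \<le> (G_exp E (LG_add T E \<xi> (LG_scale T E e \<eta>)) - G_exp E \<xi>) / e" if "0 < e" for e
      proof -
        have mem: "LG_scale T E e \<eta> \<in> LG1 T E" "LG_add T E \<xi> (LG_scale T E e \<eta>) \<in> LG1 T E"
          using X Y by (auto simp: LG_scale_cls LG_add_cls V_scale V_add intro!: cls_LG1)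
        have "G_exp E \<xi> + e * P_exp Q \<eta> \<le> G_exp E (LG_add T E \<xi> (LG_scale T E e \<eta>))"
          using P_exp_le_G_exp[OF Q(1) mem(2)] P_exp_add[OF Q(1) \<xi> mem(1)] P_exp_scale[OF Q(1) \<eta>] Q(2) by simp
        then show ?thesis using that by (simp add: field_simps)
      qed
      then show "\<forall>\<^sub>F e in at_right 0. P_exp Q \<eta> \<le> (G_exp E (LG_add T E \<xi> (LG_scale T E e \<eta>)) - G_exp E \<xi>) / e"
        by (intro eventually_mono[OF eventually_at_right_less])
    qed simp
  qed
qed

end

theorem lemma4p4:
  fixes T \<sigma>l \<sigma>u :: real
    and H :: "('w \<Rightarrow> real) set" and E' :: "('w \<Rightarrow> real) \<Rightarrow> real" and Z :: "nat \<Rightarrow> 'w \<Rightarrow> real"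
    and E :: "((real \<Rightarrow> real) \<Rightarrow> real) \<Rightarrow> real"
    and \<xi> \<eta> :: "cyl_seq set"
  assumes "0 < T" and "0 < \<sigma>l\<^sup>2" and "\<sigma>l\<^sup>2 \<le> \<sigma>u\<^sup>2"
    and "sublinear_expectation_space H E'"
    and "G_normal_seq H E' \<sigma>l \<sigma>u Z"
    and "G_expectation T E' Z E"
    and "\<xi> \<in> LG1 T E" and "\<eta> \<in> LG1 T E"
  shows "(let F = (\<lambda>l. G_exp E (LG_add T E \<xi> (LG_scale T E l \<eta>)))
          in ((\<lambda>e. (F e - F 0) / e) \<longlongrightarrow> crit_exp T E \<xi> \<eta>) (at_right 0))
       \<and> (\<exists>P\<in>max_probs T E \<xi>. P_exp P \<eta> = crit_exp T E \<xi> \<eta> \<and>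
            (\<forall>Q\<in>max_probs T E \<xi>. P_exp Q \<eta> \<le> P_exp P \<eta>))
       \<and> sublinear_expectation (LG1 T E) (LG_le E) (LG_const T E) (LG_add T E) (LG_scale T E)
            (crit_exp T E \<xi>)
       \<and> (\<forall>\<zeta>\<in>LG1 T E. crit_exp T E \<xi> \<zeta> \<le> G_exp E \<zeta>)"
proof -
  obtain C where "cylinder_expectation T E C"
    using cylinder_expectation_of_G_expectation[OF assms(1,4-6)] by blast
  then interpret cylinder_expectation T E C .
  note \<xi> = assms(7) and \<eta> = assms(8)
  let ?M = "max_probs T E \<xi>"
  have rep: "P \<in> rep_probs T E" if "P \<in> ?M" for P using that by (simp add: max_probs_def)
  have ne: "?M \<noteq> {}" using right_derivative_attained[OF \<xi> \<xi>] by blast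
  have le: "P_exp P \<zeta> \<le> G_exp E \<zeta>" if "P \<in> ?M" "\<zeta> \<in> LG1 T E" for P \<zeta>
    using P_exp_le_G_exp[OF rep[OF that(1)] that(2)] .
  have upper: "P_exp P \<zeta> \<le> crit_exp T E \<xi> \<zeta>" if "P \<in> ?M" "\<zeta> \<in> LG1 T E" for P \<zeta>
    unfolding crit_exp_def using le that by (intro cSUP_upper bdd_aboveI2[of _ _ "G_exp E \<zeta>"]) auto
  have least: "crit_exp T E \<xi> \<zeta> \<le> b" if "\<And>P. P \<in> ?M \<Longrightarrow> P_exp P \<zeta> \<le> b" for \<zeta> b
    unfolding crit_exp_def using ne that by (intro cSUP_least)
  obtain P D where P: "P \<in> ?M" "P_exp P \<eta> = D"
    and lim: "((\<lambda>e. (G_exp E (LG_add T E \<xi> (LG_scale T E e \<eta>)) - G_exp E \<xi>) / e) \<longlongrightarrow> D) (at_right 0)"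
    and D: "\<And>Q. Q \<in> ?M \<Longrightarrow> P_exp Q \<eta> \<le> D"
    by (rule right_derivative_attained[OF \<xi> \<eta>]) blast
  have crit: "crit_exp T E \<xi> \<eta> = D"
    using upper[OF P(1) \<eta>] least[OF D] P(2) by simp
  have F0: "G_exp E (LG_add T E \<xi> (LG_scale T E 0 \<eta>)) = G_exp E \<xi>"
  proof -
    obtain X where X: "X \<in> V" "\<xi> = cls X" by (rule LG1_E[OF \<xi>])
  obtain Y where Y: "Y \<in> V" "\<eta> = cls Y" by (rule LG1_E[OF \<eta>])
    show ?thesis using X Y V_scale[OF Y(1), of 0] by (simp add: LG_scale_cls LG_add_cls)
  qed
  have "sublinear_expectation (LG1 T E) (LG_le E) (LG_const T E) (LG_add T E) (LG_scale T E) (crit_exp T E \<xi>)"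
    unfolding sublinear_expectation_def
  proof (intro conjI ballI allI impI)
    fix X Y assume XY: "X \<in> LG1 T E" "Y \<in> LG1 T E"
    show "crit_exp T E \<xi> X \<le> crit_exp T E \<xi> Y" if "LG_le E X Y"
    proof (rule least)
      fix P assume P: "P \<in> ?M"
      show "P_exp P X \<le> crit_exp T E \<xi> Y"
        using P_exp_mono[OF rep[OF P] XY that] upper[OF P XY(2)] by linarith
    qed
    show "crit_exp T E \<xi> (LG_add T E X Y) \<le> crit_exp T E \<xi> X + crit_exp T E \<xi> Y"
    proof (rule least)
      fix P assume P: "P \<in> ?M"
      show "P_exp P (LG_add T E X Y) \<le> crit_exp T E \<xi> X + crit_exp T E \<xi> Y"
        using P_exp_add[OF rep[OF P] XY] upper[OF P XY(1)] upper[OF P XY(2)] by linarith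
    qed
  next
    fix c
    have "P_exp P (LG_const T E c) = c" if "P \<in> ?M" for P using P_exp_const[OF rep[OF that]] .
    then show "crit_exp T E \<xi> (LG_const T E c) = c"
      unfolding crit_exp_def using ne by simp
  next
    fix X and a :: real assume X: "X \<in> LG1 T E" and a: "0 \<le> a"
    have mem: "LG_scale T E a X \<in> LG1 T E"
    proof -
      obtain W where "W \<in> V" "X = cls W" using X by (rule LG1_E)
      then show ?thesis by (simp add: LG_scale_cls V_scale cls_LG1)
    qed
    have eq: "P_exp P (LG_scale T E a X) = a * P_exp P X" if "P \<in> ?M" for P
      using P_exp_scale[OF rep[OF that] X] .
    show "crit_exp T E \<xi> (LG_scale T E a X) = a * crit_exp T E \<xi> X"
    proof (rule antisym)
      show "crit_exp T E \<xi> (LG_scale T E a X) \<le> a * crit_exp T E \<xi> X"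
        by (rule least) (simp add: eq mult_left_mono a upper X)
      show "a * crit_exp T E \<xi> X \<le> crit_exp T E \<xi> (LG_scale T E a X)"
      proof -
        \<comment> \<open>the supremum at \<open>X\<close> is attained\<close>
        obtain Q D' where Q: "Q \<in> ?M" "P_exp Q X = D'" "\<And>R. R \<in> ?M \<Longrightarrow> P_exp R X \<le> D'"
          by (rule right_derivative_attained[OF \<xi> X]) blast
        have "a * crit_exp T E \<xi> X \<le> a * P_exp Q X"
          using Q a by (intro mult_left_mono least) auto
        then show ?thesis using upper[OF Q(1) mem] eq[OF Q(1)] by linarith
      qed
    qed
  qed
  then show ?thesis
    unfolding Let_def F0 crit using lim P D least le by auto
qed

end
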